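(* Let $A$ be a Green biset functor (for $\mathcal{D}$ over $k$). Then $\widehat{\mathcal{S}}upp(A_G)=\widehat{\mathcal{S}}upp(A)$ for all $G$ in $Ob(\mathcal{D})$.
   Context: Conventions. $k$ is a commutative ring; all groups are finite; rings and algebras are associative and unital, and homomorphisms preserve units. Bisets. For groups $H,G$, an $(H,G)$-biset is a finite set with commuting left $H$-action and right $G$-action. $B(H,G)$ is the Grothendieck group of the category of $(H,G)$-bisets with respect to disjoint union. If $Y$ is a $(K,H)$-biset and $X$ an $(H,G)$-biset, $Y\circ X=Y\times_H X$ is the set of $H$-orbits of $Y\times X$ under $h\cdot(y,x)=(yh^{-1},hx)$, a $(K,G)$-biset. The biset category $\mathcal{C}$ has all finite groups as objects, $\mathcal{C}(G,H)=B(H,G)$, composition induced by $\circ$, and identity $Id_G=[G]$. $\mathcal{D}$ is a full subcategory of $\mathcal{C}$ such that any group isomorphic to a subquotient of an object of $\mathcal{D}$ or to a product of two objects of $\mathcal{D}$ is an object of $\mathcal{D}$; $k\mathcal{D}$ is its $k$-linearization. A biset functor is a $k$-linear functor $k\mathcal{D}\to k\text{-Mod}$; morphisms are natural transformations. For an isomorphism $\psi:H\to G$, $Iso(\psi)$ is the $(G,H)$-biset $G$ with $g\cdot x\cdot h=gx\psi(h)$. The inflation $Inf_H^{H\times G}$ is the $(H\times G,H)$-biset $H$ with $(h,g)\cdot x\cdot h'=hxh'$. The external product of an $(L,K)$-biset $Y$ and an $(H,G)$-biset $X$ is the $(L\times H,K\times G)$-biset $Y\times X$ with $(l,h)(y,x)(k,g)=(lyk,hxg)$,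 extended bilinearly to $(\alpha,\beta)\mapsto\alpha\times\beta$. Green biset functors. A Green biset functor is a biset functor $A$ with bilinear products $A(K)\times A(H)\to A(K\times H)$, $(a,b)\mapsto a\times b$, for all objects $K,H$, and an element $\epsilon_A\in A(1)$, such that: (1) $(a\times b)\times c=A(Iso(\alpha_{L,K,H}))(a\times(b\times c))$ for $a\in A(L)$, $b\in A(K)$, $c\in A(H)$, with $\alpha_{L,K,H}:L\times(K\times H)\to(L\times K)\times H$ the canonical isomorphism; (2) $A(Iso(\lambda_H))(\epsilon_A\times a)=a=A(Iso(\rho_H))(a\times\epsilon_A)$ for $a\in A(H)$, with $\lambda_H:1\times H\to H$ and $\rho_H:H\times 1\to H$ canonical; (3) $A(\alpha\times\beta)(a\times b)=A(\alpha)(a)\times A(\beta)(b)$ for all morphisms $\alpha:K\to T$, $\beta:H\to L$ of $k\mathcal{D}$ and $a\in A(K)$, $b\in A(H)$. Associated category. $\overrightarrow{H}$ is the $(H\times H,1)$-biset $H$ with $(h_1,h_2)\cdot h\cdot 1=h_1hh_2^{-1}$; $\overleftarrow{H}$ is its opposite, a $(1,H\times H)$-biset. The category $\mathcal{P}_A$ has the objects of $\mathcal{D}$, $\mathcal{P}_A(H,K)=A(K\times H)$, composition $\beta\circ\alpha=A(L\times\overleftarrow{K}\times H)(\beta\times\alpha)$ for $\beta\in A(L\times K)$, $\alpha\in A(K\times H)$, and identities $Id_H=A(\overrightarrow{H})(\epsilon_A)$. Essential algebra and support. For an object $H$, $\widehat{A}(H)=End_{\mathcal{P}_A}(H)/I_A(H)$,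 where $I_A(H)$ is the $k$-submodule (a two-sided ideal) generated by the endomorphisms of $H$ in $\mathcal{P}_A$ which factor through groups (objects of $\mathcal{P}_A$) of order strictly smaller than $|H|$. The essential support $\widehat{\mathcal{S}}upp(A)$ is the class of objects $H$ of $\mathcal{D}$ with $\widehat{A}(H)\neq 0$. Shifted functor. For an object $G$ of $\mathcal{D}$, $A_G$ is the biset functor with $A_G(H)=A(H\times G)$ and $A_G(\alpha)=A(\alpha\times Id_G)$. It is a Green biset functor with products $\times^d:A_G(K)\times A_G(H)\to A_G(K\times H)$ given by $a\times^d b=A(U_{K,H})(a\times b)$ for $a\in A(K\times G)$, $b\in A(H\times G)$, where $U_{K,H}$ is the $(K\times H\times G,\,K\times G\times H\times G)$-biset $K\times G\times H\times G$ with right action by multiplication and left action $(k,h,g)\cdot(k',g_1,h',g_2)=(kk',gg_1,hh',gg_2)$, and identity element $\epsilon_{A_G}=A(Inf_1^{1\times G})(\epsilon_A)$. *)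

theory Defs
  imports "HOL-Algebra.Module" "HOL-Algebra.QuotRing"
begin

section \<open>Finite groups closed under products\<close>

text \<open>
  Groups are HOL-Algebra records whose elements are taken from one type that is closed under
  formal pairing, so that the product of two objects is again an object over the same type.
  The type is infinite for every \<open>'a\<close>, hence contains a copy of every finite group.
\<close>

datatype 'a elt = Unit | Atom 'a | Tup (tfst: "'a elt") (tsnd: "'a elt")

type_synonym 'a grp = "'a elt monoid"

definition prod_grp :: "'a grp \<Rightarrow> 'a grp \<Rightarrow> 'a grp" (infixl \<open>\<boxtimes>\<close> 75) where
  "H \<boxtimes> G =
    \<lparr>carrier = {Tup h g | h g. h \<in> carrier H \<and> g \<in> carrier G},
     mult = (\<lambda>x y. Tup (tfst x \<otimes>\<^bsub>H\<^esub> tfst y) (tsnd x \<otimes>\<^bsub>G\<^esub> tsnd y)),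
     one = Tup \<one>\<^bsub>H\<^esub> \<one>\<^bsub>G\<^esub>\<rparr>"

definition triv_grp :: "'a grp" where
  "triv_grp = \<lparr>carrier = {Unit}, mult = (\<lambda>_ _. Unit), one = Unit\<rparr>"

text \<open>The canonical isomorphism from \<open>L \<boxtimes> (K \<boxtimes> H)\<close> to \<open>(L \<boxtimes> K) \<boxtimes> H\<close>.\<close>

definition assoc_map :: "'a elt \<Rightarrow> 'a elt" where
  "assoc_map x = Tup (Tup (tfst x) (tfst (tsnd x))) (tsnd (tsnd x))"

text \<open>Closure under isomorphism is included: take \<open>S = carrier H\<close> and \<open>N\<close> trivial.\<close>

definition admissible :: "'a grp set \<Rightarrow> bool" where
  "admissible D \<longleftrightarrow>
    (\<forall>G\<in>D. group G \<and> finite (carrier G)) \<and>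
    (\<forall>H\<in>D. \<forall>S N Q. subgroup S H \<longrightarrow> N \<lhd> H\<lparr>carrier := S\<rparr> \<longrightarrow> group Q \<longrightarrow>
       Q \<cong> (H\<lparr>carrier := S\<rparr> Mod N) \<longrightarrow> Q \<in> D) \<and>
    (\<forall>H\<in>D. \<forall>K\<in>D. \<forall>Q. group Q \<longrightarrow> Q \<cong> H \<boxtimes> K \<longrightarrow> Q \<in> D)"


section \<open>Bisets\<close>

record ('h, 'x, 'g) biset =
  bcar :: "'x set"
  lact :: "'h \<Rightarrow> 'x \<Rightarrow> 'x"
  ract :: "'x \<Rightarrow> 'g \<Rightarrow> 'x"

definition is_biset :: "'h monoid \<Rightarrow> 'g monoid \<Rightarrow> ('h, 'x, 'g) biset \<Rightarrow> bool" where
  "is_biset H G X \<longleftrightarrow> finite (bcar X) \<and>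
    (\<forall>h\<in>carrier H. \<forall>x\<in>bcar X. lact X h x \<in> bcar X) \<and>
    (\<forall>x\<in>bcar X. \<forall>g\<in>carrier G. ract X x g \<in> bcar X) \<and>
    (\<forall>x\<in>bcar X. lact X \<one>\<^bsub>H\<^esub> x = x \<and> ract X x \<one>\<^bsub>G\<^esub> = x) \<and>
    (\<forall>h\<in>carrier H. \<forall>h'\<in>carrier H. \<forall>x\<in>bcar X. lact X (h \<otimes>\<^bsub>H\<^esub> h') x = lact X h (lact X h' x)) \<and>
    (\<forall>x\<in>bcar X. \<forall>g\<in>carrier G. \<forall>g'\<in>carrier G. ract X x (g \<otimes>\<^bsub>G\<^esub> g') = ract X (ract X x g) g') \<and>
    (\<forall>h\<in>carrier H. \<forall>x\<in>bcar X. \<forall>g\<in>carrier G. ract X (lact X h x) g = lact X h (ract X x g))"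

definition biset_iso ::
  "'h monoid \<Rightarrow> 'g monoid \<Rightarrow> ('h, 'x, 'g) biset \<Rightarrow> ('h, 'y, 'g) biset \<Rightarrow> bool" where
  "biset_iso H G X Y \<longleftrightarrow> (\<exists>f. bij_betw f (bcar X) (bcar Y) \<and>
    (\<forall>h\<in>carrier H. \<forall>x\<in>bcar X. f (lact X h x) = lact Y h (f x)) \<and>
    (\<forall>x\<in>bcar X. \<forall>g\<in>carrier G. f (ract X x g) = ract Y (f x) g))"

definition biset_sum ::
  "('h, 'x, 'g) biset \<Rightarrow> ('h, 'y, 'g) biset \<Rightarrow> ('h, 'x + 'y, 'g) biset" where
  "biset_sum X Y =
    \<lparr>bcar = bcar X <+> bcar Y,
     lact = (\<lambda>h. map_sum (lact X h) (lact Y h)),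
     ract = (\<lambda>z g. map_sum (\<lambda>x. ract X x g) (\<lambda>y. ract Y y g) z)\<rparr>"

text \<open>\<open>biset_comp H Y X\<close> is the set of \<open>H\<close>-orbits of \<open>Y \<times> X\<close> under \<open>h (y, x) = (y h\<^sup>-\<^sup>1, h x)\<close>.\<close>

definition biset_comp ::
  "'h monoid \<Rightarrow> ('k, 'y, 'h) biset \<Rightarrow> ('h, 'x, 'g) biset \<Rightarrow> ('k, ('y \<times> 'x) set, 'g) biset" where
  "biset_comp H Y X =
    \<lparr>bcar = {{(ract Y y (inv\<^bsub>H\<^esub> h), lact X h x) | h. h \<in> carrier H} | y x. y \<in> bcar Y \<and> x \<in> bcar X},
     lact = (\<lambda>k p. (\<lambda>(y, x). (lact Y k y, x)) ` p),
     ract = (\<lambda>p g. (\<lambda>(y, x). (y, ract X x g)) ` p)\<rparr>"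

definition biset_prod ::
  "('a elt, 'y, 'b elt) biset \<Rightarrow> ('a elt, 'x, 'b elt) biset \<Rightarrow> ('a elt, 'y \<times> 'x, 'b elt) biset" where
  "biset_prod Y X =
    \<lparr>bcar = bcar Y \<times> bcar X,
     lact = (\<lambda>p (y, x). (lact Y (tfst p) y, lact X (tsnd p) x)),
     ract = (\<lambda>(y, x) p. (ract Y y (tfst p), ract X x (tsnd p)))\<rparr>"

definition biset_op :: "'h monoid \<Rightarrow> 'g monoid \<Rightarrow> ('h, 'x, 'g) biset \<Rightarrow> ('g, 'x, 'h) biset" where
  "biset_op H G X =
    \<lparr>bcar = bcar X,
     lact = (\<lambda>g x. ract X x (inv\<^bsub>G\<^esub> g)),
     ract = (\<lambda>x h. lact X (inv\<^bsub>H\<^esub> h) x)\<rparr>"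

text \<open>Restriction of the actions along maps \<open>p\<close> and \<open>q\<close>; only used for canonical isomorphisms.\<close>

definition biset_relabel ::
  "('h' \<Rightarrow> 'h) \<Rightarrow> ('g' \<Rightarrow> 'g) \<Rightarrow> ('h, 'x, 'g) biset \<Rightarrow> ('h', 'x, 'g') biset" where
  "biset_relabel p q X =
    \<lparr>bcar = bcar X, lact = (\<lambda>h. lact X (p h)), ract = (\<lambda>x g. ract X x (q g))\<rparr>"

definition Id_bs :: "'a grp \<Rightarrow> ('a elt, 'a elt, 'a elt) biset" where
  "Id_bs G = \<lparr>bcar = carrier G, lact = mult G, ract = mult G\<rparr>"

text \<open>For an isomorphism \<open>\<psi>\<close> from \<open>H\<close> to \<open>G\<close>, \<open>Iso_bs G \<psi>\<close> is a \<open>(G, H)\<close>-biset.\<close>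

definition Iso_bs :: "'a grp \<Rightarrow> ('a elt \<Rightarrow> 'a elt) \<Rightarrow> ('a elt, 'a elt, 'a elt) biset" where
  "Iso_bs G \<psi> = \<lparr>bcar = carrier G, lact = mult G, ract = (\<lambda>x h. x \<otimes>\<^bsub>G\<^esub> \<psi> h)\<rparr>"

text \<open>Inflation, an \<open>(H \<boxtimes> G, H)\<close>-biset for every \<open>G\<close>.\<close>

definition Inf_bs :: "'a grp \<Rightarrow> ('a elt, 'a elt, 'a elt) biset" where
  "Inf_bs H = \<lparr>bcar = carrier H, lact = (\<lambda>p x. tfst p \<otimes>\<^bsub>H\<^esub> x), ract = mult H\<rparr>"

definition rarrow :: "'a grp \<Rightarrow> ('a elt, 'a elt, 'a elt) biset" where
  "rarrow H =
    \<lparr>bcar = carrier H,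
     lact = (\<lambda>p x. tfst p \<otimes>\<^bsub>H\<^esub> x \<otimes>\<^bsub>H\<^esub> inv\<^bsub>H\<^esub> (tsnd p)),
     ract = (\<lambda>x _. x)\<rparr>"

definition larrow :: "'a grp \<Rightarrow> ('a elt, 'a elt, 'a elt) biset" where
  "larrow H = biset_op (H \<boxtimes> H) triv_grp (rarrow H)"

text \<open>
  The \<open>(L \<boxtimes> H, (L \<boxtimes> K) \<boxtimes> (K \<boxtimes> H))\<close>-biset given by \<open>L\<close> times the left arrow of \<open>K\<close> times \<open>H\<close>.  The
  external product is an \<open>((L \<boxtimes> 1) \<boxtimes> H, (L \<boxtimes> (K \<boxtimes> K)) \<boxtimes> H)\<close>-biset, so the groups are relabelled
  along \<open>L \<boxtimes> H \<cong> (L \<boxtimes> 1) \<boxtimes> H\<close> and \<open>(L \<boxtimes> K) \<boxtimes> (K \<boxtimes> H) \<cong> (L \<boxtimes> (K \<boxtimes> K)) \<boxtimes> H\<close>.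
\<close>

definition contr_bs ::
  "'a grp \<Rightarrow> 'a grp \<Rightarrow> 'a grp \<Rightarrow> ('a elt, ('a elt \<times> 'a elt) \<times> 'a elt, 'a elt) biset" where
  "contr_bs L K H =
    biset_relabel
      (\<lambda>p. Tup (Tup (tfst p) Unit) (tsnd p))
      (\<lambda>p. Tup (Tup (tfst (tfst p)) (Tup (tsnd (tfst p)) (tfst (tsnd p)))) (tsnd (tsnd p)))
      (biset_prod (biset_prod (Id_bs L) (larrow K)) (Id_bs H))"

text \<open>A \<open>((K \<boxtimes> H) \<boxtimes> G, (K \<boxtimes> G) \<boxtimes> (H \<boxtimes> G))\<close>-biset; \<open>((k, h), g)\<close> acts on the left as \<open>((k, g), (h, g))\<close>.\<close>

definition U_bs :: "'a grp \<Rightarrow> 'a grp \<Rightarrow> 'a grp \<Rightarrow> ('a elt, 'a elt, 'a elt) biset" where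
  "U_bs G K H =
    (let P = (K \<boxtimes> G) \<boxtimes> (H \<boxtimes> G) in
     \<lparr>bcar = carrier P,
      lact = (\<lambda>p x. Tup (Tup (tfst (tfst p)) (tsnd p)) (Tup (tsnd (tfst p)) (tsnd p)) \<otimes>\<^bsub>P\<^esub> x),
      ract = mult P\<rparr>)"


section \<open>Modules\<close>

definition free_mod :: "('k, 'r) ring_scheme \<Rightarrow> 'x set \<Rightarrow> ('k, 'x \<Rightarrow> 'k) module" where
  "free_mod k S =
    \<lparr>carrier = {f. (\<forall>x\<in>S. f x \<in> carrier k) \<and> (\<forall>x. x \<notin> S \<longrightarrow> f x = \<zero>\<^bsub>k\<^esub>) \<and> finite {x. f x \<noteq> \<zero>\<^bsub>k\<^esub>}},
     mult = undefined, one = undefined,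
     zero = (\<lambda>_. \<zero>\<^bsub>k\<^esub>),
     add = (\<lambda>f g x. f x \<oplus>\<^bsub>k\<^esub> g x),
     smult = (\<lambda>c f x. c \<otimes>\<^bsub>k\<^esub> f x)\<rparr>"

definition free_gen :: "('k, 'r) ring_scheme \<Rightarrow> 'x \<Rightarrow> 'x \<Rightarrow> 'k" where
  "free_gen k x = (\<lambda>y. if y = x then \<one>\<^bsub>k\<^esub> else \<zero>\<^bsub>k\<^esub>)"

definition submod_gen :: "('k, 'r) ring_scheme \<Rightarrow> ('k, 'm) module \<Rightarrow> 'm set \<Rightarrow> 'm set" where
  "submod_gen k M S = \<Inter>{N. submodule N k M \<and> S \<subseteq> N}"

text \<open>
  The quotient of a module, or of an algebra together with its product and unit, as the set of
  additive cosets; \<open>(Quot)\<close> with the scalar action added.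
\<close>

definition quot_alg :: "('k, 'm) module \<Rightarrow> 'm set \<Rightarrow> ('k, 'm set) module" where
  "quot_alg M N =
    \<lparr>carrier = a_rcosets\<^bsub>M\<^esub> N, mult = rcoset_mult M N, one = N +>\<^bsub>M\<^esub> \<one>\<^bsub>M\<^esub>,
     zero = N, add = set_add M,
     smult = (\<lambda>c X. \<Union>x\<in>X. N +>\<^bsub>M\<^esub> (c \<odot>\<^bsub>M\<^esub> x))\<rparr>"

definition linear_map ::
  "('k, 'r) ring_scheme \<Rightarrow> ('k, 'm) module \<Rightarrow> ('k, 'n) module \<Rightarrow> ('m \<Rightarrow> 'n) \<Rightarrow> bool" where
  "linear_map k M N f \<longleftrightarrow> f \<in> hom (add_monoid M) (add_monoid N) \<and>
    (\<forall>c\<in>carrier k. \<forall>x\<in>carrier M. f (c \<odot>\<^bsub>M\<^esub> x) = c \<odot>\<^bsub>N\<^esub> f x)"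


section \<open>The linearized biset category\<close>

text \<open>
  \<open>kB k H G\<close> is \<open>k \<otimes> B(H, G)\<close>, where \<open>B(H, G)\<close> is the Grothendieck group of finite \<open>(H, G)\<close>-bisets
  for disjoint union.  It is presented as the free \<open>k\<close>-module on bisets modulo \<open>[Z] = [X] + [Y]\<close>
  whenever \<open>Z\<close> is isomorphic to the disjoint union of \<open>X\<close> and \<open>Y\<close>; with \<open>Y\<close> empty these relations
  identify isomorphic bisets, and over the integers they give \<open>B(H, G)\<close> itself.  The generators are
  the bisets with underlying set of natural numbers, which represent all finite bisets.
\<close>

type_synonym 'a gen_bs = "('a elt, nat, 'a elt) biset"

type_synonym ('a, 'k) bmor = "('a gen_bs \<Rightarrow> 'k) set"

definition gen_bisets :: "'a grp \<Rightarrow> 'a grp \<Rightarrow> 'a gen_bs set" where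
  "gen_bisets H G = {X. is_biset H G X}"

definition kB_free ::
  "('k, 'r) ring_scheme \<Rightarrow> 'a grp \<Rightarrow> 'a grp \<Rightarrow> ('k, 'a gen_bs \<Rightarrow> 'k) module" where
  "kB_free k H G = free_mod k (gen_bisets H G)"

definition kB_rel :: "('k, 'r) ring_scheme \<Rightarrow> 'a grp \<Rightarrow> 'a grp \<Rightarrow> ('a gen_bs \<Rightarrow> 'k) set" where
  "kB_rel k H G = submod_gen k (kB_free k H G)
    {free_gen k Z \<ominus>\<^bsub>kB_free k H G\<^esub> (free_gen k X \<oplus>\<^bsub>kB_free k H G\<^esub> free_gen k Y) | X Y Z.
       X \<in> gen_bisets H G \<and> Y \<in> gen_bisets H G \<and> Z \<in> gen_bisets H G \<and>
       biset_iso H G Z (biset_sum X Y)}"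

definition kB ::
  "('k, 'r) ring_scheme \<Rightarrow> 'a grp \<Rightarrow> 'a grp \<Rightarrow> ('k, ('a, 'k) bmor) module" where
  "kB k H G = quot_alg (kB_free k H G) (kB_rel k H G)"

text \<open>The class in \<open>kB k H G\<close> of a finite biset over any type.\<close>

definition bclass ::
  "('k, 'r) ring_scheme \<Rightarrow> 'a grp \<Rightarrow> 'a grp \<Rightarrow> ('a elt, 'x, 'a elt) biset \<Rightarrow> ('a, 'k) bmor" where
  "bclass k H G X = kB_rel k H G +>\<^bsub>kB_free k H G\<^esub>
    free_gen k (SOME X'. X' \<in> gen_bisets H G \<and> biset_iso H G X' X)"

text \<open>
  Bilinear extension to cosets \<open>\<phi>\<close>, \<open>\<psi>\<close> of an operation \<open>b\<close> on bisets with values in \<open>M\<close>.  For the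
  additive operations below, the sum is the same element of \<open>M\<close> (itself a coset) for all
  representatives, so that the union is this element, as in the library's \<open>rcoset_mult\<close>.
\<close>

definition bilin_ext ::
  "('k, 'r) ring_scheme \<Rightarrow> ('k, 'm set) module \<Rightarrow> ('x \<Rightarrow> 'y \<Rightarrow> 'm set) \<Rightarrow>
    ('x \<Rightarrow> 'k) set \<Rightarrow> ('y \<Rightarrow> 'k) set \<Rightarrow> 'm set" where
  "bilin_ext k M b \<phi> \<psi> =
    (\<Union>f\<in>\<phi>. \<Union>g\<in>\<psi>. \<Oplus>\<^bsub>M\<^esub>Y\<in>{Y. f Y \<noteq> \<zero>\<^bsub>k\<^esub>}. \<Oplus>\<^bsub>M\<^esub>X\<in>{X. g X \<noteq> \<zero>\<^bsub>k\<^esub>}.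
      (f Y \<otimes>\<^bsub>k\<^esub> g X) \<odot>\<^bsub>M\<^esub> b Y X)"

text \<open>
  An element of \<open>kB k H G\<close> is a morphism from \<open>G\<close> to \<open>H\<close>.  In \<open>bmor_comp k K H G \<phi> \<psi>\<close>, \<open>\<phi>\<close> is a
  morphism from \<open>H\<close> to \<open>K\<close> and \<open>\<psi>\<close> one from \<open>G\<close> to \<open>H\<close>; in \<open>bmor_prod k L K H G \<phi> \<psi>\<close>, \<open>\<phi>\<close> is a morphism
  from \<open>K\<close> to \<open>L\<close> and \<open>\<psi>\<close> one from \<open>G\<close> to \<open>H\<close>.
\<close>

definition bmor_comp ::
  "('k, 'r) ring_scheme \<Rightarrow> 'a grp \<Rightarrow> 'a grp \<Rightarrow> 'a grp \<Rightarrow>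
    ('a, 'k) bmor \<Rightarrow> ('a, 'k) bmor \<Rightarrow> ('a, 'k) bmor" where
  "bmor_comp k K H G = bilin_ext k (kB k K G) (\<lambda>Y X. bclass k K G (biset_comp H Y X))"

definition bmor_prod ::
  "('k, 'r) ring_scheme \<Rightarrow> 'a grp \<Rightarrow> 'a grp \<Rightarrow> 'a grp \<Rightarrow> 'a grp \<Rightarrow>
    ('a, 'k) bmor \<Rightarrow> ('a, 'k) bmor \<Rightarrow> ('a, 'k) bmor" where
  "bmor_prod k L K H G =
    bilin_ext k (kB k (L \<boxtimes> H) (K \<boxtimes> G)) (\<lambda>Y X. bclass k (L \<boxtimes> H) (K \<boxtimes> G) (biset_prod Y X))"

definition bmor_id :: "('k, 'r) ring_scheme \<Rightarrow> 'a grp \<Rightarrow> ('a, 'k) bmor" where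
  "bmor_id k G = bclass k G G (Id_bs G)"


section \<open>Biset functors and Green biset functors\<close>

text \<open>\<open>fmor A G H \<phi>\<close> is the map from \<open>fobj A G\<close> to \<open>fobj A H\<close> induced by \<open>\<phi> \<in> carrier (kB k H G)\<close>.\<close>

record ('a, 'k, 'm) biset_fun =
  fobj :: "'a grp \<Rightarrow> ('k, 'm) module"
  fmor :: "'a grp \<Rightarrow> 'a grp \<Rightarrow> ('a, 'k) bmor \<Rightarrow> 'm \<Rightarrow> 'm"

record ('a, 'k, 'm) green_fun = "('a, 'k, 'm) biset_fun" +
  gprod :: "'a grp \<Rightarrow> 'a grp \<Rightarrow> 'm \<Rightarrow> 'm \<Rightarrow> 'm"
  geps :: 'm

definition biset_functor ::
  "('k, 'r) ring_scheme \<Rightarrow> 'a grp set \<Rightarrow> ('a, 'k, 'm, 'z) biset_fun_scheme \<Rightarrow> bool" where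
  "biset_functor k D A \<longleftrightarrow>
    (\<forall>H\<in>D. module k (fobj A H)) \<and>
    (\<forall>G\<in>D. \<forall>H\<in>D. \<forall>\<phi>\<in>carrier (kB k H G). linear_map k (fobj A G) (fobj A H) (fmor A G H \<phi>)) \<and>
    (\<forall>G\<in>D. \<forall>H\<in>D. \<forall>\<phi>\<in>carrier (kB k H G). \<forall>\<psi>\<in>carrier (kB k H G). \<forall>a\<in>carrier (fobj A G).
       fmor A G H (\<phi> \<oplus>\<^bsub>kB k H G\<^esub> \<psi>) a = fmor A G H \<phi> a \<oplus>\<^bsub>fobj A H\<^esub> fmor A G H \<psi> a) \<and>
    (\<forall>G\<in>D. \<forall>H\<in>D. \<forall>c\<in>carrier k. \<forall>\<phi>\<in>carrier (kB k H G). \<forall>a\<in>carrier (fobj A G).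
       fmor A G H (c \<odot>\<^bsub>kB k H G\<^esub> \<phi>) a = c \<odot>\<^bsub>fobj A H\<^esub> fmor A G H \<phi> a) \<and>
    (\<forall>G\<in>D. \<forall>a\<in>carrier (fobj A G). fmor A G G (bmor_id k G) a = a) \<and>
    (\<forall>G\<in>D. \<forall>H\<in>D. \<forall>K\<in>D. \<forall>\<phi>\<in>carrier (kB k K H). \<forall>\<psi>\<in>carrier (kB k H G). \<forall>a\<in>carrier (fobj A G).
       fmor A G K (bmor_comp k K H G \<phi> \<psi>) a = fmor A H K \<phi> (fmor A G H \<psi> a))"

definition green_biset_functor ::
  "('k, 'r) ring_scheme \<Rightarrow> 'a grp set \<Rightarrow> ('a, 'k, 'm) green_fun \<Rightarrow> bool" where
  "green_biset_functor k D A \<longleftrightarrow>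
    biset_functor k D A \<and>
    (\<forall>K\<in>D. \<forall>H\<in>D. \<forall>a\<in>carrier (fobj A K).
       linear_map k (fobj A H) (fobj A (K \<boxtimes> H)) (\<lambda>b. gprod A K H a b)) \<and>
    (\<forall>K\<in>D. \<forall>H\<in>D. \<forall>b\<in>carrier (fobj A H).
       linear_map k (fobj A K) (fobj A (K \<boxtimes> H)) (\<lambda>a. gprod A K H a b)) \<and>
    geps A \<in> carrier (fobj A triv_grp) \<and>
    (\<forall>L\<in>D. \<forall>K\<in>D. \<forall>H\<in>D.
       \<forall>a\<in>carrier (fobj A L). \<forall>b\<in>carrier (fobj A K). \<forall>c\<in>carrier (fobj A H).
       gprod A (L \<boxtimes> K) H (gprod A L K a b) c =
       fmor A (L \<boxtimes> (K \<boxtimes> H)) ((L \<boxtimes> K) \<boxtimes> H)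
         (bclass k ((L \<boxtimes> K) \<boxtimes> H) (L \<boxtimes> (K \<boxtimes> H)) (Iso_bs ((L \<boxtimes> K) \<boxtimes> H) assoc_map))
         (gprod A L (K \<boxtimes> H) a (gprod A K H b c))) \<and>
    (\<forall>H\<in>D. \<forall>a\<in>carrier (fobj A H).
       fmor A (triv_grp \<boxtimes> H) H (bclass k H (triv_grp \<boxtimes> H) (Iso_bs H tsnd))
         (gprod A triv_grp H (geps A) a) = a \<and>
       fmor A (H \<boxtimes> triv_grp) H (bclass k H (H \<boxtimes> triv_grp) (Iso_bs H tfst))
         (gprod A H triv_grp a (geps A)) = a) \<and>
    (\<forall>K\<in>D. \<forall>T\<in>D. \<forall>H\<in>D. \<forall>L\<in>D. \<forall>\<alpha>\<in>carrier (kB k T K). \<forall>\<beta>\<in>carrier (kB k L H).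
       \<forall>a\<in>carrier (fobj A K). \<forall>b\<in>carrier (fobj A H).
       fmor A (K \<boxtimes> H) (T \<boxtimes> L) (bmor_prod k T K L H \<alpha> \<beta>) (gprod A K H a b) =
       gprod A T L (fmor A K T \<alpha> a) (fmor A H L \<beta> b))"

definition shift_green ::
  "('k, 'r) ring_scheme \<Rightarrow> 'a grp \<Rightarrow> ('a, 'k, 'm) green_fun \<Rightarrow> ('a, 'k, 'm) green_fun" where
  "shift_green k G A =
    \<lparr>fobj = (\<lambda>H. fobj A (H \<boxtimes> G)),
     fmor = (\<lambda>H K \<alpha>. fmor A (H \<boxtimes> G) (K \<boxtimes> G) (bmor_prod k K H G G \<alpha> (bmor_id k G))),
     gprod = (\<lambda>K H a b. fmor A ((K \<boxtimes> G) \<boxtimes> (H \<boxtimes> G)) ((K \<boxtimes> H) \<boxtimes> G)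
       (bclass k ((K \<boxtimes> H) \<boxtimes> G) ((K \<boxtimes> G) \<boxtimes> (H \<boxtimes> G)) (U_bs G K H))
       (gprod A (K \<boxtimes> G) (H \<boxtimes> G) a b)),
     geps = fmor A triv_grp (triv_grp \<boxtimes> G)
       (bclass k (triv_grp \<boxtimes> G) triv_grp (Inf_bs triv_grp)) (geps A)\<rparr>"


section \<open>The associated category and the essential support\<close>

text \<open>
  In the category associated with \<open>A\<close>, the morphisms from \<open>H\<close> to \<open>K\<close> are the elements of
  \<open>fobj A (K \<boxtimes> H)\<close>; \<open>PA_comp k A L K H \<beta> \<alpha>\<close> composes \<open>\<beta>\<close> from \<open>K\<close> to \<open>L\<close> with \<open>\<alpha>\<close> from \<open>H\<close> to \<open>K\<close>.
\<close>

definition PA_comp ::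
  "('k, 'r) ring_scheme \<Rightarrow> ('a, 'k, 'm) green_fun \<Rightarrow> 'a grp \<Rightarrow> 'a grp \<Rightarrow> 'a grp \<Rightarrow> 'm \<Rightarrow> 'm \<Rightarrow> 'm"
  where
  "PA_comp k A L K H \<beta> \<alpha> =
    fmor A ((L \<boxtimes> K) \<boxtimes> (K \<boxtimes> H)) (L \<boxtimes> H)
      (bclass k (L \<boxtimes> H) ((L \<boxtimes> K) \<boxtimes> (K \<boxtimes> H)) (contr_bs L K H))
      (gprod A (L \<boxtimes> K) (K \<boxtimes> H) \<beta> \<alpha>)"

definition PA_id :: "('k, 'r) ring_scheme \<Rightarrow> ('a, 'k, 'm) green_fun \<Rightarrow> 'a grp \<Rightarrow> 'm" where
  "PA_id k A H = fmor A triv_grp (H \<boxtimes> H) (bclass k (H \<boxtimes> H) triv_grp (rarrow H)) (geps A)"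

definition PA_End ::
  "('k, 'r) ring_scheme \<Rightarrow> ('a, 'k, 'm) green_fun \<Rightarrow> 'a grp \<Rightarrow> ('k, 'm) module" where
  "PA_End k A H = (fobj A (H \<boxtimes> H))\<lparr>mult := PA_comp k A H H H, one := PA_id k A H\<rparr>"

definition ess_ideal ::
  "('k, 'r) ring_scheme \<Rightarrow> 'a grp set \<Rightarrow> ('a, 'k, 'm) green_fun \<Rightarrow> 'a grp \<Rightarrow> 'm set" where
  "ess_ideal k D A H = submod_gen k (PA_End k A H)
    {PA_comp k A H K H \<beta> \<alpha> | K \<alpha> \<beta>. K \<in> D \<and> order K < order H \<and>
       \<alpha> \<in> carrier (fobj A (K \<boxtimes> H)) \<and> \<beta> \<in> carrier (fobj A (H \<boxtimes> K))}"

definition ess_alg ::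
  "('k, 'r) ring_scheme \<Rightarrow> 'a grp set \<Rightarrow> ('a, 'k, 'm) green_fun \<Rightarrow> 'a grp \<Rightarrow> ('k, 'm set) module"
  where
  "ess_alg k D A H = quot_alg (PA_End k A H) (ess_ideal k D A H)"

definition ess_supp ::
  "('k, 'r) ring_scheme \<Rightarrow> 'a grp set \<Rightarrow> ('a, 'k, 'm) green_fun \<Rightarrow> 'a grp set" where
  "ess_supp k D A = {H \<in> D. carrier (ess_alg k D A H) \<noteq> {\<zero>\<^bsub>ess_alg k D A H\<^esub>}}"

end

theory Submission
  imports Defs
begin

text \<open>
  For an object \<open>H\<close>, the essential algebra vanishes exactly when \<open>A(H \<times> H)\<close> is spanned by composites
  through groups of smaller order, and likewise for \<open>A_G\<close> with \<open>A(H \<times> H \<times> G)\<close>.  Restriction from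
  \<open>H \<times> G\<close> to \<open>H\<close> and inflation from \<open>H\<close> to \<open>H \<times> G\<close> compare the two conditions.

  Restriction, \<open>A(H \<times> H \<times> G) \<rightarrow> A(H \<times> H)\<close>, is a left inverse of inflation, hence surjective, and it
  turns the composition attached to \<open>A_G\<close> into the one attached to \<open>A\<close> (\<open>res_infl\<close>, \<open>res_PA_comp\<close>).
  It therefore sends a spanning set of composites to a spanning set of composites.

  Inflation is not onto in general, so the converse takes another route: \<open>A\<close> acts on \<open>A_G\<close> from the right,
  and an element \<open>x\<close> of \<open>A(H \<times> H \<times> G)\<close> can be contracted with an element of \<open>A(H \<times> H)\<close>.  The
  identity of \<open>H\<close> acts trivially, and acting by \<open>\<beta> \<circ> \<alpha>\<close> is the \<open>A_G\<close>-composite of \<open>x \<cdot> \<beta>\<close> with the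
  inflation of \<open>\<alpha>\<close> (\<open>mixed_PA_id\<close>, \<open>mixed_PA_comp\<close>).  If the identity is a combination of composites
  through smaller groups, then so is every \<open>x = x \<cdot> Id\<close>.

  All these identities are equations between composites of bisets applied to external products.  They
  are settled by one observation.  A transitive \<open>(P, Q)\<close>-biset with a base point \<open>x\<^sub>0\<close> is determined up
  to isomorphism by the subgroup of the pairs \<open>(p, q)\<close> with \<open>p x\<^sub>0 = x\<^sub>0 q\<close>.  Under this correspondence
  external products of bisets become products of relations, and the composition of bisets becomes the
  composition of relations, provided that the composed biset is again transitive; this is the Mackey
  formula with a single double coset (\<open>presented_unique\<close>, \<open>presented_prod\<close>, \<open>presented_comp\<close>).  Every
  canonical biset of the theory is of this kind, so that each identity becomes an equality of explicit
  sets of pairs.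

  It remains to know that composition and product in the linearized category are the expected ones on
  classes of bisets, that is, that the bilinear extension does not depend on the representatives.  This
  holds because both operations respect isomorphism and disjoint union (\<open>bilin_ext_bclass\<close>).
\<close>

section \<open>Quotients and free modules\<close>

lemma add_subgroup_of_submodule:
  assumes "module k M" "submodule N k M"
  shows "abelian_subgroup N M"
  using assms by (simp add: abelian_subgroupI3 additive_subgroupI module_def submodule.axioms(1))

lemma submod_gen_submodule:
  assumes M: "module k M" and S: "S \<subseteq> carrier M"
  shows "submodule (submod_gen k M S) k M"
proof -
  interpret module k M by (rule M)
  show ?thesis
    unfolding submod_gen_def
  proof (rule submoduleI)
    show "\<Inter>{N. submodule N k M \<and> S \<subseteq> N} \<subseteq> carrier M"
      using carrier_is_submodule S by blast
    show "\<zero>\<^bsub>M\<^esub> \<in> \<Inter>{N. submodule N k M \<and> S \<subseteq> N}"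
      by (auto dest!: submodule.axioms(1) subgroup.one_closed)
  qed (auto dest: submoduleE)
qed

lemma submod_gen_superset: "S \<subseteq> submod_gen k M S"
  by (auto simp: submod_gen_def)

lemma submod_gen_least: "submodule N k M \<Longrightarrow> S \<subseteq> N \<Longrightarrow> submod_gen k M S \<subseteq> N"
  by (auto simp: submod_gen_def)

lemma quot_alg_carrier: "carrier (quot_alg M N) = {N +>\<^bsub>M\<^esub> x | x. x \<in> carrier M}"
  by (auto simp: quot_alg_def A_RCOSETS_def')

lemma quot_alg_zero: "\<zero>\<^bsub>quot_alg M N\<^esub> = N"
  by (simp add: quot_alg_def)

lemma quot_alg_add:
  assumes "module k M" "submodule N k M" "x \<in> carrier M" "y \<in> carrier M"
  shows "(N +>\<^bsub>M\<^esub> x) \<oplus>\<^bsub>quot_alg M N\<^esub> (N +>\<^bsub>M\<^esub> y) = N +>\<^bsub>M\<^esub> (x \<oplus>\<^bsub>M\<^esub> y)"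
  using abelian_subgroup.a_rcos_sum[OF add_subgroup_of_submodule] assms
  by (simp add: quot_alg_def)

lemma quot_alg_smult:
  assumes M: "module k M" and N: "submodule N k M" and c: "c \<in> carrier k" and x: "x \<in> carrier M"
  shows "c \<odot>\<^bsub>quot_alg M N\<^esub> (N +>\<^bsub>M\<^esub> x) = N +>\<^bsub>M\<^esub> (c \<odot>\<^bsub>M\<^esub> x)"
proof -
  interpret module k M by (rule M)
  interpret abelian_subgroup N M by (rule add_subgroup_of_submodule[OF M N])
  have "N +>\<^bsub>M\<^esub> (c \<odot>\<^bsub>M\<^esub> y) = N +>\<^bsub>M\<^esub> (c \<odot>\<^bsub>M\<^esub> x)" if "y \<in> N +>\<^bsub>M\<^esub> x" for y
  proof -
    obtain n where n: "n \<in> N" and y: "y = n \<oplus>\<^bsub>M\<^esub> x"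
      using \<open>y \<in> N +>\<^bsub>M\<^esub> x\<close> by (auto simp: a_r_coset_def')
    have "c \<odot>\<^bsub>M\<^esub> y = c \<odot>\<^bsub>M\<^esub> n \<oplus>\<^bsub>M\<^esub> c \<odot>\<^bsub>M\<^esub> x"
      using n x c a_subset by (auto simp: y smult_r_distr)
    moreover have "c \<odot>\<^bsub>M\<^esub> n \<in> N"
      using N c n by (rule submodule.smult_closed)
    ultimately have "c \<odot>\<^bsub>M\<^esub> y \<in> N +>\<^bsub>M\<^esub> (c \<odot>\<^bsub>M\<^esub> x)"
      by (auto simp: a_r_coset_def')
    then show ?thesis
      using a_repr_independence[OF _ smult_closed[OF c x] a_subgroup] by simp
  qed
  then have "(\<Union>y\<in>N +>\<^bsub>M\<^esub> x. N +>\<^bsub>M\<^esub> (c \<odot>\<^bsub>M\<^esub> y)) = (\<Union>y\<in>N +>\<^bsub>M\<^esub> x. N +>\<^bsub>M\<^esub> (c \<odot>\<^bsub>M\<^esub> x))"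
    by (rule SUP_cong[OF refl])
  moreover have "x \<in> N +>\<^bsub>M\<^esub> x" using x by (rule a_rcos_self)
  ultimately show ?thesis
    by (simp add: quot_alg_def) (use \<open>x \<in> N +>\<^bsub>M\<^esub> x\<close> in blast)
qed

lemma quot_alg_module:
  assumes M: "module k M" and N: "submodule N k M"
  shows "module k (quot_alg M N)"
proof -
  interpret module k M by (rule M)
  interpret abelian_subgroup N M by (rule add_subgroup_of_submodule[OF M N])
  have zero: "\<zero>\<^bsub>quot_alg M N\<^esub> = N +>\<^bsub>M\<^esub> \<zero>\<^bsub>M\<^esub>"
    using a_subset by (simp add: quot_alg_zero)
  have ag: "abelian_group (quot_alg M N)"
  proof (rule abelian_groupI)
    fix x y z
    assume "x \<in> carrier (quot_alg M N)" "y \<in> carrier (quot_alg M N)" "z \<in> carrier (quot_alg M N)"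
    then obtain u v w where uvw: "u \<in> carrier M" "v \<in> carrier M" "w \<in> carrier M"
      and xyz: "x = N +>\<^bsub>M\<^esub> u" "y = N +>\<^bsub>M\<^esub> v" "z = N +>\<^bsub>M\<^esub> w"
      by (auto simp: quot_alg_carrier)
    show "x \<oplus>\<^bsub>quot_alg M N\<^esub> y \<oplus>\<^bsub>quot_alg M N\<^esub> z = x \<oplus>\<^bsub>quot_alg M N\<^esub> (y \<oplus>\<^bsub>quot_alg M N\<^esub> z)"
      using uvw by (simp add: xyz quot_alg_add[OF M N] M.a_assoc)
  next
    fix x y
    assume "x \<in> carrier (quot_alg M N)" "y \<in> carrier (quot_alg M N)"
    then obtain u v where uv: "u \<in> carrier M" "v \<in> carrier M"
      and xy: "x = N +>\<^bsub>M\<^esub> u" "y = N +>\<^bsub>M\<^esub> v"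
      by (auto simp: quot_alg_carrier)
    show "x \<oplus>\<^bsub>quot_alg M N\<^esub> y = y \<oplus>\<^bsub>quot_alg M N\<^esub> x"
      using uv by (simp add: xy quot_alg_add[OF M N] M.a_comm)
    show "x \<oplus>\<^bsub>quot_alg M N\<^esub> y \<in> carrier (quot_alg M N)"
      using uv by (auto simp: xy quot_alg_add[OF M N] quot_alg_carrier)
  next
    fix x
    assume "x \<in> carrier (quot_alg M N)"
    then obtain u where u: "u \<in> carrier M" and x: "x = N +>\<^bsub>M\<^esub> u"
      by (auto simp: quot_alg_carrier)
    show "\<zero>\<^bsub>quot_alg M N\<^esub> \<oplus>\<^bsub>quot_alg M N\<^esub> x = x"
      using u by (simp add: x zero quot_alg_add[OF M N] del: a_coset_add_zero)
    show "\<exists>y\<in>carrier (quot_alg M N). y \<oplus>\<^bsub>quot_alg M N\<^esub> x = \<zero>\<^bsub>quot_alg M N\<^esub>"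
      using u by (intro bexI[of _ "N +>\<^bsub>M\<^esub> (\<ominus>\<^bsub>M\<^esub> u)"])
        (auto simp: x zero quot_alg_add[OF M N] quot_alg_carrier M.l_neg simp del: a_coset_add_zero)
  next
    show "\<zero>\<^bsub>quot_alg M N\<^esub> \<in> carrier (quot_alg M N)"
      unfolding zero quot_alg_carrier by blast
  qed
  show ?thesis
  proof (rule moduleI[OF R.is_cring ag])
    fix a b x y
    assume a: "a \<in> carrier k" and b: "b \<in> carrier k"
      and "x \<in> carrier (quot_alg M N)" "y \<in> carrier (quot_alg M N)"
    then obtain u v where uv: "u \<in> carrier M" "v \<in> carrier M" and xy: "x = N +>\<^bsub>M\<^esub> u" "y = N +>\<^bsub>M\<^esub> v"
      by (auto simp: quot_alg_carrier)
    note simps = xy uv a b quot_alg_add[OF M N] quot_alg_smult[OF M N]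
    show "(a \<oplus>\<^bsub>k\<^esub> b) \<odot>\<^bsub>quot_alg M N\<^esub> x = a \<odot>\<^bsub>quot_alg M N\<^esub> x \<oplus>\<^bsub>quot_alg M N\<^esub> b \<odot>\<^bsub>quot_alg M N\<^esub> x"
      by (simp add: simps smult_l_distr)
    show "a \<odot>\<^bsub>quot_alg M N\<^esub> (x \<oplus>\<^bsub>quot_alg M N\<^esub> y) = a \<odot>\<^bsub>quot_alg M N\<^esub> x \<oplus>\<^bsub>quot_alg M N\<^esub> a \<odot>\<^bsub>quot_alg M N\<^esub> y"
      by (simp add: simps smult_r_distr)
    show "(a \<otimes>\<^bsub>k\<^esub> b) \<odot>\<^bsub>quot_alg M N\<^esub> x = a \<odot>\<^bsub>quot_alg M N\<^esub> (b \<odot>\<^bsub>quot_alg M N\<^esub> x)"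
      by (simp add: simps smult_assoc1)
    show "a \<odot>\<^bsub>quot_alg M N\<^esub> x \<in> carrier (quot_alg M N)"
      using a uv by (auto simp: simps quot_alg_carrier)
  next
    fix x assume "x \<in> carrier (quot_alg M N)"
    then show "\<one>\<^bsub>k\<^esub> \<odot>\<^bsub>quot_alg M N\<^esub> x = x"
      by (auto simp: quot_alg_carrier quot_alg_smult[OF M N])
  qed
qed

lemma quot_alg_trivial_iff:
  assumes M: "module k M" and N: "submodule N k M"
  shows "carrier (quot_alg M N) = {\<zero>\<^bsub>quot_alg M N\<^esub>} \<longleftrightarrow> carrier M \<subseteq> N"
proof -
  interpret module k M by (rule M)
  interpret abelian_subgroup N M by (rule add_subgroup_of_submodule[OF M N])
  have "carrier M \<subseteq> N" if "carrier (quot_alg M N) = {N}"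
  proof
    fix x assume "x \<in> carrier M"
    then show "x \<in> N" using that a_rcos_self[of x] by (auto simp: quot_alg_carrier)
  qed
  moreover have "carrier (quot_alg M N) = {N}" if "carrier M \<subseteq> N"
  proof -
    have "N +>\<^bsub>M\<^esub> x = N" if "x \<in> carrier M" for x
      using that \<open>carrier M \<subseteq> N\<close> by (intro a_coset_join2 a_subgroup) auto
    then show ?thesis by (auto simp: quot_alg_carrier intro: exI[of _ "\<zero>\<^bsub>M\<^esub>"])
  qed
  ultimately show ?thesis by (auto simp: quot_alg_zero)
qed

lemma free_mod_module:
  assumes "cring k"
  shows "module k (free_mod k S)"
proof -
  interpret cring k by (rule assms)
  have fin: "finite {x. f x \<oplus>\<^bsub>k\<^esub> g x \<noteq> \<zero>\<^bsub>k\<^esub>}"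
    if "finite {x. f x \<noteq> \<zero>\<^bsub>k\<^esub>}" "finite {x. g x \<noteq> \<zero>\<^bsub>k\<^esub>}" for f g :: "_ \<Rightarrow> _"
    by (rule finite_subset[OF _ finite_UnI[OF that]]) auto
  have mem: "f x \<in> carrier k" if "f \<in> carrier (free_mod k S)" for f x
    using that by (cases "x \<in> S") (auto simp: free_mod_def)
  have ag: "abelian_group (free_mod k S)"
  proof (rule abelian_groupI)
    fix f assume f: "f \<in> carrier (free_mod k S)"
    have "(\<lambda>x. \<ominus>\<^bsub>k\<^esub> f x) \<in> carrier (free_mod k S)"
      using f by (auto simp: free_mod_def intro: rev_finite_subset)
    moreover have "(\<lambda>x. \<ominus>\<^bsub>k\<^esub> f x \<oplus>\<^bsub>k\<^esub> f x) = (\<lambda>_. \<zero>\<^bsub>k\<^esub>)"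
      using mem[OF f] by (auto simp: l_neg)
    ultimately show "\<exists>g\<in>carrier (free_mod k S). g \<oplus>\<^bsub>free_mod k S\<^esub> f = \<zero>\<^bsub>free_mod k S\<^esub>"
      by (intro bexI[of _ "\<lambda>x. \<ominus>\<^bsub>k\<^esub> f x"]) (auto simp: free_mod_def)
  next
    fix f g assume "f \<in> carrier (free_mod k S)" "g \<in> carrier (free_mod k S)"
    then show "f \<oplus>\<^bsub>free_mod k S\<^esub> g \<in> carrier (free_mod k S)"
      by (simp add: free_mod_def fin)
    show "f \<oplus>\<^bsub>free_mod k S\<^esub> g = g \<oplus>\<^bsub>free_mod k S\<^esub> f"
      using mem[OF \<open>f \<in> _\<close>] mem[OF \<open>g \<in> _\<close>] by (simp add: free_mod_def a_comm)
  next
    fix f g h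
    assume "f \<in> carrier (free_mod k S)" "g \<in> carrier (free_mod k S)" "h \<in> carrier (free_mod k S)"
    note mem[OF this(1)] mem[OF this(2)] mem[OF this(3)]
    then show "f \<oplus>\<^bsub>free_mod k S\<^esub> g \<oplus>\<^bsub>free_mod k S\<^esub> h = f \<oplus>\<^bsub>free_mod k S\<^esub> (g \<oplus>\<^bsub>free_mod k S\<^esub> h)"
      by (simp add: free_mod_def a_assoc)
  next
    show "\<zero>\<^bsub>free_mod k S\<^esub> \<in> carrier (free_mod k S)" by (simp add: free_mod_def)
  next
    fix f assume "f \<in> carrier (free_mod k S)"
    from mem[OF this] show "\<zero>\<^bsub>free_mod k S\<^esub> \<oplus>\<^bsub>free_mod k S\<^esub> f = f"
      by (simp add: free_mod_def)
  qed
  show ?thesis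
  proof (rule moduleI[OF assms ag])
    fix a b f g
    assume a: "a \<in> carrier k" and b: "b \<in> carrier k"
      and f: "f \<in> carrier (free_mod k S)" and g: "g \<in> carrier (free_mod k S)"
    note facts = a b mem[OF f] mem[OF g]
    show "a \<odot>\<^bsub>free_mod k S\<^esub> f \<in> carrier (free_mod k S)"
      using a f by (auto simp: free_mod_def elim!: rev_finite_subset)
    show "(a \<oplus>\<^bsub>k\<^esub> b) \<odot>\<^bsub>free_mod k S\<^esub> f = a \<odot>\<^bsub>free_mod k S\<^esub> f \<oplus>\<^bsub>free_mod k S\<^esub> b \<odot>\<^bsub>free_mod k S\<^esub> f"
      using facts by (simp add: free_mod_def l_distr)
    show "a \<odot>\<^bsub>free_mod k S\<^esub> (f \<oplus>\<^bsub>free_mod k S\<^esub> g) = a \<odot>\<^bsub>free_mod k S\<^esub> f \<oplus>\<^bsub>free_mod k S\<^esub> a \<odot>\<^bsub>free_mod k S\<^esub> g"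
      using facts by (simp add: free_mod_def r_distr)
    show "(a \<otimes>\<^bsub>k\<^esub> b) \<odot>\<^bsub>free_mod k S\<^esub> f = a \<odot>\<^bsub>free_mod k S\<^esub> (b \<odot>\<^bsub>free_mod k S\<^esub> f)"
      using facts by (simp add: free_mod_def m_assoc)
  next
    fix f assume "f \<in> carrier (free_mod k S)"
    from mem[OF this] show "\<one>\<^bsub>k\<^esub> \<odot>\<^bsub>free_mod k S\<^esub> f = f"
      by (simp add: free_mod_def)
  qed
qed

lemma free_gen_closed:
  assumes "cring k" "x \<in> S"
  shows "free_gen k x \<in> carrier (free_mod k S)"
proof -
  interpret cring k by (rule assms)
  show ?thesis using assms(2) by (auto simp: free_mod_def free_gen_def)
qed

text \<open>
  The linear extension of \<open>b\<close> to the free module, as a sum over the support because the bilinear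
  extension is such a sum.
\<close>

definition free_lift ::
  "('k, 'r) ring_scheme \<Rightarrow> ('k, 'm) module \<Rightarrow> ('x \<Rightarrow> 'm) \<Rightarrow> ('x \<Rightarrow> 'k) \<Rightarrow> 'm" where
  "free_lift k M b f = (\<Oplus>\<^bsub>M\<^esub>x\<in>{x. f x \<noteq> \<zero>\<^bsub>k\<^esub>}. f x \<odot>\<^bsub>M\<^esub> b x)"

context
  fixes k :: "('k, 'r) ring_scheme" and M :: "('k, 'm) module" and S :: "'x set" and b :: "'x \<Rightarrow> 'm"
  assumes M: "module k M" and b: "b \<in> S \<rightarrow> carrier M"
begin

interpretation module k M by (rule M)

text \<open>
  Summing over a larger finite set lets two elements with different supports be added termwise.
\<close>

lemma free_lift_over:
  assumes f: "f \<in> carrier (free_mod k S)" and X: "finite X" "X \<subseteq> S" "{x. f x \<noteq> \<zero>\<^bsub>k\<^esub>} \<subseteq> X"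
  shows "free_lift k M b f = (\<Oplus>\<^bsub>M\<^esub>x\<in>X. f x \<odot>\<^bsub>M\<^esub> b x)"
  unfolding free_lift_def
proof (rule M.add.finprod_mono_neutral_cong_left[OF X(1,3)])
  have "f x \<odot>\<^bsub>M\<^esub> b x \<in> carrier M" if "x \<in> S" for x
    using that f b by (auto simp: free_mod_def)
  then show "(\<lambda>x. f x \<odot>\<^bsub>M\<^esub> b x) \<in> X \<rightarrow> carrier M" using X(2) by blast
  show "f x \<odot>\<^bsub>M\<^esub> b x = \<zero>\<^bsub>M\<^esub>" if "x \<in> X - {x. f x \<noteq> \<zero>\<^bsub>k\<^esub>}" for x
  proof -
    have "b x \<in> carrier M" using that b X(2) by blast
    then show ?thesis using that by simp
  qed
qed simp

lemma free_lift_closed: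
  assumes f: "f \<in> carrier (free_mod k S)"
  shows "free_lift k M b f \<in> carrier M"
  unfolding free_lift_def
  using f b by (intro M.finsum_closed) (auto simp: free_mod_def)

lemma free_lift_add:
  assumes f: "f \<in> carrier (free_mod k S)" and g: "g \<in> carrier (free_mod k S)"
  shows "free_lift k M b (f \<oplus>\<^bsub>free_mod k S\<^esub> g) = free_lift k M b f \<oplus>\<^bsub>M\<^esub> free_lift k M b g"
proof -
  let ?X = "{x. f x \<noteq> \<zero>\<^bsub>k\<^esub>} \<union> {x. g x \<noteq> \<zero>\<^bsub>k\<^esub>}"
  interpret F: module k "free_mod k S" by (rule free_mod_module) (rule R.is_cring)
  have fg: "f x \<in> carrier k" "g x \<in> carrier k" "b x \<in> carrier M" if "x \<in> S" for x
    using that f g b by (auto simp: free_mod_def)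
  have X: "finite ?X" "?X \<subseteq> S" using f g by (auto simp: free_mod_def)
  have "free_lift k M b (f \<oplus>\<^bsub>free_mod k S\<^esub> g) = (\<Oplus>\<^bsub>M\<^esub>x\<in>?X. (f \<oplus>\<^bsub>free_mod k S\<^esub> g) x \<odot>\<^bsub>M\<^esub> b x)"
    using f g X F.add.m_closed[OF f g] by (intro free_lift_over) (auto simp: free_mod_def)
  also have "\<dots> = (\<Oplus>\<^bsub>M\<^esub>x\<in>?X. f x \<odot>\<^bsub>M\<^esub> b x \<oplus>\<^bsub>M\<^esub> g x \<odot>\<^bsub>M\<^esub> b x)"
    using fg X(2) by (intro M.finsum_cong') (auto simp: free_mod_def smult_l_distr subset_iff)
  also have "\<dots> = (\<Oplus>\<^bsub>M\<^esub>x\<in>?X. f x \<odot>\<^bsub>M\<^esub> b x) \<oplus>\<^bsub>M\<^esub> (\<Oplus>\<^bsub>M\<^esub>x\<in>?X. g x \<odot>\<^bsub>M\<^esub> b x)"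
    using fg X(2) by (intro M.finsum_addf) (auto simp: subset_iff)
  also have "\<dots> = free_lift k M b f \<oplus>\<^bsub>M\<^esub> free_lift k M b g"
    using free_lift_over[OF f X] free_lift_over[OF g X] by simp
  finally show ?thesis .
qed

lemma free_lift_smult:
  assumes c: "c \<in> carrier k" and f: "f \<in> carrier (free_mod k S)"
  shows "free_lift k M b (c \<odot>\<^bsub>free_mod k S\<^esub> f) = c \<odot>\<^bsub>M\<^esub> free_lift k M b f"
proof -
  let ?X = "{x. f x \<noteq> \<zero>\<^bsub>k\<^esub>}"
  interpret F: module k "free_mod k S" by (rule free_mod_module) (rule R.is_cring)
  have fg: "f x \<in> carrier k" "b x \<in> carrier M" if "x \<in> S" for x
    using that f b by (auto simp: free_mod_def)
  have X: "finite ?X" "?X \<subseteq> S" using f by (auto simp: free_mod_def)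
  have "free_lift k M b (c \<odot>\<^bsub>free_mod k S\<^esub> f) = (\<Oplus>\<^bsub>M\<^esub>x\<in>?X. (c \<odot>\<^bsub>free_mod k S\<^esub> f) x \<odot>\<^bsub>M\<^esub> b x)"
    using c f X F.smult_closed[OF c f] by (intro free_lift_over) (auto simp: free_mod_def)
  also have "\<dots> = (\<Oplus>\<^bsub>M\<^esub>x\<in>?X. c \<odot>\<^bsub>M\<^esub> (f x \<odot>\<^bsub>M\<^esub> b x))"
    using c fg X(2) by (intro M.finsum_cong') (auto simp: free_mod_def smult_assoc1 subset_iff)
  also have "\<dots> = c \<odot>\<^bsub>M\<^esub> (\<Oplus>\<^bsub>M\<^esub>x\<in>?X. f x \<odot>\<^bsub>M\<^esub> b x)"
    using c fg X by (intro finsum_smult_ldistr[symmetric]) (auto simp: subset_iff)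
  finally show ?thesis by (simp add: free_lift_def)
qed

lemma free_lift_gen:
  assumes "x \<in> S"
  shows "free_lift k M b (free_gen k x) = b x"
proof -
  have bx: "b x \<in> carrier M" using b assms by blast
  have "free_lift k M b (free_gen k x) = (\<Oplus>\<^bsub>M\<^esub>y\<in>{x}. free_gen k x y \<odot>\<^bsub>M\<^esub> b y)"
    using assms free_gen_closed[OF R.is_cring assms]
    by (intro free_lift_over) (auto simp: free_gen_def)
  also have "\<dots> = b x" using bx by (simp add: free_gen_def)
  finally show ?thesis .
qed

text \<open>
  The kernel of a linear map is a submodule, so it contains the relations as soon as it contains the
  relators.
\<close>

lemma free_lift_vanishes_on_submod_gen:
  assumes "R \<subseteq> carrier (free_mod k S)" "\<And>f. f \<in> R \<Longrightarrow> free_lift k M b f = \<zero>\<^bsub>M\<^esub>"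
    and "f \<in> submod_gen k (free_mod k S) R"
  shows "free_lift k M b f = \<zero>\<^bsub>M\<^esub>"
proof -
  interpret F: module k "free_mod k S" by (rule free_mod_module) (rule R.is_cring)
  let ?N = "{f \<in> carrier (free_mod k S). free_lift k M b f = \<zero>\<^bsub>M\<^esub>}"
  have z: "free_lift k M b \<zero>\<^bsub>free_mod k S\<^esub> = \<zero>\<^bsub>M\<^esub>"
    by (simp add: free_lift_def free_mod_def)
  have "submodule ?N k (free_mod k S)"
  proof (rule F.submoduleI)
    fix f assume f: "f \<in> ?N"
    then have "free_lift k M b (\<ominus>\<^bsub>free_mod k S\<^esub> f \<oplus>\<^bsub>free_mod k S\<^esub> f) = free_lift k M b (\<ominus>\<^bsub>free_mod k S\<^esub> f) \<oplus>\<^bsub>M\<^esub> \<zero>\<^bsub>M\<^esub>"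
      by (subst free_lift_add) auto
    then show "\<ominus>\<^bsub>free_mod k S\<^esub> f \<in> ?N"
      using f z free_lift_closed by (simp add: F.M.l_neg)
  qed (use z in \<open>auto simp: free_lift_add free_lift_smult\<close>)
  then have "submod_gen k (free_mod k S) R \<subseteq> ?N"
    using assms(1,2) by (intro submod_gen_least) auto
  then show ?thesis using assms(3) by auto
qed

end

section \<open>Isomorphisms, disjoint unions, composites and products of bisets\<close>

lemma is_bisetD:
  assumes "is_biset H G X"
  shows "finite (bcar X)"
    "\<And>h x. h \<in> carrier H \<Longrightarrow> x \<in> bcar X \<Longrightarrow> lact X h x \<in> bcar X"
    "\<And>g x. g \<in> carrier G \<Longrightarrow> x \<in> bcar X \<Longrightarrow> ract X x g \<in> bcar X"
    "\<And>x. x \<in> bcar X \<Longrightarrow> lact X \<one>\<^bsub>H\<^esub> x = x"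
    "\<And>x. x \<in> bcar X \<Longrightarrow> ract X x \<one>\<^bsub>G\<^esub> = x"
    "\<And>h h' x. h \<in> carrier H \<Longrightarrow> h' \<in> carrier H \<Longrightarrow> x \<in> bcar X \<Longrightarrow>
      lact X (h \<otimes>\<^bsub>H\<^esub> h') x = lact X h (lact X h' x)"
    "\<And>g g' x. g \<in> carrier G \<Longrightarrow> g' \<in> carrier G \<Longrightarrow> x \<in> bcar X \<Longrightarrow>
      ract X x (g \<otimes>\<^bsub>G\<^esub> g') = ract X (ract X x g) g'"
    "\<And>h g x. h \<in> carrier H \<Longrightarrow> g \<in> carrier G \<Longrightarrow> x \<in> bcar X \<Longrightarrow>
      ract X (lact X h x) g = lact X h (ract X x g)"
  using assms unfolding is_biset_def by blast+

lemma biset_isoE: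
  assumes "biset_iso H G X Y"
  obtains f where "bij_betw f (bcar X) (bcar Y)"
    "\<And>h x. h \<in> carrier H \<Longrightarrow> x \<in> bcar X \<Longrightarrow> f (lact X h x) = lact Y h (f x)"
    "\<And>g x. g \<in> carrier G \<Longrightarrow> x \<in> bcar X \<Longrightarrow> f (ract X x g) = ract Y (f x) g"
  using assms unfolding biset_iso_def by blast

lemma biset_iso_refl: "biset_iso H G X X"
  unfolding biset_iso_def by (rule exI[of _ id]) (simp add: bij_betw_def)

lemma biset_iso_sym:
  assumes "is_biset H G X" "biset_iso H G X Y"
  shows "biset_iso H G Y X"
  using assms(2)
proof (rule biset_isoE)
  fix f assume f: "bij_betw f (bcar X) (bcar Y)"
    "\<And>h x. h \<in> carrier H \<Longrightarrow> x \<in> bcar X \<Longrightarrow> f (lact X h x) = lact Y h (f x)"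
    "\<And>g x. g \<in> carrier G \<Longrightarrow> x \<in> bcar X \<Longrightarrow> f (ract X x g) = ract Y (f x) g"
  let ?g = "inv_into (bcar X) f"
  have g: "?g y \<in> bcar X" "f (?g y) = y" if "y \<in> bcar Y" for y
    using that f(1) by (auto simp: bij_betw_def inv_into_into f_inv_into_f)
  have gf: "?g (f x) = x" if "x \<in> bcar X" for x
    using that f(1) by (simp add: bij_betw_def)
  have "?g (lact Y h y) = lact X h (?g y)" if "h \<in> carrier H" "y \<in> bcar Y" for h y
    using gf[of "lact X h (?g y)"] is_bisetD(2)[OF assms(1)] that f(2) g by auto
  moreover have "?g (ract Y y h) = ract X (?g y) h" if "h \<in> carrier G" "y \<in> bcar Y" for h y
    using gf[of "ract X (?g y) h"] is_bisetD(3)[OF assms(1)] that f(3) g by auto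
  ultimately show ?thesis
    unfolding biset_iso_def using bij_betw_inv_into[OF f(1)] by blast
qed

lemma biset_iso_trans:
  assumes "biset_iso H G X Y" "biset_iso H G Y Z"
  shows "biset_iso H G X Z"
proof -
  from assms(1) obtain f where f: "bij_betw f (bcar X) (bcar Y)"
    "\<And>h x. h \<in> carrier H \<Longrightarrow> x \<in> bcar X \<Longrightarrow> f (lact X h x) = lact Y h (f x)"
    "\<And>g x. g \<in> carrier G \<Longrightarrow> x \<in> bcar X \<Longrightarrow> f (ract X x g) = ract Y (f x) g"
    by (rule biset_isoE) blast
  from assms(2) obtain f' where f': "bij_betw f' (bcar Y) (bcar Z)"
    "\<And>h x. h \<in> carrier H \<Longrightarrow> x \<in> bcar Y \<Longrightarrow> f' (lact Y h x) = lact Z h (f' x)"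
    "\<And>g x. g \<in> carrier G \<Longrightarrow> x \<in> bcar Y \<Longrightarrow> f' (ract Y x g) = ract Z (f' x) g"
    by (rule biset_isoE) blast
  have "f x \<in> bcar Y" if "x \<in> bcar X" for x using f(1) that by (auto simp: bij_betw_def)
  then show ?thesis
    unfolding biset_iso_def using bij_betw_trans[OF f(1) f'(1)] f f'
    by (intro exI[of _ "f' \<circ> f"]) auto
qed

text \<open>
  The actions are transported along an enumeration of the underlying finite set.
\<close>

lemma gen_biset_exists:
  fixes X :: "('a elt, 'x, 'a elt) biset"
  assumes "is_biset H G X"
  shows "\<exists>X'. X' \<in> gen_bisets H G \<and> biset_iso H G X' X"
proof -
  note X = is_bisetD[OF assms]
  obtain e :: "nat \<Rightarrow> 'x" where e: "bij_betw e {..<card (bcar X)} (bcar X)"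
    using ex_bij_betw_nat_finite[OF X(1)] by (metis lessThan_atLeast0)
  let ?N = "{..<card (bcar X)}" and ?d = "inv_into {..<card (bcar X)} e"
  have e_in: "e n \<in> bcar X" if "n < card (bcar X)" for n
    using e that by (auto simp: bij_betw_def)
  have d_in: "?d x < card (bcar X)" "e (?d x) = x" if "x \<in> bcar X" for x
    using e that inv_into_into[of x e ?N] by (auto simp: bij_betw_def f_inv_into_f)
  have de: "?d (e n) = n" if "n < card (bcar X)" for n
    using e that by (simp add: bij_betw_def)
  define X' :: "'a gen_bs" where
    "X' = \<lparr>bcar = ?N, lact = (\<lambda>h n. ?d (lact X h (e n))), ract = (\<lambda>n g. ?d (ract X (e n) g))\<rparr>"
  have "is_biset H G X'"
    using e_in d_in de X(2-) by (simp add: is_biset_def X'_def)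
  moreover have "biset_iso H G X' X"
    unfolding biset_iso_def using e e_in d_in X(2,3) by (intro exI[of _ e]) (simp add: X'_def)
  ultimately show ?thesis
    by (auto simp: gen_bisets_def)
qed

lemma biset_sum_cong:
  assumes "biset_iso H G X X'" "biset_iso H G Y Y'"
  shows "biset_iso H G (biset_sum X Y) (biset_sum X' Y')"
proof -
  from assms(1) obtain f where f: "bij_betw f (bcar X) (bcar X')"
    "\<And>h x. h \<in> carrier H \<Longrightarrow> x \<in> bcar X \<Longrightarrow> f (lact X h x) = lact X' h (f x)"
    "\<And>g x. g \<in> carrier G \<Longrightarrow> x \<in> bcar X \<Longrightarrow> f (ract X x g) = ract X' (f x) g"
    by (rule biset_isoE) blast
  from assms(2) obtain f' where f': "bij_betw f' (bcar Y) (bcar Y')"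
    "\<And>h x. h \<in> carrier H \<Longrightarrow> x \<in> bcar Y \<Longrightarrow> f' (lact Y h x) = lact Y' h (f' x)"
    "\<And>g x. g \<in> carrier G \<Longrightarrow> x \<in> bcar Y \<Longrightarrow> f' (ract Y x g) = ract Y' (f' x) g"
    by (rule biset_isoE) blast
  have "bij_betw (map_sum f f') (bcar X <+> bcar Y) (bcar X' <+> bcar Y')"
    unfolding bij_betw_def
  proof
    show "inj_on (map_sum f f') (bcar X <+> bcar Y)"
      using bij_betw_imp_inj_on[OF f(1)] bij_betw_imp_inj_on[OF f'(1)]
      by (intro inj_onI) (elim PlusE; simp add: inj_on_eq_iff)
    have "map_sum f f' ` (bcar X <+> bcar Y) = f ` bcar X <+> f' ` bcar Y"
      by (simp add: Plus_def image_Un image_image)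
    then show "map_sum f f' ` (bcar X <+> bcar Y) = bcar X' <+> bcar Y'"
      using f(1) f'(1) by (simp add: bij_betw_def)
  qed
  then show ?thesis
    unfolding biset_iso_def using f f'
    by (intro exI[of _ "map_sum f f'"]) (auto simp: biset_sum_def)
qed

text \<open>
  A decomposition of \<open>Z\<close> as a disjoint union amounts to a partition of \<open>Z\<close> into two subsets stable
  under the actions; this lemma and the next one pass back and forth.  The advantage of a partition is that its
  parts keep the action maps of \<open>Z\<close>.
\<close>

lemma biset_sum_split:
  assumes Z: "is_biset H G Z" and iso: "biset_iso H G Z (biset_sum X Y)"
  obtains S T where "bcar Z = S \<union> T" "S \<inter> T = {}"
    "is_biset H G (Z\<lparr>bcar := S\<rparr>)" "is_biset H G (Z\<lparr>bcar := T\<rparr>)"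
    "biset_iso H G (Z\<lparr>bcar := S\<rparr>) X" "biset_iso H G (Z\<lparr>bcar := T\<rparr>) Y"
proof -
  from iso obtain f where f: "bij_betw f (bcar Z) (bcar X <+> bcar Y)"
    "\<And>h x. h \<in> carrier H \<Longrightarrow> x \<in> bcar Z \<Longrightarrow> f (lact Z h x) = map_sum (lact X h) (lact Y h) (f x)"
    "\<And>g x. g \<in> carrier G \<Longrightarrow> x \<in> bcar Z \<Longrightarrow>
      f (ract Z x g) = map_sum (\<lambda>x. ract X x g) (\<lambda>y. ract Y y g) (f x)"
    by (rule biset_isoE) (auto simp: biset_sum_def)
  note Z' = is_bisetD[OF Z]
  define S where "S = {z \<in> bcar Z. isl (f z)}"
  define T where "T = {z \<in> bcar Z. \<not> isl (f z)}"
  have S: "\<exists>x\<in>bcar X. f z = Inl x" if "z \<in> S" for z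
    using bij_betw_apply[OF f(1), of z] that by (auto simp: S_def)
  have T: "\<exists>y\<in>bcar Y. f z = Inr y" if "z \<in> T" for z
    using bij_betw_apply[OF f(1), of z] that by (auto simp: T_def)
  have inj: "inj_on f (bcar Z)" and im: "f ` bcar Z = bcar X <+> bcar Y"
    using f(1) by (auto simp: bij_betw_def)
  show thesis
  proof
    show "bcar Z = S \<union> T" "S \<inter> T = {}" by (auto simp: S_def T_def)
    show "is_biset H G (Z\<lparr>bcar := S\<rparr>)" "is_biset H G (Z\<lparr>bcar := T\<rparr>)"
      using Z' f(2,3) by (auto simp: is_biset_def S_def T_def isl_map_sum)
    have "bij_betw (\<lambda>z. projl (f z)) S (bcar X)"
      unfolding bij_betw_def
    proof
      show "inj_on (\<lambda>z. projl (f z)) S"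
        using inj S by (smt (verit) S_def inj_on_def mem_Collect_eq sum.collapse(1))
      show "(\<lambda>z. projl (f z)) ` S = bcar X"
      proof
        show "(\<lambda>z. projl (f z)) ` S \<subseteq> bcar X" using S by force
        show "bcar X \<subseteq> (\<lambda>z. projl (f z)) ` S"
        proof
          fix x assume "x \<in> bcar X"
          then have "Inl x \<in> f ` bcar Z" using im by auto
          then obtain z where "z \<in> bcar Z" "f z = Inl x" by auto
          then show "x \<in> (\<lambda>z. projl (f z)) ` S" by (auto simp: S_def image_iff intro!: bexI[of _ z])
        qed
      qed
    qed
    moreover have "projl (f (lact Z h z)) = lact X h (projl (f z))" if "h \<in> carrier H" "z \<in> S" for h z
      using S[OF that(2)] f(2)[OF that(1)] that(2) by (auto simp: S_def)
    moreover have "projl (f (ract Z z h)) = ract X (projl (f z)) h" if "h \<in> carrier G" "z \<in> S" for h z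
      using S[OF that(2)] f(3)[OF that(1)] that(2) by (auto simp: S_def)
    ultimately show "biset_iso H G (Z\<lparr>bcar := S\<rparr>) X"
      unfolding biset_iso_def by auto
    have "bij_betw (\<lambda>z. projr (f z)) T (bcar Y)"
      unfolding bij_betw_def
    proof
      show "inj_on (\<lambda>z. projr (f z)) T"
        using inj T by (smt (verit) T_def inj_on_def mem_Collect_eq sum.collapse(2))
      show "(\<lambda>z. projr (f z)) ` T = bcar Y"
      proof
        show "(\<lambda>z. projr (f z)) ` T \<subseteq> bcar Y" using T by force
        show "bcar Y \<subseteq> (\<lambda>z. projr (f z)) ` T"
        proof
          fix x assume "x \<in> bcar Y"
          then have "Inr x \<in> f ` bcar Z" using im by auto
          then obtain z where "z \<in> bcar Z" "f z = Inr x" by auto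
          then show "x \<in> (\<lambda>z. projr (f z)) ` T" by (auto simp: T_def image_iff intro!: bexI[of _ z])
        qed
      qed
    qed
    moreover have "projr (f (lact Z h z)) = lact Y h (projr (f z))" if "h \<in> carrier H" "z \<in> T" for h z
      using T[OF that(2)] f(2)[OF that(1)] that(2) by (auto simp: T_def)
    moreover have "projr (f (ract Z z h)) = ract Y (projr (f z)) h" if "h \<in> carrier G" "z \<in> T" for h z
      using T[OF that(2)] f(3)[OF that(1)] that(2) by (auto simp: T_def)
    ultimately show "biset_iso H G (Z\<lparr>bcar := T\<rparr>) Y"
      unfolding biset_iso_def by auto
  qed
qed

lemma biset_sum_join:
  assumes "bcar Z = S \<union> T" "S \<inter> T = {}"
    "is_biset H G (Z\<lparr>bcar := S\<rparr>)" "is_biset H G (Z\<lparr>bcar := T\<rparr>)"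
  shows "biset_iso H G Z (biset_sum (Z\<lparr>bcar := S\<rparr>) (Z\<lparr>bcar := T\<rparr>))"
proof -
  note D = is_bisetD[OF assms(3)] is_bisetD[OF assms(4)]
  let ?f = "\<lambda>z. if z \<in> S then Inl z else Inr z"
  have "bij_betw ?f (bcar Z) (S <+> T)"
    using assms(1,2) by (auto simp: bij_betw_def inj_on_def image_iff Plus_def)
  moreover have "?f (lact Z h z) = map_sum (lact Z h) (lact Z h) (?f z)"
    if "h \<in> carrier H" "z \<in> bcar Z" for h z
    using D(2)[OF that(1), of z] D(10)[OF that(1), of z] that(2) assms(1,2) by auto
  moreover have "?f (ract Z z g) = map_sum (\<lambda>z. ract Z z g) (\<lambda>z. ract Z z g) (?f z)"
    if "g \<in> carrier G" "z \<in> bcar Z" for g z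
    using D(3)[OF that(1), of z] D(11)[OF that(1), of z] that(2) assms(1,2) by auto
  ultimately show ?thesis
    unfolding biset_iso_def biset_sum_def by (intro exI[of _ ?f]) simp
qed

text \<open>
  The common reason why composition and external product are additive in each variable: an operation
  \<open>F\<close> respects disjoint unions if it respects isomorphisms and turns a partition of \<open>Z\<close> into a
  partition of \<open>F Z\<close>.  For these operations, \<open>F\<close> of a part of \<open>Z\<close> is literally a part of \<open>F Z\<close>.
\<close>

lemma biset_sum_transfer:
  fixes F :: "('h, 'x, 'g) biset \<Rightarrow> ('h', 'y, 'g') biset"
  assumes Z: "is_biset H G Z" and iso: "biset_iso H G Z (biset_sum X Y)"
    and F_biset: "\<And>V. is_biset H G V \<Longrightarrow> is_biset H' G' (F V)"
    and F_X: "\<And>V. is_biset H G V \<Longrightarrow> biset_iso H G V X \<Longrightarrow> biset_iso H' G' (F V) FX"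
    and F_Y: "\<And>V. is_biset H G V \<Longrightarrow> biset_iso H G V Y \<Longrightarrow> biset_iso H' G' (F V) FY"
    and F_bcar: "\<And>S. F (Z\<lparr>bcar := S\<rparr>) = (F Z)\<lparr>bcar := bcar (F (Z\<lparr>bcar := S\<rparr>))\<rparr>"
    and F_Un: "\<And>S T. bcar Z = S \<union> T \<Longrightarrow> S \<inter> T = {} \<Longrightarrow> is_biset H G (Z\<lparr>bcar := S\<rparr>) \<Longrightarrow>
      is_biset H G (Z\<lparr>bcar := T\<rparr>) \<Longrightarrow>
      bcar (F Z) = bcar (F (Z\<lparr>bcar := S\<rparr>)) \<union> bcar (F (Z\<lparr>bcar := T\<rparr>)) \<and>
      bcar (F (Z\<lparr>bcar := S\<rparr>)) \<inter> bcar (F (Z\<lparr>bcar := T\<rparr>)) = {}"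
  shows "biset_iso H' G' (F Z) (biset_sum FX FY)"
proof -
  obtain S T where ST: "bcar Z = S \<union> T" "S \<inter> T = {}"
    and b: "is_biset H G (Z\<lparr>bcar := S\<rparr>)" "is_biset H G (Z\<lparr>bcar := T\<rparr>)"
    and i: "biset_iso H G (Z\<lparr>bcar := S\<rparr>) X" "biset_iso H G (Z\<lparr>bcar := T\<rparr>) Y"
    using biset_sum_split[OF Z iso] .
  have "biset_iso H' G' (F Z) (biset_sum (F (Z\<lparr>bcar := S\<rparr>)) (F (Z\<lparr>bcar := T\<rparr>)))"
    using biset_sum_join[of "F Z" "bcar (F (Z\<lparr>bcar := S\<rparr>))" "bcar (F (Z\<lparr>bcar := T\<rparr>))" H' G']
      F_Un[OF ST b] F_biset[OF b(1)] F_biset[OF b(2)] by (simp flip: F_bcar)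
  then show ?thesis
    by (rule biset_iso_trans) (intro biset_sum_cong F_X F_Y b i)
qed

text \<open>
  The class of \<open>(y, x)\<close> in \<open>Y \<times>\<^sub>H X\<close>.
\<close>

definition bal_orbit :: "'h monoid \<Rightarrow> ('k, 'y, 'h) biset \<Rightarrow> ('h, 'x, 'g) biset \<Rightarrow> 'y \<Rightarrow> 'x \<Rightarrow> ('y \<times> 'x) set"
  where "bal_orbit H Y X y x = {(ract Y y (inv\<^bsub>H\<^esub> h), lact X h x) | h. h \<in> carrier H}"

lemma bal_orbit_image:
  "bal_orbit H Y X y x = (\<lambda>h. (ract Y y (inv\<^bsub>H\<^esub> h), lact X h x)) ` carrier H"
  by (auto simp: bal_orbit_def)

lemma bcar_biset_comp: "bcar (biset_comp H Y X) = {bal_orbit H Y X y x | y x. y \<in> bcar Y \<and> x \<in> bcar X}"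
  by (simp add: biset_comp_def bal_orbit_def)

lemma bal_orbit_subset:
  assumes "group H" "is_biset K H Y" "is_biset H G X" "y \<in> bcar Y" "x \<in> bcar X"
  shows "bal_orbit H Y X y x \<subseteq> bcar Y \<times> bcar X"
  using is_bisetD[OF assms(2)] is_bisetD[OF assms(3)] assms(4,5) group.inv_closed[OF assms(1)]
  by (auto simp: bal_orbit_def)

lemma bal_orbit_self:
  fixes H (structure)
  assumes "group H" "is_biset K H Y" "is_biset H G X" "y \<in> bcar Y" "x \<in> bcar X"
  shows "(y, x) \<in> bal_orbit H Y X y x"
proof -
  interpret group H by fact
  show ?thesis
    using is_bisetD(5)[OF assms(2,4)] is_bisetD(4)[OF assms(3,5)] one_closed
    unfolding bal_orbit_def by (metis (mono_tags, lifting) inv_one mem_Collect_eq)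
qed

text \<open>
  The tensor rule \<open>(y h, x) = (y, h x)\<close>: the orbits agree after the substitution of \<open>h' h\<^sup>-\<^sup>1\<close> for \<open>h'\<close>.
\<close>

lemma bal_orbit_move:
  fixes H (structure)
  assumes "group H" "is_biset K H Y" "is_biset H G X" "y \<in> bcar Y" "x \<in> bcar X" "h \<in> carrier H"
  shows "bal_orbit H Y X (ract Y y h) x = bal_orbit H Y X y (lact X h x)"
proof -
  interpret group H by fact
  note Y = is_bisetD[OF assms(2)] and X = is_bisetD[OF assms(3)]
  have 1: "(ract Y (ract Y y h) (inv h'), lact X h' x) =
      (ract Y y (inv (h' \<otimes> inv h)), lact X (h' \<otimes> inv h) (lact X h x))" if "h' \<in> carrier H" for h'
  proof -
    have "h' = (h' \<otimes> inv h) \<otimes> h" using that assms(6) by (simp add: m_assoc)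
    then have "lact X h' x = lact X (h' \<otimes> inv h) (lact X h x)"
      using X(6)[of "h' \<otimes> inv h" h x] that assms(5,6) by simp
    moreover have "inv (h' \<otimes> inv h) = h \<otimes> inv h'"
      using that assms(6) by (simp add: inv_mult_group)
    ultimately show ?thesis using Y(7)[of h "inv h'" y] that assms(4,6) by simp
  qed
  show ?thesis
  proof (intro equalityI subsetI)
    fix p assume "p \<in> bal_orbit H Y X (ract Y y h) x"
    then obtain h' where "h' \<in> carrier H" "p = (ract Y (ract Y y h) (inv h'), lact X h' x)"
      by (auto simp: bal_orbit_def)
    then show "p \<in> bal_orbit H Y X y (lact X h x)"
      using 1[of h'] assms(6) unfolding bal_orbit_def by blast
  next
    fix p assume "p \<in> bal_orbit H Y X y (lact X h x)"
    then obtain h'' where "h'' \<in> carrier H" "p = (ract Y y (inv h''), lact X h'' (lact X h x))"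
      by (auto simp: bal_orbit_def)
    moreover have "h'' \<otimes> h \<otimes> inv h = h''"
      using \<open>h'' \<in> carrier H\<close> assms(6) by (simp add: m_assoc)
    ultimately have "p = (ract Y (ract Y y h) (inv (h'' \<otimes> h)), lact X (h'' \<otimes> h) x)" "h'' \<otimes> h \<in> carrier H"
      using 1[of "h'' \<otimes> h"] assms(6) by auto
    then show "p \<in> bal_orbit H Y X (ract Y y h) x"
      unfolding bal_orbit_def by blast
  qed
qed

lemma bal_orbit_eq_iff:
  fixes H (structure)
  assumes "group H" "is_biset K H Y" "is_biset H G X"
    "y \<in> bcar Y" "x \<in> bcar X" "y' \<in> bcar Y" "x' \<in> bcar X"
  shows "bal_orbit H Y X y' x' = bal_orbit H Y X y x \<longleftrightarrow>
    (\<exists>h\<in>carrier H. y = ract Y y' h \<and> x' = lact X h x)"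
proof -
  interpret group H by fact
  note Y = is_bisetD[OF assms(2)] and X = is_bisetD[OF assms(3)]
  have "\<exists>h\<in>carrier H. y = ract Y y' h \<and> x' = lact X h x"
    if "bal_orbit H Y X y' x' = bal_orbit H Y X y x"
  proof -
    have "(y', x') \<in> bal_orbit H Y X y x"
      using bal_orbit_self[OF assms(1-3,6,7)] that by simp
    then obtain h where h: "h \<in> carrier H" "y' = ract Y y (inv h)" "x' = lact X h x"
      by (auto simp: bal_orbit_def)
    then have "ract Y y' h = y"
      using Y(7)[of "inv h" h y] Y(5)[of y] assms(4) by simp
    with h show ?thesis by (intro bexI[of _ h]) auto
  qed
  moreover have "bal_orbit H Y X y' x' = bal_orbit H Y X y x"
    if "\<exists>h\<in>carrier H. y = ract Y y' h \<and> x' = lact X h x"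
    using bal_orbit_move[OF assms(1-3,6,5)] that by auto
  ultimately show ?thesis by (rule iffI)
qed

lemma lact_bal_orbit:
  fixes H (structure)
  assumes "group H" "is_biset K H Y" "y \<in> bcar Y" "k \<in> carrier K"
  shows "lact (biset_comp H Y X) k (bal_orbit H Y X y x) = bal_orbit H Y X (lact Y k y) x"
proof -
  interpret group H by fact
  note Y = is_bisetD[OF assms(2)]
  have "(lact Y k (ract Y y (inv h)), z) = (ract Y (lact Y k y) (inv h), z)" if "h \<in> carrier H" for h and z :: 'd
    using Y(8)[OF assms(4) inv_closed[OF that] assms(3)] by simp
  then show ?thesis
    by (simp add: biset_comp_def bal_orbit_image image_image cong: image_cong)
qed

lemma ract_bal_orbit:
  assumes "is_biset H G X" "x \<in> bcar X" "g \<in> carrier G"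
  shows "ract (biset_comp H Y X) (bal_orbit H Y X y x) g = bal_orbit H Y X y (ract X x g)"
proof -
  note X = is_bisetD[OF assms(1)]
  have "(z, ract X (lact X h x) g) = (z, lact X h (ract X x g))" if "h \<in> carrier H" for h and z :: 'e
    using X(8)[OF that assms(3,2)] by simp
  then show ?thesis
    by (simp add: biset_comp_def bal_orbit_image image_image cong: image_cong)
qed

lemma is_biset_comp:
  assumes "group H" "is_biset K H Y" "is_biset H G X" "group K" "group G"
  shows "is_biset K G (biset_comp H Y X)"
proof -
  interpret K: group K by fact
  interpret G: group G by fact
  note Y = is_bisetD[OF assms(2)] and X = is_bisetD[OF assms(3)]
  note l = lact_bal_orbit[OF assms(1,2)] and r = ract_bal_orbit[OF assms(3)]
  have "bcar (biset_comp H Y X) = (\<lambda>(y, x). bal_orbit H Y X y x) ` (bcar Y \<times> bcar X)"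
    by (auto simp: bcar_biset_comp)
  then have "finite (bcar (biset_comp H Y X))" using Y(1) X(1) by simp
  moreover have "bal_orbit H Y X y x \<in> bcar (biset_comp H Y X)" if "y \<in> bcar Y" "x \<in> bcar X" for y x
    using that by (auto simp: bcar_biset_comp)
  ultimately show ?thesis
    unfolding is_biset_def
    by (intro conjI ballI) (use Y X in \<open>auto simp: bcar_biset_comp l r\<close>)
qed

lemma biset_comp_cong:
  assumes H: "group H" and Y: "is_biset K H Y" "is_biset K H Y'" and X: "is_biset H G X" "is_biset H G X'"
    and iso: "biset_iso K H Y Y'" "biset_iso H G X X'"
  shows "biset_iso K G (biset_comp H Y X) (biset_comp H Y' X')"
proof -
  from iso(1) obtain f where f: "bij_betw f (bcar Y) (bcar Y')"
    "\<And>h x. h \<in> carrier K \<Longrightarrow> x \<in> bcar Y \<Longrightarrow> f (lact Y h x) = lact Y' h (f x)"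
    "\<And>g x. g \<in> carrier H \<Longrightarrow> x \<in> bcar Y \<Longrightarrow> f (ract Y x g) = ract Y' (f x) g"
    by (rule biset_isoE) blast
  from iso(2) obtain f' where f': "bij_betw f' (bcar X) (bcar X')"
    "\<And>h x. h \<in> carrier H \<Longrightarrow> x \<in> bcar X \<Longrightarrow> f' (lact X h x) = lact X' h (f' x)"
    "\<And>g x. g \<in> carrier G \<Longrightarrow> x \<in> bcar X \<Longrightarrow> f' (ract X x g) = ract X' (f' x) g"
    by (rule biset_isoE) blast
  note YD = is_bisetD[OF Y(1)] and XD = is_bisetD[OF X(1)]
  have fb: "f y \<in> bcar Y'" if "y \<in> bcar Y" for y using bij_betw_apply[OF f(1) that] .
  have fb': "f' x \<in> bcar X'" if "x \<in> bcar X" for x using bij_betw_apply[OF f'(1) that] .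
  define F where "F p = map_prod f f' ` p" for p
  have F: "F (bal_orbit H Y X y x) = bal_orbit H Y' X' (f y) (f' x)" if "y \<in> bcar Y" "x \<in> bcar X" for y x
  proof -
    have "F (bal_orbit H Y X y x) = (\<lambda>h. (f (ract Y y (inv\<^bsub>H\<^esub> h)), f' (lact X h x))) ` carrier H"
      by (simp add: F_def image_image bal_orbit_image)
    also have "\<dots> = (\<lambda>h. (ract Y' (f y) (inv\<^bsub>H\<^esub> h), lact X' h (f' x))) ` carrier H"
      using that f(3) f'(2) group.inv_closed[OF H] by (intro image_cong) auto
    finally show ?thesis by (simp add: bal_orbit_image)
  qed
  have orb: "\<exists>y x. y \<in> bcar Y \<and> x \<in> bcar X \<and> p = bal_orbit H Y X y x" if "p \<in> bcar (biset_comp H Y X)" for p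
    using that by (auto simp: bcar_biset_comp)
  have inj: "inj_on F (bcar (biset_comp H Y X))"
  proof (rule inj_onI)
    fix p q assume pq: "p \<in> bcar (biset_comp H Y X)" "q \<in> bcar (biset_comp H Y X)" "F p = F q"
    have "p \<subseteq> bcar Y \<times> bcar X" "q \<subseteq> bcar Y \<times> bcar X"
      using pq(1,2) bal_orbit_subset[OF H Y(1) X(1)] by (auto simp: bcar_biset_comp)
    moreover have "inj_on (map_prod f f') (bcar Y \<times> bcar X)"
      using f(1) f'(1) by (simp add: bij_betw_def map_prod_inj_on)
    ultimately show "p = q"
      using pq(3) unfolding F_def by (metis inj_on_image_eq_iff)
  qed
  have im: "F ` bcar (biset_comp H Y X) = bcar (biset_comp H Y' X')"
  proof
    show "F ` bcar (biset_comp H Y X) \<subseteq> bcar (biset_comp H Y' X')"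
    proof
      fix q assume "q \<in> F ` bcar (biset_comp H Y X)"
      then obtain y x where "y \<in> bcar Y" "x \<in> bcar X" "q = F (bal_orbit H Y X y x)"
        using orb by blast
      then show "q \<in> bcar (biset_comp H Y' X')"
        using fb fb' by (auto simp: F bcar_biset_comp)
    qed
    show "bcar (biset_comp H Y' X') \<subseteq> F ` bcar (biset_comp H Y X)"
    proof
      fix q assume "q \<in> bcar (biset_comp H Y' X')"
      then obtain y' x' where y': "y' \<in> bcar Y'" "x' \<in> bcar X'" "q = bal_orbit H Y' X' y' x'"
        by (auto simp: bcar_biset_comp)
      then obtain y x where "y \<in> bcar Y" "x \<in> bcar X" "y' = f y" "x' = f' x"
        using bij_betw_imp_surj_on[OF f(1)] bij_betw_imp_surj_on[OF f'(1)] by blast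
      then have "q = F (bal_orbit H Y X y x)" "bal_orbit H Y X y x \<in> bcar (biset_comp H Y X)"
        using y'(3) by (auto simp: F bcar_biset_comp)
      then show "q \<in> F ` bcar (biset_comp H Y X)" by blast
    qed
  qed
  have "F (lact (biset_comp H Y X) k p) = lact (biset_comp H Y' X') k (F p)"
    if "k \<in> carrier K" "p \<in> bcar (biset_comp H Y X)" for k p
    using orb[OF that(2)] that(1) fb f(2) YD(2)
    by (auto simp: lact_bal_orbit[OF H Y(1)] lact_bal_orbit[OF H Y(2)] F)
  moreover have "F (ract (biset_comp H Y X) p g) = ract (biset_comp H Y' X') (F p) g"
    if "g \<in> carrier G" "p \<in> bcar (biset_comp H Y X)" for g p
    using orb[OF that(2)] that(1) fb' f'(3) XD(3)
    by (auto simp: ract_bal_orbit[OF X(1)] ract_bal_orbit[OF X(2)] F)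
  ultimately show ?thesis
    unfolding biset_iso_def using inj im by (intro exI[of _ F]) (auto simp: bij_betw_def)
qed

lemma bal_orbit_restrict [simp]:
  "bal_orbit H (Y\<lparr>bcar := S\<rparr>) X = bal_orbit H Y X" "bal_orbit H Y (X\<lparr>bcar := T\<rparr>) = bal_orbit H Y X"
  by (auto simp: bal_orbit_def fun_eq_iff)

lemma biset_comp_sum_left:
  assumes H: "group H" and KG: "group K" "group G" and Z: "is_biset K H Z" and X: "is_biset H G X"
    and Y: "is_biset K H Y" "is_biset K H Y'"
    and iso: "biset_iso K H Z (biset_sum Y Y')"
  shows "biset_iso K G (biset_comp H Z X) (biset_sum (biset_comp H Y X) (biset_comp H Y' X))"
proof (rule biset_sum_transfer[where F = "\<lambda>V. biset_comp H V X", OF Z iso])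
  show "bcar (biset_comp H Z X) = bcar (biset_comp H (Z\<lparr>bcar := S\<rparr>) X) \<union> bcar (biset_comp H (Z\<lparr>bcar := T\<rparr>) X) \<and>
      bcar (biset_comp H (Z\<lparr>bcar := S\<rparr>) X) \<inter> bcar (biset_comp H (Z\<lparr>bcar := T\<rparr>) X) = {}"
    if ST: "bcar Z = S \<union> T" "S \<inter> T = {}" "is_biset K H (Z\<lparr>bcar := S\<rparr>)" "is_biset K H (Z\<lparr>bcar := T\<rparr>)" for S T
  proof -
    have "bal_orbit H Z X y x \<noteq> bal_orbit H Z X y' x'"
      if "y \<in> S" "y' \<in> T" "x \<in> bcar X" "x' \<in> bcar X" for y y' x x'
      using bal_orbit_subset[OF H ST(3) X, of y x] bal_orbit_self[OF H ST(4) X, of y' x'] that ST(2) by auto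
    then show ?thesis using ST(1) by (auto simp: bcar_biset_comp)
  qed
qed (auto intro: is_biset_comp biset_comp_cong biset_iso_refl assms, simp add: biset_comp_def)

lemma biset_comp_sum_right:
  assumes H: "group H" and KG: "group K" "group G" and Z: "is_biset H G Z" and Y: "is_biset K H Y"
    and X: "is_biset H G X" "is_biset H G X'"
    and iso: "biset_iso H G Z (biset_sum X X')"
  shows "biset_iso K G (biset_comp H Y Z) (biset_sum (biset_comp H Y X) (biset_comp H Y X'))"
proof (rule biset_sum_transfer[where F = "\<lambda>V. biset_comp H Y V", OF Z iso])
  show "bcar (biset_comp H Y Z) = bcar (biset_comp H Y (Z\<lparr>bcar := S\<rparr>)) \<union> bcar (biset_comp H Y (Z\<lparr>bcar := T\<rparr>)) \<and>
      bcar (biset_comp H Y (Z\<lparr>bcar := S\<rparr>)) \<inter> bcar (biset_comp H Y (Z\<lparr>bcar := T\<rparr>)) = {}"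
    if ST: "bcar Z = S \<union> T" "S \<inter> T = {}" "is_biset H G (Z\<lparr>bcar := S\<rparr>)" "is_biset H G (Z\<lparr>bcar := T\<rparr>)" for S T
  proof -
    have "bal_orbit H Y Z y x \<noteq> bal_orbit H Y Z y' x'"
      if "x \<in> S" "x' \<in> T" "y \<in> bcar Y" "y' \<in> bcar Y" for y y' x x'
      using bal_orbit_subset[OF H Y ST(3), of y x] bal_orbit_self[OF H Y ST(4), of y' x'] that ST(2) by auto
    then show ?thesis using ST(1) by (auto simp: bcar_biset_comp)
  qed
qed (auto intro: is_biset_comp biset_comp_cong biset_iso_refl assms, simp add: biset_comp_def)

lemma carrier_prod_grp: "carrier (H \<boxtimes> G) = {Tup h g | h g. h \<in> carrier H \<and> g \<in> carrier G}"
  and mult_prod_grp [simp]: "Tup h g \<otimes>\<^bsub>H \<boxtimes> G\<^esub> Tup h' g' = Tup (h \<otimes>\<^bsub>H\<^esub> h') (g \<otimes>\<^bsub>G\<^esub> g')"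
  and one_prod_grp: "\<one>\<^bsub>H \<boxtimes> G\<^esub> = Tup \<one>\<^bsub>H\<^esub> \<one>\<^bsub>G\<^esub>"
  by (simp_all add: prod_grp_def)

lemma is_biset_prod:
  assumes "is_biset L K Y" "is_biset H G X"
  shows "is_biset (L \<boxtimes> H) (K \<boxtimes> G) (biset_prod Y X)"
  using is_bisetD[OF assms(1)] is_bisetD[OF assms(2)]
  by (auto simp: is_biset_def biset_prod_def carrier_prod_grp one_prod_grp)

lemma biset_prod_cong:
  assumes "biset_iso L K Y Y'" "biset_iso H G X X'"
  shows "biset_iso (L \<boxtimes> H) (K \<boxtimes> G) (biset_prod Y X) (biset_prod Y' X')"
proof -
  from assms(1) obtain f where f: "bij_betw f (bcar Y) (bcar Y')"
    "\<And>h x. h \<in> carrier L \<Longrightarrow> x \<in> bcar Y \<Longrightarrow> f (lact Y h x) = lact Y' h (f x)"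
    "\<And>g x. g \<in> carrier K \<Longrightarrow> x \<in> bcar Y \<Longrightarrow> f (ract Y x g) = ract Y' (f x) g"
    by (rule biset_isoE) blast
  from assms(2) obtain f' where f': "bij_betw f' (bcar X) (bcar X')"
    "\<And>h x. h \<in> carrier H \<Longrightarrow> x \<in> bcar X \<Longrightarrow> f' (lact X h x) = lact X' h (f' x)"
    "\<And>g x. g \<in> carrier G \<Longrightarrow> x \<in> bcar X \<Longrightarrow> f' (ract X x g) = ract X' (f' x) g"
    by (rule biset_isoE) blast
  have "bij_betw (map_prod f f') (bcar Y \<times> bcar X) (bcar Y' \<times> bcar X')"
    using f(1) f'(1) by (rule bij_betw_map_prod)
  then show ?thesis
    unfolding biset_iso_def using f f'
    by (intro exI[of _ "map_prod f f'"]) (auto simp: biset_prod_def carrier_prod_grp)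
qed

lemma biset_prod_sum_left:
  assumes Z: "is_biset L K Z" and X: "is_biset H G X"
    and iso: "biset_iso L K Z (biset_sum Y Y')"
  shows "biset_iso (L \<boxtimes> H) (K \<boxtimes> G) (biset_prod Z X) (biset_sum (biset_prod Y X) (biset_prod Y' X))"
  by (rule biset_sum_transfer[where F = "\<lambda>V. biset_prod V X", OF Z iso])
    (auto intro: is_biset_prod biset_prod_cong biset_iso_refl X, auto simp: biset_prod_def)

lemma biset_prod_sum_right:
  assumes Z: "is_biset H G Z" and Y: "is_biset L K Y"
    and iso: "biset_iso H G Z (biset_sum X X')"
  shows "biset_iso (L \<boxtimes> H) (K \<boxtimes> G) (biset_prod Y Z) (biset_sum (biset_prod Y X) (biset_prod Y X'))"
  by (rule biset_sum_transfer[where F = "\<lambda>V. biset_prod Y V", OF Z iso])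
    (auto intro: is_biset_prod biset_prod_cong biset_iso_refl Y, auto simp: biset_prod_def)

section \<open>Operations on classes of bisets\<close>

definition sum_relators :: "('k, 'r) ring_scheme \<Rightarrow> 'a grp \<Rightarrow> 'a grp \<Rightarrow> ('a gen_bs \<Rightarrow> 'k) set" where
  "sum_relators k H G =
    {free_gen k Z \<ominus>\<^bsub>kB_free k H G\<^esub> (free_gen k X \<oplus>\<^bsub>kB_free k H G\<^esub> free_gen k Y) | X Y Z.
       X \<in> gen_bisets H G \<and> Y \<in> gen_bisets H G \<and> Z \<in> gen_bisets H G \<and>
       biset_iso H G Z (biset_sum X Y)}"

lemma kB_rel_eq: "kB_rel k H G = submod_gen k (kB_free k H G) (sum_relators k H G)"
  by (simp add: kB_rel_def sum_relators_def)

lemma kB_free_module: "cring k \<Longrightarrow> module k (kB_free k H G)"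
  unfolding kB_free_def by (rule free_mod_module)

lemma gen_closed: "cring k \<Longrightarrow> X \<in> gen_bisets H G \<Longrightarrow> free_gen k X \<in> carrier (kB_free k H G)"
  unfolding kB_free_def by (rule free_gen_closed)

lemma sum_relators_subset:
  assumes k: "cring k"
  shows "sum_relators k H G \<subseteq> carrier (kB_free k H G)"
proof -
  interpret F: module k "kB_free k H G" using k by (rule kB_free_module)
  show ?thesis
    using gen_closed[OF k, of _ H G] by (auto simp: sum_relators_def intro!: F.M.minus_closed)
qed

lemma kB_rel_submodule: "cring k \<Longrightarrow> submodule (kB_rel k H G) k (kB_free k H G)"
  unfolding kB_rel_eq by (intro submod_gen_submodule kB_free_module sum_relators_subset)

lemma kB_module: "cring k \<Longrightarrow> module k (kB k H G)"
  unfolding kB_def by (intro quot_alg_module kB_free_module kB_rel_submodule)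

definition biset_rep :: "'a grp \<Rightarrow> 'a grp \<Rightarrow> ('a elt, 'x, 'a elt) biset \<Rightarrow> 'a gen_bs" where
  "biset_rep H G X = (SOME X'. X' \<in> gen_bisets H G \<and> biset_iso H G X' X)"

lemma biset_rep:
  assumes "is_biset H G X"
  shows "biset_rep H G X \<in> gen_bisets H G" "biset_iso H G (biset_rep H G X) X"
  using someI_ex[OF gen_biset_exists[OF assms]] by (auto simp: biset_rep_def)

lemma bclass_eq: "bclass k H G X = kB_rel k H G +>\<^bsub>kB_free k H G\<^esub> free_gen k (biset_rep H G X)"
  by (simp add: bclass_def biset_rep_def)

lemma bclass_closed:
  assumes "cring k" "is_biset H G X"
  shows "bclass k H G X \<in> carrier (kB k H G)"
  using gen_closed[OF assms(1) biset_rep(1)[OF assms(2)]] by (auto simp: bclass_eq kB_def quot_alg_carrier)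

lemma bclass_cong:
  assumes "is_biset H G X" "biset_iso H G X Y"
  shows "bclass k H G X = bclass k H G Y"
proof -
  have "biset_iso H G X' X \<longleftrightarrow> biset_iso H G X' Y" for X' :: "'a gen_bs"
    using biset_iso_trans[OF _ assms(2)] biset_iso_trans[OF _ biset_iso_sym[OF assms]] by (rule iffI)
  then show ?thesis by (simp add: bclass_def)
qed

lemma bclass_sum:
  assumes k: "cring k" and b: "is_biset H G X" "is_biset H G Y" "is_biset H G Z"
    and iso: "biset_iso H G Z (biset_sum X Y)"
  shows "bclass k H G Z = bclass k H G X \<oplus>\<^bsub>kB k H G\<^esub> bclass k H G Y"
proof -
  let ?F = "kB_free k H G" and ?N = "kB_rel k H G"
  let ?X = "biset_rep H G X" and ?Y = "biset_rep H G Y" and ?Z = "biset_rep H G Z"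
  note F = kB_free_module[OF k, of H G] and N = kB_rel_submodule[OF k, of H G]
  interpret F: module k ?F by (rule F)
  interpret N: abelian_subgroup ?N ?F by (rule add_subgroup_of_submodule[OF F N])
  note r = biset_rep(1)[OF b(1)] biset_rep(1)[OF b(2)] biset_rep(1)[OF b(3)]
  note g = gen_closed[OF k r(1)] gen_closed[OF k r(2)] gen_closed[OF k r(3)]
  have "biset_iso H G (biset_sum X Y) (biset_sum ?X ?Y)"
    using r biset_rep(2)[OF b(1)] biset_rep(2)[OF b(2)]
    by (intro biset_sum_cong) (auto simp: gen_bisets_def intro: biset_iso_sym)
  then have "biset_iso H G ?Z (biset_sum ?X ?Y)"
    by (rule biset_iso_trans[OF biset_iso_trans[OF biset_rep(2)[OF b(3)] iso]])
  then have "free_gen k ?Z \<ominus>\<^bsub>?F\<^esub> (free_gen k ?X \<oplus>\<^bsub>?F\<^esub> free_gen k ?Y) \<in> sum_relators k H G"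
    using r unfolding sum_relators_def by blast
  then have mem: "free_gen k ?Z \<ominus>\<^bsub>?F\<^esub> (free_gen k ?X \<oplus>\<^bsub>?F\<^esub> free_gen k ?Y) \<in> ?N"
    unfolding kB_rel_eq by (rule subsetD[OF submod_gen_superset])
  have xy: "free_gen k ?X \<oplus>\<^bsub>?F\<^esub> free_gen k ?Y \<in> carrier ?F" using g by simp
  have "?N +>\<^bsub>?F\<^esub> free_gen k ?Z = ?N +>\<^bsub>?F\<^esub> (free_gen k ?X \<oplus>\<^bsub>?F\<^esub> free_gen k ?Y)"
  proof (rule F.a_coset_add_inv1[OF _ g(3) xy N.a_subset])
    show "?N +>\<^bsub>?F\<^esub> (free_gen k ?Z \<oplus>\<^bsub>?F\<^esub> \<ominus>\<^bsub>?F\<^esub> (free_gen k ?X \<oplus>\<^bsub>?F\<^esub> free_gen k ?Y)) = ?N"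
      using F.a_coset_join2[OF _ N.a_subgroup mem[unfolded a_minus_def]] g(3) xy by simp
  qed
  then show ?thesis
    unfolding bclass_eq kB_def by (simp add: quot_alg_add[OF F N] g)
qed

text \<open>
  An additive function on bisets kills the relators, so its linear extension takes a single value on
  the coset of a biset.
\<close>

lemma free_lift_coset:
  assumes k: "cring k" and M: "module k M"
    and b: "b \<in> gen_bisets H G \<rightarrow> carrier M"
    and additive: "\<And>X Y Z. X \<in> gen_bisets H G \<Longrightarrow> Y \<in> gen_bisets H G \<Longrightarrow> Z \<in> gen_bisets H G \<Longrightarrow>
      biset_iso H G Z (biset_sum X Y) \<Longrightarrow> b Z = b X \<oplus>\<^bsub>M\<^esub> b Y"
    and X: "is_biset H G X" and f: "f \<in> bclass k H G X"
  shows "f \<in> carrier (kB_free k H G)" "free_lift k M b f = b (biset_rep H G X)"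
proof -
  let ?F = "kB_free k H G"
  interpret F: module k ?F using k by (rule kB_free_module)
  interpret M: module k M by (rule M)
  note N = kB_rel_submodule[OF k, of H G]
  note r = biset_rep(1)[OF X]
  note add = free_lift_add[OF M b, folded kB_free_def] and gen = free_lift_gen[OF M b]
  obtain n where n: "n \<in> kB_rel k H G" and f: "f = n \<oplus>\<^bsub>?F\<^esub> free_gen k (biset_rep H G X)"
    using f by (auto simp: bclass_eq a_r_coset_def')
  have n': "n \<in> carrier ?F" using F.submoduleE(1)[OF N] n by blast
  show "f \<in> carrier ?F" using n' gen_closed[OF k r] by (simp add: f)
  have "free_lift k M b n = \<zero>\<^bsub>M\<^esub>"
  proof (rule free_lift_vanishes_on_submod_gen[OF M b])
    show "n \<in> submod_gen k (free_mod k (gen_bisets H G)) (sum_relators k H G)"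
      using n by (simp add: kB_rel_eq kB_free_def)
    show "sum_relators k H G \<subseteq> carrier (free_mod k (gen_bisets H G))"
      using sum_relators_subset[OF k] by (simp add: kB_free_def)
    fix g assume g_rel: "g \<in> sum_relators k H G"
    then obtain X Y Z where g: "g = free_gen k Z \<ominus>\<^bsub>?F\<^esub> (free_gen k X \<oplus>\<^bsub>?F\<^esub> free_gen k Y)"
      and XYZ: "X \<in> gen_bisets H G" "Y \<in> gen_bisets H G" "Z \<in> gen_bisets H G"
      and iso: "biset_iso H G Z (biset_sum X Y)"
      by (auto simp: sum_relators_def)
    have g': "g \<in> carrier ?F" using sum_relators_subset[OF k] g_rel by blast
    note c = gen_closed[OF k XYZ(1)] gen_closed[OF k XYZ(2)] gen_closed[OF k XYZ(3)]
    have "free_gen k Z = g \<oplus>\<^bsub>?F\<^esub> (free_gen k X \<oplus>\<^bsub>?F\<^esub> free_gen k Y)"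
      using c by (simp add: g a_minus_def F.M.a_assoc F.M.l_neg)
    then have "b Z = free_lift k M b g \<oplus>\<^bsub>M\<^esub> (b X \<oplus>\<^bsub>M\<^esub> b Y)"
      using add[OF g', of "free_gen k X \<oplus>\<^bsub>?F\<^esub> free_gen k Y"] add[OF c(1,2)] c gen[OF XYZ(1)] gen[OF XYZ(2)] gen[OF XYZ(3)] by simp
    moreover have "b Z = b X \<oplus>\<^bsub>M\<^esub> b Y" using additive XYZ iso by blast
    moreover have "free_lift k M b g \<in> carrier M"
      using free_lift_closed[OF M b, folded kB_free_def, OF g'] .
    ultimately show "free_lift k M b g = \<zero>\<^bsub>M\<^esub>"
      using b XYZ by (metis M.M.add.r_cancel_one M.M.add.m_closed PiE)
  qed
  then show "free_lift k M b f = b (biset_rep H G X)"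
    using add[OF n' gen_closed[OF k r]] gen[OF r] b r by (simp add: f) (metis M.M.l_zero PiE)
qed

text \<open>
  The double sum is an iterated linear extension.  The inner one is constant on the second coset, and
  then the outer one is constant on the first, so the union over all representatives has one member.
\<close>

lemma bilin_ext_bclass:
  assumes k: "cring k" and M: "module k M"
    and b: "\<And>Y X. Y \<in> gen_bisets L K \<Longrightarrow> X \<in> gen_bisets H G \<Longrightarrow> b Y X \<in> carrier M"
    and left: "\<And>Y Y' Z X. Y \<in> gen_bisets L K \<Longrightarrow> Y' \<in> gen_bisets L K \<Longrightarrow> Z \<in> gen_bisets L K \<Longrightarrow>
      X \<in> gen_bisets H G \<Longrightarrow> biset_iso L K Z (biset_sum Y Y') \<Longrightarrow> b Z X = b Y X \<oplus>\<^bsub>M\<^esub> b Y' X"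
    and right: "\<And>Y X X' Z. X \<in> gen_bisets H G \<Longrightarrow> X' \<in> gen_bisets H G \<Longrightarrow> Z \<in> gen_bisets H G \<Longrightarrow>
      Y \<in> gen_bisets L K \<Longrightarrow> biset_iso H G Z (biset_sum X X') \<Longrightarrow> b Y Z = b Y X \<oplus>\<^bsub>M\<^esub> b Y X'"
    and Y: "is_biset L K Y" and X: "is_biset H G X"
  shows "bilin_ext k M b (bclass k L K Y) (bclass k H G X) = b (biset_rep L K Y) (biset_rep H G X)"
proof -
  interpret M: module k M by (rule M)
  let ?Y = "biset_rep L K Y" and ?X = "biset_rep H G X"
  note rY = biset_rep(1)[OF Y] and rX = biset_rep(1)[OF X]
  have ne: "\<exists>f. f \<in> bclass k H G X" if "is_biset H G X" for H G X
  proof -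
    interpret N: abelian_subgroup "kB_rel k H G" "kB_free k H G"
      using add_subgroup_of_submodule[OF kB_free_module kB_rel_submodule] k by blast
    show ?thesis
      unfolding bclass_eq using N.a_rcos_self[OF gen_closed[OF k biset_rep(1)[OF that]]] by blast
  qed
  have "(\<Oplus>\<^bsub>M\<^esub>Y\<in>{Y. f Y \<noteq> \<zero>\<^bsub>k\<^esub>}. \<Oplus>\<^bsub>M\<^esub>X\<in>{X. g X \<noteq> \<zero>\<^bsub>k\<^esub>}. (f Y \<otimes>\<^bsub>k\<^esub> g X) \<odot>\<^bsub>M\<^esub> b Y X) = b ?Y ?X"
    if f: "f \<in> bclass k L K Y" and g: "g \<in> bclass k H G X" for f g
  proof -
    have bY: "b V \<in> gen_bisets H G \<rightarrow> carrier M" if "V \<in> gen_bisets L K" for V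
      using b that by blast
    have g': "g \<in> carrier (kB_free k H G)" "free_lift k M (b V) g = b V ?X" if "V \<in> gen_bisets L K" for V
      using free_lift_coset[OF k M bY[OF that] _ X g] right that by blast+
    have bX: "(\<lambda>V. b V ?X) \<in> gen_bisets L K \<rightarrow> carrier M" using b rX by blast
    have f': "f \<in> carrier (kB_free k L K)" "free_lift k M (\<lambda>V. b V ?X) f = b ?Y ?X"
      using free_lift_coset[OF k M bX _ Y f] left rX by blast+
    have fk: "f V \<in> carrier k" "V \<in> gen_bisets L K" if "f V \<noteq> \<zero>\<^bsub>k\<^esub>" for V
      using f'(1) that by (auto simp: kB_free_def free_mod_def)
    have gk: "g V \<in> carrier k" "V \<in> gen_bisets H G" if "g V \<noteq> \<zero>\<^bsub>k\<^esub>" for V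
      using g'(1)[OF rY] that by (auto simp: kB_free_def free_mod_def)
    have fin: "finite {X. g X \<noteq> \<zero>\<^bsub>k\<^esub>}" using g'(1)[OF rY] by (auto simp: kB_free_def free_mod_def)
    have "(\<Oplus>\<^bsub>M\<^esub>X\<in>{X. g X \<noteq> \<zero>\<^bsub>k\<^esub>}. (f V \<otimes>\<^bsub>k\<^esub> g X) \<odot>\<^bsub>M\<^esub> b V X) = f V \<odot>\<^bsub>M\<^esub> b V ?X"
      if V: "f V \<noteq> \<zero>\<^bsub>k\<^esub>" for V
    proof -
      have "(\<Oplus>\<^bsub>M\<^esub>X\<in>{X. g X \<noteq> \<zero>\<^bsub>k\<^esub>}. (f V \<otimes>\<^bsub>k\<^esub> g X) \<odot>\<^bsub>M\<^esub> b V X) =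
          (\<Oplus>\<^bsub>M\<^esub>X\<in>{X. g X \<noteq> \<zero>\<^bsub>k\<^esub>}. f V \<odot>\<^bsub>M\<^esub> (g X \<odot>\<^bsub>M\<^esub> b V X))"
        using fk[OF V] gk b by (intro M.M.finsum_cong') (auto simp: M.smult_assoc1)
      also have "\<dots> = f V \<odot>\<^bsub>M\<^esub> free_lift k M (b V) g"
        unfolding free_lift_def using fk[OF V] gk b fin
        by (intro M.finsum_smult_ldistr[symmetric]) auto
      finally show ?thesis using g'(2)[OF fk(2)[OF V]] by simp
    qed
    then have "(\<Oplus>\<^bsub>M\<^esub>Y\<in>{Y. f Y \<noteq> \<zero>\<^bsub>k\<^esub>}. \<Oplus>\<^bsub>M\<^esub>X\<in>{X. g X \<noteq> \<zero>\<^bsub>k\<^esub>}. (f Y \<otimes>\<^bsub>k\<^esub> g X) \<odot>\<^bsub>M\<^esub> b Y X) =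
        free_lift k M (\<lambda>V. b V ?X) f"
      unfolding free_lift_def using fk b rX by (intro M.M.finsum_cong') auto
    with f'(2) show ?thesis by simp
  qed
  then have "bilin_ext k M b (bclass k L K Y) (bclass k H G X) =
      (\<Union>f\<in>bclass k L K Y. \<Union>g\<in>bclass k H G X. b ?Y ?X)"
    unfolding bilin_ext_def by (intro SUP_cong refl)
  also have "\<dots> = b ?Y ?X"
    using ne[OF Y] ne[OF X] by auto
  finally show ?thesis .
qed

lemma gen_bisetsD: "X \<in> gen_bisets H G \<Longrightarrow> is_biset H G X"
  by (simp add: gen_bisets_def)

lemma bmor_comp_bclass:
  assumes k: "cring k" and grp: "group K" "group H" "group G"
    and Y: "is_biset K H Y" and X: "is_biset H G X"
  shows "bmor_comp k K H G (bclass k K H Y) (bclass k H G X) = bclass k K G (biset_comp H Y X)"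
proof -
  note r = biset_rep[OF Y] biset_rep[OF X]
  have "bmor_comp k K H G (bclass k K H Y) (bclass k H G X) =
      bclass k K G (biset_comp H (biset_rep K H Y) (biset_rep H G X))"
    unfolding bmor_comp_def
  proof (rule bilin_ext_bclass[OF k kB_module[OF k] _ _ _ Y X])
  qed (drule gen_bisetsD | rule bclass_closed bclass_sum k is_biset_comp grp
      biset_comp_sum_left biset_comp_sum_right | assumption)+
  also have "\<dots> = bclass k K G (biset_comp H Y X)"
    using r Y X grp by (intro bclass_cong is_biset_comp biset_comp_cong) (auto dest: gen_bisetsD)
  finally show ?thesis .
qed

lemma bmor_prod_bclass:
  assumes k: "cring k" and Y: "is_biset L K Y" and X: "is_biset H G X"
  shows "bmor_prod k L K H G (bclass k L K Y) (bclass k H G X) =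
    bclass k (L \<boxtimes> H) (K \<boxtimes> G) (biset_prod Y X)"
proof -
  note r = biset_rep[OF Y] biset_rep[OF X]
  have "bmor_prod k L K H G (bclass k L K Y) (bclass k H G X) =
      bclass k (L \<boxtimes> H) (K \<boxtimes> G) (biset_prod (biset_rep L K Y) (biset_rep H G X))"
    unfolding bmor_prod_def
  proof (rule bilin_ext_bclass[OF k kB_module[OF k] _ _ _ Y X])
  qed (drule gen_bisetsD | rule bclass_closed bclass_sum k is_biset_prod
      biset_prod_sum_left biset_prod_sum_right | assumption)+
  also have "\<dots> = bclass k (L \<boxtimes> H) (K \<boxtimes> G) (biset_prod Y X)"
    using r Y X by (intro bclass_cong is_biset_prod biset_prod_cong) (auto dest: gen_bisetsD)
  finally show ?thesis .
qed

section \<open>Transitive bisets as subgroups\<close>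

text \<open>
  \<open>X\<close> is a single orbit of \<open>P \<times> Q\<close> acting by \<open>x \<mapsto> p x q\<^sup>-\<^sup>1\<close>, and \<open>S\<close> is the stabilizer of \<open>x0\<close>.
\<close>

definition presented_at ::
  "'h monoid \<Rightarrow> 'g monoid \<Rightarrow> ('h \<times> 'g) set \<Rightarrow> ('h, 'x, 'g) biset \<Rightarrow> 'x \<Rightarrow> bool" where
  "presented_at P Q S X x0 \<longleftrightarrow> is_biset P Q X \<and> S \<subseteq> carrier P \<times> carrier Q \<and> x0 \<in> bcar X \<and>
    (\<forall>x\<in>bcar X. \<exists>p\<in>carrier P. \<exists>q\<in>carrier Q. x = lact X p (ract X x0 q)) \<and>
    (\<forall>p\<in>carrier P. \<forall>q\<in>carrier Q. lact X p x0 = ract X x0 q \<longleftrightarrow> (p, q) \<in> S)"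

definition presented :: "'h monoid \<Rightarrow> 'g monoid \<Rightarrow> ('h \<times> 'g) set \<Rightarrow> ('h, 'x, 'g) biset \<Rightarrow> bool" where
  "presented P Q S X \<longleftrightarrow> (\<exists>x0. presented_at P Q S X x0)"

lemma presented_atD:
  assumes "presented_at P Q S X x0"
  shows "is_biset P Q X" "S \<subseteq> carrier P \<times> carrier Q" "x0 \<in> bcar X"
    "\<And>x. x \<in> bcar X \<Longrightarrow> \<exists>p\<in>carrier P. \<exists>q\<in>carrier Q. x = lact X p (ract X x0 q)"
    "\<And>p q. p \<in> carrier P \<Longrightarrow> q \<in> carrier Q \<Longrightarrow> lact X p x0 = ract X x0 q \<longleftrightarrow> (p, q) \<in> S"
  using assms unfolding presented_at_def by simp_all

lemma presented_is_biset: "presented P Q S X \<Longrightarrow> is_biset P Q X"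
  by (auto simp: presented_def presented_at_def)

text \<open>
  Cancelling \<open>p'\<close> on the left and \<open>q\<close> on the right turns an equality between two points of the orbit
  into membership in the stabilizer of the base point.
\<close>

lemma translates_eq_iff:
  fixes P (structure) and Q (structure)
  assumes "group P" "group Q" and X: "is_biset P Q X" and x: "x \<in> bcar X"
    and pq: "p \<in> carrier P" "p' \<in> carrier P" "q \<in> carrier Q" "q' \<in> carrier Q"
  shows "lact X p (ract X x q) = lact X p' (ract X x q') \<longleftrightarrow>
    lact X (inv\<^bsub>P\<^esub> p' \<otimes>\<^bsub>P\<^esub> p) x = ract X x (q' \<otimes>\<^bsub>Q\<^esub> inv\<^bsub>Q\<^esub> q)"
proof -
  interpret P: group P by fact
  interpret Q: group Q by fact
  note D = is_bisetD[OF X]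
  have lc: "lact X (inv\<^bsub>P\<^esub> h) (lact X h z) = z" "lact X h (lact X (inv\<^bsub>P\<^esub> h) z) = z"
    if "h \<in> carrier P" "z \<in> bcar X" for h z
    using that D(4) by (simp_all flip: D(6))
  have rc: "ract X (ract X z g) (inv\<^bsub>Q\<^esub> g) = z" "ract X (ract X z (inv\<^bsub>Q\<^esub> g)) g = z"
    if "g \<in> carrier Q" "z \<in> bcar X" for g z
    using that D(5) by (simp_all flip: D(7))
  define \<phi> where "\<phi> z = ract X (lact X (inv\<^bsub>P\<^esub> p') z) (inv\<^bsub>Q\<^esub> q)" for z
  define \<psi> where "\<psi> z = lact X p' (ract X z q)" for z
  have c: "lact X p (ract X x q) \<in> bcar X" "lact X p' (ract X x q') \<in> bcar X"
    using D(2,3) x pq by auto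
  have inv: "\<psi> (\<phi> z) = z" if "z \<in> bcar X" for z
    using that pq D(2,3) by (simp add: \<phi>_def \<psi>_def rc lc)
  have 1: "\<phi> (lact X p (ract X x q)) = lact X (inv\<^bsub>P\<^esub> p' \<otimes>\<^bsub>P\<^esub> p) x"
  proof -
    have "\<phi> (lact X p (ract X x q)) = lact X (inv\<^bsub>P\<^esub> p') (lact X p (ract X (ract X x q) (inv\<^bsub>Q\<^esub> q)))"
      using x pq D(2,3) by (simp add: \<phi>_def D(8))
    also have "\<dots> = lact X (inv\<^bsub>P\<^esub> p' \<otimes>\<^bsub>P\<^esub> p) x"
      using x pq by (simp add: rc D(6))
    finally show ?thesis .
  qed
  have 2: "\<phi> (lact X p' (ract X x q')) = ract X x (q' \<otimes>\<^bsub>Q\<^esub> inv\<^bsub>Q\<^esub> q)"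
    using x pq D(2,3,7) by (simp add: \<phi>_def lc)
  show ?thesis
    unfolding 1[symmetric] 2[symmetric] by (metis inv c)
qed

text \<open>
  Orbits with the same stabilizer are isomorphic: \<open>p x\<^sub>0 q \<mapsto> p y\<^sub>0 q\<close> is well defined and injective,
  since equality of such points is expressed by \<open>S\<close> alone.
\<close>

lemma presented_unique:
  fixes P (structure) and Q (structure)
  assumes grp: "group P" "group Q" and "presented P Q S X" "presented P Q S Y"
  shows "biset_iso P Q X Y"
proof -
  interpret P: group P by fact
  interpret Q: group Q by fact
  obtain x0 where at_x0: "presented_at P Q S X x0"
    using assms(3) by (auto simp: presented_def)
  note X = presented_atD(1)[OF at_x0] and x0 = presented_atD(3)[OF at_x0]
    and x_st = presented_atD(5)[OF at_x0] and x_ex = presented_atD(4)[OF at_x0]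
  obtain y0 where at_y0: "presented_at P Q S Y y0"
    using assms(4) by (auto simp: presented_def)
  note Y = presented_atD(1)[OF at_y0] and y0 = presented_atD(3)[OF at_y0]
    and y_st = presented_atD(5)[OF at_y0] and y_ex = presented_atD(4)[OF at_y0]
  note XD = is_bisetD[OF X] and YD = is_bisetD[OF Y]
  let ?x = "\<lambda>p q. lact X p (ract X x0 q)" and ?y = "\<lambda>p q. lact Y p (ract Y y0 q)"
  have eq: "?x p q = ?x p' q' \<longleftrightarrow> ?y p q = ?y p' q'"
    if "p \<in> carrier P" "p' \<in> carrier P" "q \<in> carrier Q" "q' \<in> carrier Q" for p p' q q'
    using that by (simp add: translates_eq_iff[OF grp X x0] translates_eq_iff[OF grp Y y0] x_st y_st)
  define f where "f x = (THE y. \<exists>p\<in>carrier P. \<exists>q\<in>carrier Q. x = ?x p q \<and> y = ?y p q)" for x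
  have f: "f (?x p q) = ?y p q" if "p \<in> carrier P" "q \<in> carrier Q" for p q
    unfolding f_def
  proof (rule the_equality)
    show "\<exists>p'\<in>carrier P. \<exists>q'\<in>carrier Q. ?x p q = ?x p' q' \<and> ?y p q = ?y p' q'"
      using that by blast
    fix y assume "\<exists>p'\<in>carrier P. \<exists>q'\<in>carrier Q. ?x p q = ?x p' q' \<and> y = ?y p' q'"
    then obtain p' q' where "p' \<in> carrier P" "q' \<in> carrier Q" "?x p q = ?x p' q'" "y = ?y p' q'"
      by blast
    then show "y = ?y p q" using eq[of p p' q q'] that by simp
  qed
  have "inj_on f (bcar X)"
  proof (rule inj_onI)
    fix x x' assume "x \<in> bcar X" "x' \<in> bcar X" and e: "f x = f x'"
    then obtain p q p' q' where "p \<in> carrier P" "p' \<in> carrier P" "q \<in> carrier Q" "q' \<in> carrier Q"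
      and "x = ?x p q" "x' = ?x p' q'"
      using x_ex by meson
    then show "x = x'" using e eq[of p p' q q'] by (simp add: f)
  qed
  moreover have "f ` bcar X = bcar Y"
  proof
    show "f ` bcar X \<subseteq> bcar Y"
    proof
      fix y assume "y \<in> f ` bcar X"
      then obtain p q where "p \<in> carrier P" "q \<in> carrier Q" "y = f (?x p q)" using x_ex by blast
      then show "y \<in> bcar Y" using y0 YD(2,3) by (simp add: f)
    qed
    show "bcar Y \<subseteq> f ` bcar X"
    proof
      fix y assume "y \<in> bcar Y"
      then obtain p q where pq: "p \<in> carrier P" "q \<in> carrier Q" "y = ?y p q" using y_ex by blast
      then have "y = f (?x p q)" "?x p q \<in> bcar X" using x0 XD(2,3) by (simp_all add: f)
      then show "y \<in> f ` bcar X" by blast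
    qed
  qed
  moreover have "f (lact X h x) = lact Y h (f x)" if h: "h \<in> carrier P" and x: "x \<in> bcar X" for h x
  proof -
    obtain p q where pq: "p \<in> carrier P" "q \<in> carrier Q" "x = ?x p q" using x_ex[OF x] by blast
    then have "lact X h x = ?x (h \<otimes>\<^bsub>P\<^esub> p) q" "lact Y h (?y p q) = ?y (h \<otimes>\<^bsub>P\<^esub> p) q"
      using h x0 y0 XD(3,6) YD(3,6) by auto
    then show ?thesis using pq h by (simp add: f)
  qed
  moreover have "f (ract X x g) = ract Y (f x) g" if g: "g \<in> carrier Q" and x: "x \<in> bcar X" for g x
  proof -
    obtain p q where pq: "p \<in> carrier P" "q \<in> carrier Q" "x = ?x p q" using x_ex[OF x] by blast
    then have "ract X x g = ?x p (q \<otimes>\<^bsub>Q\<^esub> g)" "ract Y (?y p q) g = ?y p (q \<otimes>\<^bsub>Q\<^esub> g)"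
      using g x0 y0 XD(3,7,8) YD(3,7,8) by auto
    then show ?thesis using pq g by (simp add: f)
  qed
  ultimately show ?thesis
    unfolding biset_iso_def by (intro exI[of _ f]) (auto simp: bij_betw_def)
qed

text \<open>
  The Mackey formula in the case of a single double coset.  The base point is the class of \<open>(y\<^sub>0, x\<^sub>0)\<close>.
  By the tensor rule, \<open>k y\<^sub>0 = y\<^sub>0 h\<close> and \<open>h x\<^sub>0 = x\<^sub>0 g\<close> for some \<open>h\<close> is what it means that \<open>k\<close> and \<open>g\<close>
  translate it equally, which is composition of relations.  Every class has the form
  \<open>(k y\<^sub>0, h x\<^sub>0 g)\<close>, and the factorization of \<open>h\<close> into a part that \<open>S\<close> moves across \<open>y\<^sub>0\<close> and a part that
  \<open>T\<close> moves across \<open>x\<^sub>0\<close> brings it into the orbit of the base point.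
\<close>

lemma presented_comp:
  fixes K (structure) and H (structure) and G (structure)
  assumes grp: "group K" "group H" "group G"
    and "presented K H S Y" "presented H G T X"
    and trans: "\<And>h. h \<in> carrier H \<Longrightarrow> \<exists>s\<in>Range S. \<exists>t\<in>Domain T. h = s \<otimes>\<^bsub>H\<^esub> t"
  shows "presented K G (S O T) (biset_comp H Y X)"
proof -
  interpret K: group K by fact
  interpret H: group H by fact
  interpret G: group G by fact
  obtain y0 where at_y0: "presented_at K H S Y y0"
    using assms(4) by (auto simp: presented_def)
  note Y = presented_atD(1)[OF at_y0] and y0 = presented_atD(3)[OF at_y0]
    and y_st = presented_atD(5)[OF at_y0] and y_ex = presented_atD(4)[OF at_y0] and S = presented_atD(2)[OF at_y0]
  obtain x0 where at_x0: "presented_at H G T X x0"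
    using assms(5) by (auto simp: presented_def)
  note X = presented_atD(1)[OF at_x0] and x0 = presented_atD(3)[OF at_x0]
    and x_st = presented_atD(5)[OF at_x0] and x_ex = presented_atD(4)[OF at_x0] and T = presented_atD(2)[OF at_x0]
  note XD = is_bisetD[OF X] and YD = is_bisetD[OF Y]
  let ?o = "bal_orbit H Y X" and ?C = "biset_comp H Y X"
  note l = lact_bal_orbit[OF grp(2) Y] and r = ract_bal_orbit[OF X]
    and move = bal_orbit_move[OF grp(2) Y X] and eq_iff = bal_orbit_eq_iff[OF grp(2) Y X]
  have "is_biset K G ?C" by (rule is_biset_comp) fact+
  moreover have "?o y0 x0 \<in> bcar ?C" using x0 y0 by (auto simp: bcar_biset_comp)
  moreover have "\<exists>p\<in>carrier K. \<exists>q\<in>carrier G. z = lact ?C p (ract ?C (?o y0 x0) q)" if z: "z \<in> bcar ?C" for z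
  proof -
    obtain y x where yx: "y \<in> bcar Y" "x \<in> bcar X" and z: "z = ?o y x"
      using z by (auto simp: bcar_biset_comp)
    obtain k h where k: "k \<in> carrier K" and h: "h \<in> carrier H" and y: "y = lact Y k (ract Y y0 h)"
      using y_ex[OF yx(1)] by blast
    obtain h' g where h': "h' \<in> carrier H" and g: "g \<in> carrier G" and x: "x = lact X h' (ract X x0 g)"
      using x_ex[OF yx(2)] by blast
    obtain a s t d where as: "(a, s) \<in> S" and td: "(t, d) \<in> T" and st: "h \<otimes>\<^bsub>H\<^esub> h' = s \<otimes>\<^bsub>H\<^esub> t"
      using trans[of "h \<otimes>\<^bsub>H\<^esub> h'"] h h' by auto
    then have mem: "a \<in> carrier K" "s \<in> carrier H" "t \<in> carrier H" "d \<in> carrier G"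
      using S T by auto
    note c = mem k h h' g
    \<comment> \<open>The middle element \<open>h h' = s t\<close> is split: \<open>s\<close> moves left across \<open>y0\<close> to become \<open>a\<close>, and \<open>t\<close> moves
      right across \<open>x0\<close> to become \<open>d\<close>.\<close>
    have y: "y = ract Y (lact Y k y0) h" using y YD(8) h k y0 by simp
    have "?o y x = ?o (lact Y k y0) (lact X h x)"
      unfolding y using move[of "lact Y k y0" x h] YD(2) y0 k h yx(2) by simp
    also have "lact X h x = lact X s (lact X t (ract X x0 g))"
      using XD(3,6) x0 c st by (simp add: x flip: XD(6))
    also have "?o (lact Y k y0) \<dots> = ?o (ract Y (lact Y k y0) s) (lact X t (ract X x0 g))"
      using move[of "lact Y k y0" "lact X t (ract X x0 g)" s] YD(2) XD(2,3) y0 x0 c by simp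
    also have "ract Y (lact Y k y0) s = lact Y (k \<otimes>\<^bsub>K\<^esub> a) y0"
      using YD(6,8) y_st[of a s] as y0 c by simp
    also have "lact X t (ract X x0 g) = ract X x0 (d \<otimes>\<^bsub>G\<^esub> g)"
      using XD(7) XD(8)[of t g x0] x_st[of t d] td x0 c by simp
    also have "?o (lact Y (k \<otimes>\<^bsub>K\<^esub> a) y0) \<dots> = lact ?C (k \<otimes>\<^bsub>K\<^esub> a) (ract ?C (?o y0 x0) (d \<otimes>\<^bsub>G\<^esub> g))"
      using x0 y0 c XD(3) by (simp add: l r)
    finally show ?thesis using z c by (metis K.m_closed G.m_closed)
  qed
  moreover have "lact ?C p (?o y0 x0) = ract ?C (?o y0 x0) q \<longleftrightarrow> (p, q) \<in> S O T"
    if p: "p \<in> carrier K" and q: "q \<in> carrier G" for p q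
  proof -
    have "lact ?C p (?o y0 x0) = ract ?C (?o y0 x0) q \<longleftrightarrow> ?o y0 (ract X x0 q) = ?o (lact Y p y0) x0"
      using x0 y0 p q by (simp add: l r eq_commute)
    also have "\<dots> \<longleftrightarrow> (\<exists>h\<in>carrier H. lact Y p y0 = ract Y y0 h \<and> ract X x0 q = lact X h x0)"
      using eq_iff x0 y0 p q XD(3) YD(2) by simp
    also have "\<dots> \<longleftrightarrow> (\<exists>h\<in>carrier H. (p, h) \<in> S \<and> (h, q) \<in> T)"
      using x_st y_st p q by (metis (no_types))
    also have "\<dots> \<longleftrightarrow> (p, q) \<in> S O T" using S by auto
    finally show ?thesis .
  qed
  moreover have "S O T \<subseteq> carrier K \<times> carrier G" using S T by auto
  ultimately show ?thesis unfolding presented_def presented_at_def by blast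
qed

definition prod_rel :: "('a elt \<times> 'b elt) set \<Rightarrow> ('a elt \<times> 'b elt) set \<Rightarrow> ('a elt \<times> 'b elt) set"
  where "prod_rel S T = {(Tup p h, Tup q g) | p q h g. (p, q) \<in> S \<and> (h, g) \<in> T}"

lemma presented_prod:
  assumes "presented L K S Y" "presented H G T X"
  shows "presented (L \<boxtimes> H) (K \<boxtimes> G) (prod_rel S T) (biset_prod Y X)"
proof -
  obtain y0 where at_y0: "presented_at L K S Y y0"
    using assms(1) by (auto simp: presented_def)
  note Y = presented_atD[OF at_y0]
  obtain x0 where at_x0: "presented_at H G T X x0"
    using assms(2) by (auto simp: presented_def)
  note X = presented_atD[OF at_x0]
  have "\<exists>p\<in>carrier (L \<boxtimes> H). \<exists>q\<in>carrier (K \<boxtimes> G).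
      z = lact (biset_prod Y X) p (ract (biset_prod Y X) (y0, x0) q)" if z: "z \<in> bcar (biset_prod Y X)" for z
  proof -
    obtain y x where "z = (y, x)" "y \<in> bcar Y" "x \<in> bcar X" using z by (auto simp: biset_prod_def)
    moreover obtain p q where "p \<in> carrier L" "q \<in> carrier K" "y = lact Y p (ract Y y0 q)"
      using Y(4) calculation by blast
    moreover obtain h g where "h \<in> carrier H" "g \<in> carrier G" "x = lact X h (ract X x0 g)"
      using X(4) calculation by blast
    ultimately show ?thesis
      by (intro bexI[of _ "Tup p h"] bexI[of _ "Tup q g"]) (auto simp: biset_prod_def carrier_prod_grp)
  qed
  moreover have "(y0, x0) \<in> bcar (biset_prod Y X)" using X Y by (simp add: biset_prod_def)
  moreover have "lact (biset_prod Y X) p (y0, x0) = ract (biset_prod Y X) (y0, x0) q \<longleftrightarrow> (p, q) \<in> prod_rel S T"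
    if "p \<in> carrier (L \<boxtimes> H)" "q \<in> carrier (K \<boxtimes> G)" for p q
    using that X(5) Y(5) by (auto simp: carrier_prod_grp biset_prod_def prod_rel_def)
  moreover have "prod_rel S T \<subseteq> carrier (L \<boxtimes> H) \<times> carrier (K \<boxtimes> G)"
    using X(2) Y(2) by (auto simp: prod_rel_def carrier_prod_grp)
  ultimately show ?thesis
    unfolding presented_def presented_at_def using is_biset_prod[OF Y(1) X(1)] by blast
qed

lemma presented_subgroup:
  fixes P (structure) and Q (structure)
  assumes grp: "group P" "group Q" and "presented P Q S X"
  shows "subgroup S (P \<times>\<times> Q)"
proof -
  interpret P: group P by fact
  interpret Q: group Q by fact
  obtain x0 where at_x0: "presented_at P Q S X x0"
    using assms(3) by (auto simp: presented_def)
  note X = presented_atD(1)[OF at_x0] and x0 = presented_atD(3)[OF at_x0]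
    and st = presented_atD(5)[OF at_x0] and S = presented_atD(2)[OF at_x0]
  note D = is_bisetD[OF X]
  have "(\<one>\<^bsub>P\<^esub>, \<one>\<^bsub>Q\<^esub>) \<in> S"
    using st[of "\<one>\<^bsub>P\<^esub>" "\<one>\<^bsub>Q\<^esub>"] D(4,5) x0 by simp
  moreover have "(p \<otimes>\<^bsub>P\<^esub> p', q \<otimes>\<^bsub>Q\<^esub> q') \<in> S" if "(p, q) \<in> S" "(p', q') \<in> S" for p q p' q'
  proof -
    have c: "p \<in> carrier P" "p' \<in> carrier P" "q \<in> carrier Q" "q' \<in> carrier Q" using that S by auto
    have "lact X (p \<otimes>\<^bsub>P\<^esub> p') x0 = ract X x0 (q \<otimes>\<^bsub>Q\<^esub> q')"
      using D(6,7) D(8)[of p q' x0] st[of p q] st[of p' q'] c that x0 by simp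
    then show ?thesis using st c by simp
  qed
  moreover have "(inv\<^bsub>P\<^esub> p, inv\<^bsub>Q\<^esub> q) \<in> S" if "(p, q) \<in> S" for p q
  proof -
    have c: "p \<in> carrier P" "q \<in> carrier Q" using that S by auto
    then have "lact X (inv\<^bsub>P\<^esub> p) x0 = ract X x0 (inv\<^bsub>Q\<^esub> q)"
      using translates_eq_iff[OF grp X x0, of "inv\<^bsub>P\<^esub> p" "\<one>\<^bsub>P\<^esub>" "\<one>\<^bsub>Q\<^esub>" "inv\<^bsub>Q\<^esub> q"]
        translates_eq_iff[OF grp X x0, of "\<one>\<^bsub>P\<^esub>" p q "\<one>\<^bsub>Q\<^esub>"]
        translates_eq_iff[OF grp X x0, of p "\<one>\<^bsub>P\<^esub>" "\<one>\<^bsub>Q\<^esub>" q]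
        st[OF c] that x0 D(2,3,4,5) by simp
    then show ?thesis using st c by simp
  qed
  ultimately show ?thesis
    using S grp by (intro subgroup.intro) (auto simp: DirProd_def inv_DirProd[unfolded DirProd_def] subset_iff)
qed

text \<open>
  The homogeneous space \<open>(P \<times> Q) / S\<close>, with \<open>Q\<close> acting on the right through inverses.
\<close>

definition coset_biset :: "'h monoid \<Rightarrow> 'g monoid \<Rightarrow> ('h \<times> 'g) set \<Rightarrow> ('h, ('h \<times> 'g) set, 'g) biset" where
  "coset_biset P Q S =
    \<lparr>bcar = {c <#\<^bsub>P \<times>\<times> Q\<^esub> S | c. c \<in> carrier (P \<times>\<times> Q)},
     lact = (\<lambda>p C. (p, \<one>\<^bsub>Q\<^esub>) <#\<^bsub>P \<times>\<times> Q\<^esub> C),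
     ract = (\<lambda>C q. (\<one>\<^bsub>P\<^esub>, inv\<^bsub>Q\<^esub> q) <#\<^bsub>P \<times>\<times> Q\<^esub> C)\<rparr>"

lemma presented_coset_biset:
  fixes P (structure) and Q (structure)
  assumes grp: "group P" "group Q" and fin: "finite (carrier P)" "finite (carrier Q)"
    and S: "subgroup S (P \<times>\<times> Q)"
  shows "presented P Q S (coset_biset P Q S)"
proof -
  interpret P: group P by fact
  interpret Q: group Q by fact
  interpret R: group "P \<times>\<times> Q" using grp by (rule DirProd_group)
  interpret S: subgroup S "P \<times>\<times> Q" by (rule S)
  let ?X = "coset_biset P Q S"
  let ?c = "\<lambda>p q. (p, q) <#\<^bsub>P \<times>\<times> Q\<^esub> S"
  have bcar: "bcar ?X = (\<lambda>(p, q). ?c p q) ` (carrier P \<times> carrier Q)"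
    by (auto simp: coset_biset_def)
  have l: "lact ?X p (?c a b) = ?c (p \<otimes>\<^bsub>P\<^esub> a) b" if "p \<in> carrier P" "a \<in> carrier P" "b \<in> carrier Q" for p a b
    using that S.subset by (simp add: coset_biset_def R.lcos_m_assoc)
  have r: "ract ?X (?c a b) q = ?c a (inv\<^bsub>Q\<^esub> q \<otimes>\<^bsub>Q\<^esub> b)" if "q \<in> carrier Q" "a \<in> carrier P" "b \<in> carrier Q" for q a b
    using that S.subset by (simp add: coset_biset_def R.lcos_m_assoc)
  have "is_biset P Q ?X"
    using fin unfolding is_biset_def bcar
    by (auto simp: l r P.m_assoc Q.m_assoc Q.inv_mult_group)
  moreover have "?c \<one>\<^bsub>P\<^esub> \<one>\<^bsub>Q\<^esub> \<in> bcar ?X" by (auto simp: bcar)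
  moreover have "\<exists>p\<in>carrier P. \<exists>q\<in>carrier Q. x = lact ?X p (ract ?X (?c \<one>\<^bsub>P\<^esub> \<one>\<^bsub>Q\<^esub>) q)"
    if x: "x \<in> bcar ?X" for x
  proof -
    obtain a b where "a \<in> carrier P" "b \<in> carrier Q" "x = ?c a b" using x by (auto simp: bcar)
    then show ?thesis by (intro bexI[of _ a] bexI[of _ "inv\<^bsub>Q\<^esub> b"]) (auto simp: l r)
  qed
  moreover have "lact ?X p (?c \<one>\<^bsub>P\<^esub> \<one>\<^bsub>Q\<^esub>) = ract ?X (?c \<one>\<^bsub>P\<^esub> \<one>\<^bsub>Q\<^esub>) q \<longleftrightarrow> (p, q) \<in> S"
    if pq: "p \<in> carrier P" "q \<in> carrier Q" for p q
  proof -
    have "?c p \<one>\<^bsub>Q\<^esub> = ?c \<one>\<^bsub>P\<^esub> (inv\<^bsub>Q\<^esub> q) \<longleftrightarrow> (p, q) \<in> S"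
    proof
      assume "?c p \<one>\<^bsub>Q\<^esub> = ?c \<one>\<^bsub>P\<^esub> (inv\<^bsub>Q\<^esub> q)"
      then have "(\<one>\<^bsub>P\<^esub>, inv\<^bsub>Q\<^esub> q) \<in> ?c p \<one>\<^bsub>Q\<^esub>"
        using S.one_closed pq by (force simp: l_coset_def)
      then obtain a b where ab: "(a, b) \<in> S" "\<one>\<^bsub>P\<^esub> = p \<otimes>\<^bsub>P\<^esub> a" "inv\<^bsub>Q\<^esub> q = \<one>\<^bsub>Q\<^esub> \<otimes>\<^bsub>Q\<^esub> b"
        by (auto simp: l_coset_def)
      then have "a \<in> carrier P" "b \<in> carrier Q" using S.subset by auto
      then have "a = inv\<^bsub>P\<^esub> p" "b = inv\<^bsub>Q\<^esub> q"
        using ab(3) pq P.inv_equality[OF ab(2)[symmetric]] by auto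
      then have "(inv\<^bsub>P\<^esub> p, inv\<^bsub>Q\<^esub> q) \<in> S" using ab by simp
      then show "(p, q) \<in> S"
        using S.m_inv_closed[of "(inv\<^bsub>P\<^esub> p, inv\<^bsub>Q\<^esub> q)"] grp pq by simp
    next
      assume "(p, q) \<in> S"
      then have "(inv\<^bsub>P\<^esub> p, inv\<^bsub>Q\<^esub> q) \<in> S"
        using S.m_inv_closed[of "(p, q)"] grp pq by simp
      then have "(\<one>\<^bsub>P\<^esub>, inv\<^bsub>Q\<^esub> q) \<in> ?c p \<one>\<^bsub>Q\<^esub>"
        unfolding l_coset_def using pq
        by (intro UN_I[of "(inv\<^bsub>P\<^esub> p, inv\<^bsub>Q\<^esub> q)"]) simp_all
      then show "?c p \<one>\<^bsub>Q\<^esub> = ?c \<one>\<^bsub>P\<^esub> (inv\<^bsub>Q\<^esub> q)"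
        using pq S by (intro R.l_repr_independence) simp_all
    qed
    then show ?thesis using pq by (simp add: l r)
  qed
  moreover have "S \<subseteq> carrier P \<times> carrier Q" using S.subset by simp
  ultimately have "presented_at P Q S ?X (?c \<one>\<^bsub>P\<^esub> \<one>\<^bsub>Q\<^esub>)"
    unfolding presented_at_def by blast
  then show ?thesis by (auto simp: presented_def)
qed

definition rel_mor :: "('k, 'r) ring_scheme \<Rightarrow> 'a grp \<Rightarrow> 'a grp \<Rightarrow> ('a elt \<times> 'a elt) set \<Rightarrow> ('a, 'k) bmor" where
  "rel_mor k P Q S = bclass k P Q (coset_biset P Q S)"

lemma bclass_presented:
  assumes grp: "group P" "group Q" and fin: "finite (carrier P)" "finite (carrier Q)"
    and X: "presented P Q S X"
  shows "bclass k P Q X = rel_mor k P Q S"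
  unfolding rel_mor_def
  using presented_coset_biset[OF grp fin presented_subgroup[OF grp X]] presented_unique[OF grp X]
  by (intro bclass_cong presented_is_biset[OF X]) blast

lemma rel_mor_closed:
  assumes "cring k" "group P" "group Q" "finite (carrier P)" "finite (carrier Q)" "subgroup S (P \<times>\<times> Q)"
  shows "rel_mor k P Q S \<in> carrier (kB k P Q)"
  unfolding rel_mor_def
  using presented_coset_biset[OF assms(2-6)] assms(1) by (intro bclass_closed presented_is_biset)

text \<open>
  By \<open>trans\<close> there is a single double coset of the second projection of \<open>S\<close> and the first projection
  of \<open>T\<close> in \<open>H\<close>, so the composite is again transitive.
\<close>

lemma rel_mor_comp:
  assumes k: "cring k" and grp: "group K" "group H" "group G"
    and fin: "finite (carrier K)" "finite (carrier H)" "finite (carrier G)"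
    and S: "subgroup S (K \<times>\<times> H)" and T: "subgroup T (H \<times>\<times> G)"
    and trans: "\<And>h. h \<in> carrier H \<Longrightarrow> \<exists>s\<in>Range S. \<exists>t\<in>Domain T. h = s \<otimes>\<^bsub>H\<^esub> t"
  shows "bmor_comp k K H G (rel_mor k K H S) (rel_mor k H G T) = rel_mor k K G (S O T)"
proof -
  note p = presented_coset_biset[OF grp(1,2) fin(1,2) S] presented_coset_biset[OF grp(2,3) fin(2,3) T]
  show ?thesis
    unfolding rel_mor_def[of k K H] rel_mor_def[of k H G]
      bmor_comp_bclass[OF k grp p[THEN presented_is_biset]]
    by (rule bclass_presented[OF grp(1,3) fin(1,3) presented_comp[OF grp p trans]])
qed

lemma group_prod_grp:
  fixes H (structure) and G (structure)
  assumes "group H" "group G"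
  shows "group (H \<boxtimes> G)"
proof -
  interpret H: group H by fact
  interpret G: group G by fact
  show ?thesis
  proof (rule groupI)
    fix x assume "x \<in> carrier (H \<boxtimes> G)"
    then obtain h g where "x = Tup h g" "h \<in> carrier H" "g \<in> carrier G" by (auto simp: carrier_prod_grp)
    then show "\<exists>y\<in>carrier (H \<boxtimes> G). y \<otimes>\<^bsub>H \<boxtimes> G\<^esub> x = \<one>\<^bsub>H \<boxtimes> G\<^esub>"
      by (intro bexI[of _ "Tup (inv\<^bsub>H\<^esub> h) (inv\<^bsub>G\<^esub> g)"]) (auto simp: carrier_prod_grp one_prod_grp)
  qed (auto simp: carrier_prod_grp one_prod_grp H.m_assoc G.m_assoc)
qed

lemma inv_prod_grp:
  assumes "group H" "group G" "h \<in> carrier H" "g \<in> carrier G"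
  shows "inv\<^bsub>H \<boxtimes> G\<^esub> (Tup h g) = Tup (inv\<^bsub>H\<^esub> h) (inv\<^bsub>G\<^esub> g)"
proof -
  interpret H: group H by fact
  interpret G: group G by fact
  interpret HG: group "H \<boxtimes> G" using assms(1,2) by (rule group_prod_grp)
  show ?thesis
    using assms(3,4) by (intro HG.inv_equality) (auto simp: carrier_prod_grp one_prod_grp)
qed

lemma finite_prod_grp: "finite (carrier H) \<Longrightarrow> finite (carrier G) \<Longrightarrow> finite (carrier (H \<boxtimes> G))"
  by (rule finite_subset[of _ "(\<lambda>(h, g). Tup h g) ` (carrier H \<times> carrier G)"]) (auto simp: carrier_prod_grp)

lemma rel_mor_prod:
  assumes k: "cring k" and grp: "group L" "group K" "group H" "group G"
    and fin: "finite (carrier L)" "finite (carrier K)" "finite (carrier H)" "finite (carrier G)"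
    and S: "subgroup S (L \<times>\<times> K)" and T: "subgroup T (H \<times>\<times> G)"
  shows "bmor_prod k L K H G (rel_mor k L K S) (rel_mor k H G T) =
    rel_mor k (L \<boxtimes> H) (K \<boxtimes> G) (prod_rel S T)"
    "subgroup (prod_rel S T) ((L \<boxtimes> H) \<times>\<times> (K \<boxtimes> G))"
proof -
  note p = presented_coset_biset[OF grp(1,2) fin(1,2) S] presented_coset_biset[OF grp(3,4) fin(3,4) T]
  note g = group_prod_grp[OF grp(1,3)] group_prod_grp[OF grp(2,4)]
  note f = finite_prod_grp[OF fin(1,3)] finite_prod_grp[OF fin(2,4)]
  show "bmor_prod k L K H G (rel_mor k L K S) (rel_mor k H G T) =
    rel_mor k (L \<boxtimes> H) (K \<boxtimes> G) (prod_rel S T)"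
    unfolding rel_mor_def[of k L K] rel_mor_def[of k H G]
      bmor_prod_bclass[OF k p[THEN presented_is_biset]]
    by (rule bclass_presented[OF g f presented_prod[OF p]])
  show "subgroup (prod_rel S T) ((L \<boxtimes> H) \<times>\<times> (K \<boxtimes> G))"
    by (rule presented_subgroup[OF g presented_prod[OF p]])
qed

lemma subgroup_relcomp:
  assumes grp: "group K" "group H" "group G"
    and S: "subgroup S (K \<times>\<times> H)" and T: "subgroup T (H \<times>\<times> G)"
  shows "subgroup (S O T) (K \<times>\<times> G)"
proof (rule subgroup.intro)
  interpret S: subgroup S "K \<times>\<times> H" by (rule S)
  interpret T: subgroup T "H \<times>\<times> G" by (rule T)
  show "S O T \<subseteq> carrier (K \<times>\<times> G)" using S.subset T.subset by (auto simp: DirProd_def)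
  show "\<one>\<^bsub>K \<times>\<times> G\<^esub> \<in> S O T" using S.one_closed T.one_closed by (auto simp: DirProd_def)
  fix x assume "x \<in> S O T"
  then obtain a b c where x: "x = (a, c)" "(a, b) \<in> S" "(b, c) \<in> T" by auto
  moreover have "a \<in> carrier K" "b \<in> carrier H" "c \<in> carrier G"
    using x S.subset T.subset by (auto simp: DirProd_def)
  ultimately show "inv\<^bsub>K \<times>\<times> G\<^esub> x \<in> S O T"
    using S.m_inv_closed[of "(a, b)"] T.m_inv_closed[of "(b, c)"] grp by (auto simp: inv_DirProd)
  fix y assume "y \<in> S O T"
  then obtain a' b' c' where y: "y = (a', c')" "(a', b') \<in> S" "(b', c') \<in> T" by auto
  then show "x \<otimes>\<^bsub>K \<times>\<times> G\<^esub> y \<in> S O T"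
    using x S.m_closed[of "(a, b)" "(a', b')"] T.m_closed[of "(b, c)" "(b', c')"] by (auto simp: mult_DirProd)
qed

section \<open>The subgroups of the canonical bisets\<close>

text \<open>
  A group acting on itself by translations through two homomorphisms is transitive as soon as one of
  them is onto, and the stabilizer of its unit is their fibre product.  Identities, isomorphisms and the diagonal
  bisets are of this form.
\<close>

lemma presented_hom_biset:
  fixes P (structure) and Q (structure) and Z (structure)
  assumes grp: "group P" "group Q" "group Z" and fin: "finite (carrier Z)"
    and u: "u \<in> hom P Z" and v: "v \<in> hom Q Z"
    and surj: "carrier Z \<subseteq> u ` carrier P \<or> carrier Z \<subseteq> v ` carrier Q"
    and X: "bcar X = carrier Z" "\<And>p z. lact X p z = u p \<otimes>\<^bsub>Z\<^esub> z" "\<And>z q. ract X z q = z \<otimes>\<^bsub>Z\<^esub> v q"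
  shows "presented P Q {(p, q). p \<in> carrier P \<and> q \<in> carrier Q \<and> u p = v q} X"
proof -
  interpret P: group P by fact
  interpret Q: group Q by fact
  interpret Z: group Z by fact
  interpret u: group_hom P Z u using grp u by (simp add: group_hom_def group_hom_axioms_def)
  interpret v: group_hom Q Z v using grp v by (simp add: group_hom_def group_hom_axioms_def)
  have "is_biset P Q X"
    using fin by (simp add: is_biset_def X Z.m_assoc)
  moreover have "\<exists>p\<in>carrier P. \<exists>q\<in>carrier Q. z = lact X p (ract X \<one>\<^bsub>Z\<^esub> q)" if z: "z \<in> bcar X" for z
    using surj
  proof
    assume "carrier Z \<subseteq> u ` carrier P"
    then obtain p where "p \<in> carrier P" "z = u p" using z X(1) by auto
    then show ?thesis by (intro bexI[of _ p] bexI[of _ "\<one>\<^bsub>Q\<^esub>"]) (simp_all add: X)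
  next
    assume "carrier Z \<subseteq> v ` carrier Q"
    then obtain q where "q \<in> carrier Q" "z = v q" using z X(1) by auto
    then show ?thesis by (intro bexI[of _ "\<one>\<^bsub>P\<^esub>"] bexI[of _ q]) (simp_all add: X)
  qed
  ultimately have "presented_at P Q {(p, q). p \<in> carrier P \<and> q \<in> carrier Q \<and> u p = v q} X \<one>\<^bsub>Z\<^esub>"
    by (auto simp: presented_at_def X(1) simp: X(2,3))
  then show ?thesis by (auto simp: presented_def)
qed

text \<open>
  In the opposite biset the condition \<open>g x\<^sub>0 = x\<^sub>0 h\<close> reads \<open>x\<^sub>0 g\<^sup>-\<^sup>1 = h\<^sup>-\<^sup>1 x\<^sub>0\<close>, and \<open>S\<close> is closed under inverses.
\<close>

lemma presented_op:
  fixes H (structure) and G (structure)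
  assumes grp: "group H" "group G" and X: "presented H G S X"
  shows "presented G H (S\<inverse>) (biset_op H G X)"
proof -
  interpret H: group H by fact
  interpret G: group G by fact
  interpret S: subgroup S "H \<times>\<times> G" by (rule presented_subgroup[OF grp X])
  obtain x0 where at_x0: "presented_at H G S X x0" using X by (auto simp: presented_def)
  note X = presented_atD[OF at_x0]
  note D = is_bisetD[OF X(1)]
  have "is_biset G H (biset_op H G X)"
    using D by (simp add: is_biset_def biset_op_def H.inv_mult_group G.inv_mult_group)
  moreover have "\<exists>g\<in>carrier G. \<exists>h\<in>carrier H. x = lact (biset_op H G X) g (ract (biset_op H G X) x0 h)"
    if x: "x \<in> bcar X" for x
  proof -
    obtain p q where "p \<in> carrier H" "q \<in> carrier G" "x = lact X p (ract X x0 q)" using X(4)[OF x] by blast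
    then show ?thesis using X(3) D(8)
      by (intro bexI[of _ "inv\<^bsub>G\<^esub> q"] bexI[of _ "inv\<^bsub>H\<^esub> p"]) (simp_all add: biset_op_def)
  qed
  moreover have "lact (biset_op H G X) g x0 = ract (biset_op H G X) x0 h \<longleftrightarrow> (g, h) \<in> S\<inverse>"
    if gh: "g \<in> carrier G" "h \<in> carrier H" for g h
  proof -
    have "lact X (inv\<^bsub>H\<^esub> h) x0 = ract X x0 (inv\<^bsub>G\<^esub> g) \<longleftrightarrow> (inv\<^bsub>H\<^esub> h, inv\<^bsub>G\<^esub> g) \<in> S"
      using X(5) gh by simp
    also have "\<dots> \<longleftrightarrow> (h, g) \<in> S"
      using S.m_inv_closed[of "(h, g)"] S.m_inv_closed[of "(inv\<^bsub>H\<^esub> h, inv\<^bsub>G\<^esub> g)"] gh grp by auto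
    finally show ?thesis by (auto simp: biset_op_def)
  qed
  ultimately have "presented_at G H (S\<inverse>) (biset_op H G X) x0"
    using X(2,3) by (auto simp: presented_at_def biset_op_def)
  then show ?thesis by (auto simp: presented_def)
qed

lemma presented_relabel:
  fixes P (structure) and Q (structure) and P' (structure) and Q' (structure)
  assumes grp: "group P" "group Q" "group P'" "group Q'" and X: "presented P Q S X"
    and p: "p \<in> hom P' P" "carrier P \<subseteq> p ` carrier P'"
    and q: "q \<in> hom Q' Q" "carrier Q \<subseteq> q ` carrier Q'"
  shows "presented P' Q' {(a, b). a \<in> carrier P' \<and> b \<in> carrier Q' \<and> (p a, q b) \<in> S} (biset_relabel p q X)"
proof -
  interpret p: group_hom P' P p using grp p by (simp add: group_hom_def group_hom_axioms_def)
  interpret q: group_hom Q' Q q using grp q by (simp add: group_hom_def group_hom_axioms_def)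
  obtain x0 where at_x0: "presented_at P Q S X x0" using X by (auto simp: presented_def)
  note X = presented_atD[OF at_x0]
  note D = is_bisetD[OF X(1)]
  have "is_biset P' Q' (biset_relabel p q X)"
    using D by (simp add: is_biset_def biset_relabel_def)
  moreover have "\<exists>a\<in>carrier P'. \<exists>b\<in>carrier Q'. x = lact X (p a) (ract X x0 (q b))" if "x \<in> bcar X" for x
    using X(4)[OF that] p(2) q(2) by blast
  ultimately have "presented_at P' Q' {(a, b). a \<in> carrier P' \<and> b \<in> carrier Q' \<and> (p a, q b) \<in> S}
      (biset_relabel p q X) x0"
    using X(3,5) by (auto simp: presented_at_def biset_relabel_def)
  then show ?thesis by (auto simp: presented_def)
qed

definition contr_rel :: "'a grp \<Rightarrow> 'a grp \<Rightarrow> 'a grp \<Rightarrow> ('a elt \<times> 'a elt) set" where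
  "contr_rel L K H = {(Tup l h, Tup (Tup l k) (Tup k h)) | l k h.
     l \<in> carrier L \<and> k \<in> carrier K \<and> h \<in> carrier H}"

definition diag_rel :: "'a grp \<Rightarrow> 'a grp \<Rightarrow> 'a grp \<Rightarrow> ('a elt \<times> 'a elt) set" where
  "diag_rel G K H = {(Tup (Tup k h) g, Tup (Tup k g) (Tup h g)) | k h g.
     k \<in> carrier K \<and> h \<in> carrier H \<and> g \<in> carrier G}"

definition assoc_rel :: "'a grp \<Rightarrow> 'a grp \<Rightarrow> 'a grp \<Rightarrow> ('a elt \<times> 'a elt) set" where
  "assoc_rel L K H = {(Tup (Tup l k) h, Tup l (Tup k h)) | l k h.
     l \<in> carrier L \<and> k \<in> carrier K \<and> h \<in> carrier H}"

definition runit_rel :: "'a grp \<Rightarrow> ('a elt \<times> 'a elt) set" where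
  "runit_rel H = {(h, Tup h Unit) | h. h \<in> carrier H}"

definition rarrow_rel :: "'a grp \<Rightarrow> ('a elt \<times> 'a elt) set" where
  "rarrow_rel H = {(Tup h h, Unit) | h. h \<in> carrier H}"

definition infl_rel :: "'a grp \<Rightarrow> 'a grp \<Rightarrow> ('a elt \<times> 'a elt) set" where
  "infl_rel G H = {(Tup h g, h) | h g. h \<in> carrier H \<and> g \<in> carrier G}"

definition res_rel :: "'a grp \<Rightarrow> 'a grp \<Rightarrow> ('a elt \<times> 'a elt) set" where
  "res_rel G H = {(h, Tup h \<one>\<^bsub>G\<^esub>) | h. h \<in> carrier H}"

text \<open>
  Contraction of the two inner copies of \<open>K\<close> while \<open>G\<close> is carried along.
\<close>

definition mixed_rel :: "'a grp \<Rightarrow> 'a grp \<Rightarrow> 'a grp \<Rightarrow> 'a grp \<Rightarrow> ('a elt \<times> 'a elt) set" where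
  "mixed_rel G L K H = {(Tup (Tup l h) g, Tup (Tup (Tup l k) g) (Tup k h)) | l k h g.
     l \<in> carrier L \<and> k \<in> carrier K \<and> h \<in> carrier H \<and> g \<in> carrier G}"

text \<open>
  Contraction of the two inner copies of \<open>K\<close> along the diagonal of \<open>G\<close>; this is the relation behind
  the composition attached to \<open>A_G\<close>.
\<close>

definition shift_contr_rel :: "'a grp \<Rightarrow> 'a grp \<Rightarrow> 'a grp \<Rightarrow> 'a grp \<Rightarrow> ('a elt \<times> 'a elt) set" where
  "shift_contr_rel G L K H = {(Tup (Tup l h) g, Tup (Tup (Tup l k) g) (Tup (Tup k h) g)) | l k h g.
     l \<in> carrier L \<and> k \<in> carrier K \<and> h \<in> carrier H \<and> g \<in> carrier G}"

lemma triv_grp_simps [simp]: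
  "carrier triv_grp = {Unit}" "mult triv_grp x y = Unit" "\<one>\<^bsub>triv_grp\<^esub> = Unit"
  by (simp_all add: triv_grp_def)

lemma group_triv_grp: "group triv_grp"
  by (rule groupI) auto

lemma presented_Id:
  assumes "group G" "finite (carrier G)"
  shows "presented G G (Id_on (carrier G)) (Id_bs G)"
proof -
  have "presented G G {(p, q). p \<in> carrier G \<and> q \<in> carrier G \<and> id p = id q} (Id_bs G)"
    by (rule presented_hom_biset[OF assms(1,1,1,2)]) (auto simp: Id_bs_def hom_def)
  also have "{(p, q). p \<in> carrier G \<and> q \<in> carrier G \<and> id p = id q} = Id_on (carrier G)" by auto
  finally show ?thesis .
qed

lemma presented_Iso:
  assumes "group G" "group H" "finite (carrier G)" "\<psi> \<in> hom H G"
  shows "presented G H {(\<psi> h, h) | h. h \<in> carrier H} (Iso_bs G \<psi>)"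
proof -
  have "presented G H {(p, q). p \<in> carrier G \<and> q \<in> carrier H \<and> id p = \<psi> q} (Iso_bs G \<psi>)"
    by (rule presented_hom_biset[OF assms(1,2,1,3)]) (use assms(4) in \<open>auto simp: Iso_bs_def hom_def\<close>)
  also have "{(p, q). p \<in> carrier G \<and> q \<in> carrier H \<and> id p = \<psi> q} = {(\<psi> h, h) | h. h \<in> carrier H}"
    using assms(4) by (auto simp: hom_def)
  finally show ?thesis .
qed

lemma presented_runit:
  assumes "group H" "finite (carrier H)"
  shows "presented H (H \<boxtimes> triv_grp) (runit_rel H) (Iso_bs H tfst)"
proof -
  have "presented H (H \<boxtimes> triv_grp) {(tfst h, h) | h. h \<in> carrier (H \<boxtimes> triv_grp)} (Iso_bs H tfst)"
    using assms group_triv_grp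
    by (intro presented_Iso group_prod_grp) (auto simp: hom_def carrier_prod_grp)
  also have "{(tfst h, h) | h. h \<in> carrier (H \<boxtimes> triv_grp)} = runit_rel H"
    by (auto simp: runit_rel_def carrier_prod_grp)
  finally show ?thesis .
qed

lemma presented_assoc:
  assumes "group L" "group K" "group H" "finite (carrier L)" "finite (carrier K)" "finite (carrier H)"
  shows "presented ((L \<boxtimes> K) \<boxtimes> H) (L \<boxtimes> (K \<boxtimes> H)) (assoc_rel L K H) (Iso_bs ((L \<boxtimes> K) \<boxtimes> H) assoc_map)"
proof -
  have "presented ((L \<boxtimes> K) \<boxtimes> H) (L \<boxtimes> (K \<boxtimes> H)) {(assoc_map h, h) | h. h \<in> carrier (L \<boxtimes> (K \<boxtimes> H))}
      (Iso_bs ((L \<boxtimes> K) \<boxtimes> H) assoc_map)"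
    using assms by (intro presented_Iso group_prod_grp finite_prod_grp)
      (auto simp: hom_def carrier_prod_grp assoc_map_def)
  also have "{(assoc_map h, h) | h. h \<in> carrier (L \<boxtimes> (K \<boxtimes> H))} = assoc_rel L K H"
    by (force simp: assoc_rel_def carrier_prod_grp assoc_map_def)
  finally show ?thesis .
qed

lemma presented_U:
  assumes "group G" "group K" "group H" "finite (carrier G)" "finite (carrier K)" "finite (carrier H)"
  shows "presented ((K \<boxtimes> H) \<boxtimes> G) ((K \<boxtimes> G) \<boxtimes> (H \<boxtimes> G)) (diag_rel G K H) (U_bs G K H)"
proof -
  let ?P = "(K \<boxtimes> H) \<boxtimes> G" and ?Q = "(K \<boxtimes> G) \<boxtimes> (H \<boxtimes> G)"
  let ?u = "\<lambda>p. Tup (Tup (tfst (tfst p)) (tsnd p)) (Tup (tsnd (tfst p)) (tsnd p))"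
  have "presented ?P ?Q {(p, q). p \<in> carrier ?P \<and> q \<in> carrier ?Q \<and> ?u p = id q} (U_bs G K H)"
    using assms by (intro presented_hom_biset[where Z = ?Q] group_prod_grp finite_prod_grp)
      (auto simp: hom_def carrier_prod_grp U_bs_def Let_def)
  also have "{(p, q). p \<in> carrier ?P \<and> q \<in> carrier ?Q \<and> ?u p = id q} = diag_rel G K H"
    by (auto simp: diag_rel_def carrier_prod_grp)
  finally show ?thesis .
qed

text \<open>
  At the unit, \<open>(h\<^sub>1, h\<^sub>2)\<close> acts as \<open>h\<^sub>1 h\<^sub>2\<^sup>-\<^sup>1\<close>, so the stabilizer is the diagonal.
\<close>

lemma presented_rarrow:
  fixes H (structure)
  assumes H: "group H" "finite (carrier H)"
  shows "presented (H \<boxtimes> H) triv_grp (rarrow_rel H) (rarrow H)"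
proof -
  interpret group H by fact
  have "is_biset (H \<boxtimes> H) triv_grp (rarrow H)"
    using H(2) by (auto simp: is_biset_def rarrow_def carrier_prod_grp one_prod_grp m_assoc inv_mult_group)
  moreover have "\<exists>p\<in>carrier (H \<boxtimes> H). \<exists>q\<in>carrier triv_grp. x = lact (rarrow H) p (ract (rarrow H) \<one> q)"
    if "x \<in> bcar (rarrow H)" for x
    using that by (intro bexI[of _ "Tup x \<one>"] bexI[of _ Unit]) (auto simp: rarrow_def carrier_prod_grp)
  moreover have "x \<otimes> inv y = \<one> \<longleftrightarrow> x = y" if "x \<in> carrier H" "y \<in> carrier H" for x y
    using that by (metis inv_closed inv_equality inv_inv r_inv)
  ultimately have "presented_at (H \<boxtimes> H) triv_grp (rarrow_rel H) (rarrow H) \<one>"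
    by (auto simp: presented_at_def rarrow_rel_def rarrow_def carrier_prod_grp)
  then show ?thesis by (auto simp: presented_def)
qed

lemma presented_contr:
  assumes grp: "group L" "group K" "group H" and fin: "finite (carrier L)" "finite (carrier K)" "finite (carrier H)"
  shows "presented (L \<boxtimes> H) ((L \<boxtimes> K) \<boxtimes> (K \<boxtimes> H)) (contr_rel L K H) (contr_bs L K H)"
proof -
  let ?P = "L \<boxtimes> H" and ?Q = "(L \<boxtimes> K) \<boxtimes> (K \<boxtimes> H)"
  let ?p = "\<lambda>p. Tup (Tup (tfst p) Unit) (tsnd p)"
  let ?q = "\<lambda>p. Tup (Tup (tfst (tfst p)) (Tup (tsnd (tfst p)) (tfst (tsnd p)))) (tsnd (tsnd p))"
  let ?S = "prod_rel (prod_rel (Id_on (carrier L)) ((rarrow_rel K)\<inverse>)) (Id_on (carrier H))"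
  have "presented ((L \<boxtimes> triv_grp) \<boxtimes> H) ((L \<boxtimes> (K \<boxtimes> K)) \<boxtimes> H) ?S
      (biset_prod (biset_prod (Id_bs L) (larrow K)) (Id_bs H))"
    unfolding larrow_def using grp fin group_triv_grp
    by (intro presented_prod presented_Id presented_op presented_rarrow group_prod_grp)
  then have "presented ?P ?Q {(a, b). a \<in> carrier ?P \<and> b \<in> carrier ?Q \<and> (?p a, ?q b) \<in> ?S} (contr_bs L K H)"
    unfolding contr_bs_def using grp group_triv_grp
    by (rule_tac presented_relabel[where P = "(L \<boxtimes> triv_grp) \<boxtimes> H" and Q = "(L \<boxtimes> (K \<boxtimes> K)) \<boxtimes> H"])
      (auto intro!: group_prod_grp simp: hom_def carrier_prod_grp image_iff; force)+
  also have "{(a, b). a \<in> carrier ?P \<and> b \<in> carrier ?Q \<and> (?p a, ?q b) \<in> ?S} = contr_rel L K H"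
    by (auto simp: contr_rel_def carrier_prod_grp prod_rel_def rarrow_rel_def)
  finally show ?thesis .
qed

lemma subgroup_infl_rel:
  assumes "group G" "group H"
  shows "subgroup (infl_rel G H) ((H \<boxtimes> G) \<times>\<times> H)"
proof -
  interpret G: group G by fact
  interpret H: group H by fact
  show ?thesis
    using group_prod_grp[OF assms(2,1)] assms
    by (intro subgroup.intro) (auto simp: infl_rel_def carrier_prod_grp one_prod_grp inv_prod_grp)
qed

lemma subgroup_res_rel:
  assumes "group G" "group H"
  shows "subgroup (res_rel G H) (H \<times>\<times> (H \<boxtimes> G))"
proof -
  interpret G: group G by fact
  interpret H: group H by fact
  show ?thesis
    using group_prod_grp[OF assms(2,1)] assms
    by (intro subgroup.intro) (auto simp: res_rel_def carrier_prod_grp one_prod_grp inv_prod_grp)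
qed

lemma subgroup_mixed_rel:
  assumes "group G" "group L" "group K" "group H"
  shows "subgroup (mixed_rel G L K H) (((L \<boxtimes> H) \<boxtimes> G) \<times>\<times> (((L \<boxtimes> K) \<boxtimes> G) \<boxtimes> (K \<boxtimes> H)))"
proof -
  interpret G: group G by fact
  interpret H: group H by fact
  interpret L: group L by fact
  interpret K: group K by fact
  show ?thesis
    using group_prod_grp[OF group_prod_grp[OF assms(2,4)] assms(1)] group_prod_grp[OF assms(2,4)]
      group_prod_grp[OF assms(2,3)] group_prod_grp[OF group_prod_grp[OF assms(2,3)] assms(1)]
      group_prod_grp[OF assms(3,4)]
      group_prod_grp[OF group_prod_grp[OF group_prod_grp[OF assms(2,3)] assms(1)] group_prod_grp[OF assms(3,4)]] assms
    by (intro subgroup.intro) (auto simp: mixed_rel_def carrier_prod_grp one_prod_grp inv_prod_grp)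
qed

section \<open>The essential ideal\<close>

lemma linear_mapD:
  assumes "linear_map k M N f"
  shows "\<And>x. x \<in> carrier M \<Longrightarrow> f x \<in> carrier N"
    "\<And>x y. x \<in> carrier M \<Longrightarrow> y \<in> carrier M \<Longrightarrow> f (x \<oplus>\<^bsub>M\<^esub> y) = f x \<oplus>\<^bsub>N\<^esub> f y"
    "\<And>c x. c \<in> carrier k \<Longrightarrow> x \<in> carrier M \<Longrightarrow> f (c \<odot>\<^bsub>M\<^esub> x) = c \<odot>\<^bsub>N\<^esub> f x"
  using assms by (auto simp: linear_map_def hom_def)

lemma linear_map_comp:
  "linear_map k M N f \<Longrightarrow> linear_map k N N' g \<Longrightarrow> linear_map k M N' (\<lambda>x. g (f x))"
  by (simp add: linear_map_def hom_def Pi_iff)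

lemma linear_map_submod_gen:
  assumes M: "module k M" and N: "module k N" and f: "linear_map k M N f"
    and V: "submodule V k N" and S: "S \<subseteq> carrier M" "\<And>x. x \<in> S \<Longrightarrow> f x \<in> V"
    and x: "x \<in> submod_gen k M S"
  shows "f x \<in> V"
proof -
  interpret M: module k M by (rule M)
  interpret N: module k N by (rule N)
  note f = linear_mapD[OF f] and V' = N.submoduleE[OF V]
  have f0: "f \<zero>\<^bsub>M\<^esub> = \<zero>\<^bsub>N\<^esub>"
    using f(3)[of "\<zero>\<^bsub>k\<^esub>" "\<zero>\<^bsub>M\<^esub>"] f(1)[of "\<zero>\<^bsub>M\<^esub>"] by simp
  have fm: "f (\<ominus>\<^bsub>M\<^esub> x) = \<ominus>\<^bsub>N\<^esub> f x" if "x \<in> carrier M" for x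
    using f(2)[of "\<ominus>\<^bsub>M\<^esub> x" x] f(1)[of x] f(1)[of "\<ominus>\<^bsub>M\<^esub> x"] that f0
    by (simp add: M.M.l_neg N.M.minus_equality)
  have "submodule {x \<in> carrier M. f x \<in> V} k M"
    using V' f f0 fm V subgroup.one_closed[OF submodule.axioms(1)[OF V]]
    by (intro M.submoduleI) auto
  then have "submod_gen k M S \<subseteq> {x \<in> carrier M. f x \<in> V}"
    using S by (intro submod_gen_least) auto
  with x show ?thesis by blast
qed

lemma module_update_mult_one: "module k (M\<lparr>mult := m, one := e\<rparr>) \<longleftrightarrow> module k M"
  by (simp add: module_def module_axioms_def abelian_group_def abelian_group_axioms_def abelian_monoid_def)

lemma submod_gen_update_mult_one: "submod_gen k (M\<lparr>mult := m, one := e\<rparr>) S = submod_gen k M S"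
  by (simp add: submod_gen_def submodule_def submodule_axioms_def)

lemma ess_supp_iff:
  assumes M: "module k (fobj B (H \<boxtimes> H))"
    and closed: "\<And>K \<alpha> \<beta>. K \<in> D \<Longrightarrow> \<alpha> \<in> carrier (fobj B (K \<boxtimes> H)) \<Longrightarrow> \<beta> \<in> carrier (fobj B (H \<boxtimes> K)) \<Longrightarrow>
      PA_comp k B H K H \<beta> \<alpha> \<in> carrier (fobj B (H \<boxtimes> H))"
  shows "H \<in> ess_supp k D B \<longleftrightarrow> H \<in> D \<and> \<not> carrier (fobj B (H \<boxtimes> H)) \<subseteq> ess_ideal k D B H"
    "submodule (ess_ideal k D B H) k (fobj B (H \<boxtimes> H))"
proof -
  have M': "module k (PA_End k B H)" using M by (simp add: PA_End_def module_update_mult_one)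
  have sub: "submodule (ess_ideal k D B H) k (PA_End k B H)"
    unfolding ess_ideal_def using closed by (intro submod_gen_submodule M') (auto simp: PA_End_def)
  show "H \<in> ess_supp k D B \<longleftrightarrow> H \<in> D \<and> \<not> carrier (fobj B (H \<boxtimes> H)) \<subseteq> ess_ideal k D B H"
    using quot_alg_trivial_iff[OF M' sub] by (auto simp: ess_supp_def ess_alg_def PA_End_def)
  show "submodule (ess_ideal k D B H) k (fobj B (H \<boxtimes> H))"
    using sub by (simp add: PA_End_def submodule_def submodule_axioms_def)
qed

definition ess_gens :: "('k, 'r) ring_scheme \<Rightarrow> 'a grp set \<Rightarrow> ('a, 'k, 'm) green_fun \<Rightarrow> 'a grp \<Rightarrow> 'm set" where
  "ess_gens k D B H = {PA_comp k B H K H \<beta> \<alpha> | K \<alpha> \<beta>. K \<in> D \<and> order K < order H \<and>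
     \<alpha> \<in> carrier (fobj B (K \<boxtimes> H)) \<and> \<beta> \<in> carrier (fobj B (H \<boxtimes> K))}"

lemma ess_ideal_eq: "ess_ideal k D B H = submod_gen k (fobj B (H \<boxtimes> H)) (ess_gens k D B H)"
  by (simp add: ess_ideal_def ess_gens_def PA_End_def submod_gen_update_mult_one)

lemma biset_functorD:
  assumes "biset_functor k D A"
  shows "H \<in> D \<Longrightarrow> module k (fobj A H)"
    "G \<in> D \<Longrightarrow> H \<in> D \<Longrightarrow> \<phi> \<in> carrier (kB k H G) \<Longrightarrow>
      linear_map k (fobj A G) (fobj A H) (fmor A G H \<phi>)"
    "G \<in> D \<Longrightarrow> a \<in> carrier (fobj A G) \<Longrightarrow> fmor A G G (bmor_id k G) a = a"
    "G \<in> D \<Longrightarrow> H \<in> D \<Longrightarrow> K \<in> D \<Longrightarrow> \<phi> \<in> carrier (kB k K H) \<Longrightarrow> \<psi> \<in> carrier (kB k H G) \<Longrightarrow>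
      a \<in> carrier (fobj A G) \<Longrightarrow> fmor A G K (bmor_comp k K H G \<phi> \<psi>) a = fmor A H K \<phi> (fmor A G H \<psi> a)"
  using assms unfolding biset_functor_def by simp_all

lemma green_biset_functorD:
  assumes "green_biset_functor k D A"
  shows "biset_functor k D A"
    "K \<in> D \<Longrightarrow> H \<in> D \<Longrightarrow> a \<in> carrier (fobj A K) \<Longrightarrow>
      linear_map k (fobj A H) (fobj A (K \<boxtimes> H)) (\<lambda>b. gprod A K H a b)"
    "geps A \<in> carrier (fobj A triv_grp)"
    "L \<in> D \<Longrightarrow> K \<in> D \<Longrightarrow> H \<in> D \<Longrightarrow> a \<in> carrier (fobj A L) \<Longrightarrow> b \<in> carrier (fobj A K) \<Longrightarrow>
      c \<in> carrier (fobj A H) \<Longrightarrow> gprod A (L \<boxtimes> K) H (gprod A L K a b) c =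
       fmor A (L \<boxtimes> (K \<boxtimes> H)) ((L \<boxtimes> K) \<boxtimes> H)
         (bclass k ((L \<boxtimes> K) \<boxtimes> H) (L \<boxtimes> (K \<boxtimes> H)) (Iso_bs ((L \<boxtimes> K) \<boxtimes> H) assoc_map))
         (gprod A L (K \<boxtimes> H) a (gprod A K H b c))"
    "H \<in> D \<Longrightarrow> a \<in> carrier (fobj A H) \<Longrightarrow>
       fmor A (H \<boxtimes> triv_grp) H (bclass k H (H \<boxtimes> triv_grp) (Iso_bs H tfst))
         (gprod A H triv_grp a (geps A)) = a"
    "K \<in> D \<Longrightarrow> T \<in> D \<Longrightarrow> H \<in> D \<Longrightarrow> L \<in> D \<Longrightarrow> \<alpha> \<in> carrier (kB k T K) \<Longrightarrow> \<beta> \<in> carrier (kB k L H) \<Longrightarrow>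
       a \<in> carrier (fobj A K) \<Longrightarrow> b \<in> carrier (fobj A H) \<Longrightarrow>
       fmor A (K \<boxtimes> H) (T \<boxtimes> L) (bmor_prod k T K L H \<alpha> \<beta>) (gprod A K H a b) =
       gprod A T L (fmor A K T \<alpha> a) (fmor A H L \<beta> b)"
  using assms unfolding green_biset_functor_def by simp_all

section \<open>Subgroups acting on a Green biset functor\<close>

locale green_functor =
  fixes k :: "('k, 'r) ring_scheme" and D :: "'a grp set" and A :: "('a, 'k, 'm) green_fun"
  assumes k: "cring k" and D: "admissible D" and A: "green_biset_functor k D A"
begin

lemma D_group: "G \<in> D \<Longrightarrow> group G" and D_finite: "G \<in> D \<Longrightarrow> finite (carrier G)"
  using conjunct1[OF D[unfolded admissible_def]] by simp_all

lemma D_subquotient: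
  assumes "H \<in> D" "subgroup S H" "N \<lhd> H\<lparr>carrier := S\<rparr>" "group Q" "Q \<cong> H\<lparr>carrier := S\<rparr> Mod N"
  shows "Q \<in> D"
  using conjunct1[OF conjunct2[OF D[unfolded admissible_def]]] assms by simp

lemma D_prod:
  assumes "H \<in> D" "K \<in> D"
  shows "H \<boxtimes> K \<in> D"
  using spec[OF bspec[OF bspec[OF conjunct2[OF conjunct2[OF D[unfolded admissible_def]]] assms(1)] assms(2)],
      of "H \<boxtimes> K"] group_prod_grp[OF D_group[OF assms(1)] D_group[OF assms(2)]] iso_refl
  by blast

text \<open>
  The trivial group is the quotient of the trivial subgroup of any object by itself.
\<close>

lemma D_triv:
  assumes H: "H \<in> D"
  shows "triv_grp \<in> D"
proof -
  interpret group H using H by (rule D_group)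
  let ?T = "H\<lparr>carrier := {\<one>\<^bsub>H\<^esub>}\<rparr>"
  interpret T: group ?T by (rule subgroup_imp_group[OF triv_subgroup])
  have "carrier (?T Mod {\<one>\<^bsub>H\<^esub>}) = {{\<one>\<^bsub>H\<^esub>}}"
    by (auto simp: FactGroup_def RCOSETS_def r_coset_def)
  then have "(\<lambda>_. {\<one>\<^bsub>H\<^esub>}) \<in> iso triv_grp (?T Mod {\<one>\<^bsub>H\<^esub>})"
    by (auto simp: iso_def hom_def bij_betw_def FactGroup_def set_mult_def)
  then have "triv_grp \<cong> ?T Mod {\<one>\<^bsub>H\<^esub>}"
    by (auto simp: is_iso_def)
  moreover have "{\<one>\<^bsub>H\<^esub>} \<lhd> ?T" using T.one_is_normal by simp
  ultimately show ?thesis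
    using D_subquotient[OF H triv_subgroup] group_triv_grp by blast
qed

text \<open>
  The map \<open>A(Q) \<rightarrow> A(P)\<close> given by the transitive biset with stabilizer \<open>S\<close>.
\<close>

definition act :: "'a grp \<Rightarrow> 'a grp \<Rightarrow> ('a elt \<times> 'a elt) set \<Rightarrow> 'm \<Rightarrow> 'm" where
  "act P Q S = fmor A Q P (rel_mor k P Q S)"

lemmas functorD = biset_functorD[OF green_biset_functorD(1)[OF A]]

lemmas fobj_module = functorD(1)

lemma rel_mor_in:
  "P \<in> D \<Longrightarrow> Q \<in> D \<Longrightarrow> subgroup S (P \<times>\<times> Q) \<Longrightarrow> rel_mor k P Q S \<in> carrier (kB k P Q)"
  using rel_mor_closed[OF k] D_group D_finite by blast

lemma act_linear:
  assumes "P \<in> D" "Q \<in> D" "subgroup S (P \<times>\<times> Q)"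
  shows "linear_map k (fobj A Q) (fobj A P) (act P Q S)"
  unfolding act_def by (rule functorD(2)[OF assms(2,1) rel_mor_in[OF assms]])

lemma act_closed:
  "P \<in> D \<Longrightarrow> Q \<in> D \<Longrightarrow> subgroup S (P \<times>\<times> Q) \<Longrightarrow> a \<in> carrier (fobj A Q) \<Longrightarrow> act P Q S a \<in> carrier (fobj A P)"
  using linear_mapD(1)[OF act_linear] by blast

lemma fmor_presented:
  assumes "P \<in> D" "Q \<in> D" "presented P Q S X"
  shows "fmor A Q P (bclass k P Q X) = act P Q S"
  unfolding act_def using assms by (subst bclass_presented) (auto intro: D_group D_finite)

lemma act_comp:
  assumes PQR: "P \<in> D" "Q \<in> D" "R \<in> D" and S: "subgroup S (P \<times>\<times> Q)" and T: "subgroup T (Q \<times>\<times> R)"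
    and trans: "\<And>h. h \<in> carrier Q \<Longrightarrow> \<exists>s\<in>Range S. \<exists>t\<in>Domain T. h = s \<otimes>\<^bsub>Q\<^esub> t"
    and a: "a \<in> carrier (fobj A R)"
  shows "act P Q S (act Q R T a) = act P R (S O T) a"
proof -
  have "act P Q S (act Q R T a) = fmor A R P (bmor_comp k P Q R (rel_mor k P Q S) (rel_mor k Q R T)) a"
    unfolding act_def
    by (rule functorD(4)[OF PQR(3,2,1) rel_mor_in[OF PQR(1,2) S] rel_mor_in[OF PQR(2,3) T] a, symmetric])
  also have "\<dots> = act P R (S O T) a"
    unfolding act_def using PQR D_group D_finite by (subst rel_mor_comp[OF k _ _ _ _ _ _ S T trans]) auto
  finally show ?thesis .
qed

text \<open>
  If the first projection of \<open>T\<close> is onto, there is a single double coset whatever \<open>S\<close> is.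
\<close>

lemma act_comp_full:
  assumes PQR: "P \<in> D" "Q \<in> D" "R \<in> D" and S: "subgroup S (P \<times>\<times> Q)" and T: "subgroup T (Q \<times>\<times> R)"
    and full: "carrier Q \<subseteq> Domain T" and a: "a \<in> carrier (fobj A R)"
  shows "act P Q S (act Q R T a) = act P R (S O T) a"
proof (rule act_comp[OF PQR S T _ a])
  interpret Q: group Q using PQR(2) by (rule D_group)
  fix h assume "h \<in> carrier Q"
  moreover have "\<one>\<^bsub>Q\<^esub> \<in> Range S" using subgroup.one_closed[OF S] by auto
  ultimately show "\<exists>s\<in>Range S. \<exists>t\<in>Domain T. h = s \<otimes>\<^bsub>Q\<^esub> t"
    using full by (intro bexI[of _ "\<one>\<^bsub>Q\<^esub>"] bexI[of _ h]) auto
qed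

lemma subgroup_Id:
  assumes "P \<in> D"
  shows "subgroup (Id_on (carrier P)) (P \<times>\<times> P)"
  using presented_subgroup[OF _ _ presented_Id] D_group[OF assms] D_finite[OF assms] by blast

lemma act_Id:
  assumes "P \<in> D" "a \<in> carrier (fobj A P)"
  shows "act P P (Id_on (carrier P)) a = a"
proof -
  have "bmor_id k P = rel_mor k P P (Id_on (carrier P))"
    unfolding bmor_id_def using assms(1) by (intro bclass_presented presented_Id D_group D_finite)
  then show ?thesis
    using functorD(3)[OF assms] by (simp add: act_def)
qed

lemma gprod_closed:
  assumes "K \<in> D" "H \<in> D" "a \<in> carrier (fobj A K)" "b \<in> carrier (fobj A H)"
  shows "gprod A K H a b \<in> carrier (fobj A (K \<boxtimes> H))"
  using linear_mapD(1)[OF green_biset_functorD(2)[OF A]] assms by blast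

lemma subgroup_prod_rel:
  assumes "P \<in> D" "Q \<in> D" "P' \<in> D" "Q' \<in> D"
    and "subgroup S (P \<times>\<times> Q)" "subgroup T (P' \<times>\<times> Q')"
  shows "subgroup (prod_rel S T) ((P \<boxtimes> P') \<times>\<times> (Q \<boxtimes> Q'))"
  using assms by (intro rel_mor_prod(2)[OF k] D_group D_finite)

lemma gprod_act:
  assumes D4: "P \<in> D" "Q \<in> D" "P' \<in> D" "Q' \<in> D"
    and S: "subgroup S (P \<times>\<times> Q)" and T: "subgroup T (P' \<times>\<times> Q')"
    and a: "a \<in> carrier (fobj A Q)" and b: "b \<in> carrier (fobj A Q')"
  shows "gprod A P P' (act P Q S a) (act P' Q' T b) =
      act (P \<boxtimes> P') (Q \<boxtimes> Q') (prod_rel S T) (gprod A Q Q' a b)"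
proof -
  have "gprod A P P' (act P Q S a) (act P' Q' T b) =
      fmor A (Q \<boxtimes> Q') (P \<boxtimes> P') (bmor_prod k P Q P' Q' (rel_mor k P Q S) (rel_mor k P' Q' T)) (gprod A Q Q' a b)"
    unfolding act_def
    by (rule green_biset_functorD(6)[OF A D4(2,1,4,3) rel_mor_in[OF D4(1,2) S] rel_mor_in[OF D4(3,4) T] a b,
        symmetric])
  also have "\<dots> = act (P \<boxtimes> P') (Q \<boxtimes> Q') (prod_rel S T) (gprod A Q Q' a b)"
    unfolding act_def using D4 by (subst rel_mor_prod[OF k _ _ _ _ _ _ _ _ S T]) (auto intro: D_group D_finite)
  finally show "gprod A P P' (act P Q S a) (act P' Q' T b) =
      act (P \<boxtimes> P') (Q \<boxtimes> Q') (prod_rel S T) (gprod A Q Q' a b)" .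
qed

end

section \<open>Comparison of a Green biset functor with its shift\<close>

context green_functor
begin

lemma PA_comp_act:
  assumes "L \<in> D" "K \<in> D" "H \<in> D"
  shows "PA_comp k A L K H \<beta> \<alpha> =
    act (L \<boxtimes> H) ((L \<boxtimes> K) \<boxtimes> (K \<boxtimes> H)) (contr_rel L K H) (gprod A (L \<boxtimes> K) (K \<boxtimes> H) \<beta> \<alpha>)"
  unfolding PA_comp_def
  using assms by (subst fmor_presented[OF _ _ presented_contr]) (auto intro: D_prod D_group D_finite)

lemma subgroup_contr_rel:
  assumes "L \<in> D" "K \<in> D" "H \<in> D"
  shows "subgroup (contr_rel L K H) ((L \<boxtimes> H) \<times>\<times> ((L \<boxtimes> K) \<boxtimes> (K \<boxtimes> H)))"
  using assms by (intro presented_subgroup[OF _ _ presented_contr] group_prod_grp D_group D_finite)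

lemma subgroup_diag_rel:
  assumes "G \<in> D" "K \<in> D" "H \<in> D"
  shows "subgroup (diag_rel G K H) (((K \<boxtimes> H) \<boxtimes> G) \<times>\<times> ((K \<boxtimes> G) \<boxtimes> (H \<boxtimes> G)))"
  using assms by (intro presented_subgroup[OF _ _ presented_U] group_prod_grp D_group D_finite)

lemma subgroup_assoc_rel:
  assumes "L \<in> D" "K \<in> D" "H \<in> D"
  shows "subgroup (assoc_rel L K H) (((L \<boxtimes> K) \<boxtimes> H) \<times>\<times> (L \<boxtimes> (K \<boxtimes> H)))"
  using assms by (intro presented_subgroup[OF _ _ presented_assoc] group_prod_grp D_group D_finite)

lemma subgroup_rarrow_rel:
  assumes "H \<in> D"
  shows "subgroup (rarrow_rel H) ((H \<boxtimes> H) \<times>\<times> triv_grp)"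
  using assms
  by (intro presented_subgroup[OF _ _ presented_rarrow] group_prod_grp group_triv_grp D_group D_finite)

text \<open>
  The product of \<open>A_G\<close> restricts to the diagonal of \<open>G\<close> before \<open>K\<close> is contracted; the two steps
  amount to a single relation.
\<close>

lemma contr_after_diag:
  assumes "G \<in> D" "L \<in> D" "K \<in> D" "H \<in> D"
  shows "prod_rel (contr_rel L K H) (Id_on (carrier G)) O diag_rel G (L \<boxtimes> K) (K \<boxtimes> H) =
    shift_contr_rel G L K H"
proof -
  have "x \<in> prod_rel (contr_rel L K H) (Id_on (carrier G)) O diag_rel G (L \<boxtimes> K) (K \<boxtimes> H)"
    if "x \<in> shift_contr_rel G L K H" for x
    using that
    by (fastforce simp: prod_rel_def contr_rel_def diag_rel_def shift_contr_rel_def carrier_prod_grp)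
  then show ?thesis
    by (auto simp: prod_rel_def contr_rel_def diag_rel_def shift_contr_rel_def carrier_prod_grp)
qed

lemma shift_fmor:
  assumes "G \<in> D" "P \<in> D" "Q \<in> D" "subgroup S (P \<times>\<times> Q)"
  shows "fmor (shift_green k G A) Q P (rel_mor k P Q S) =
    act (P \<boxtimes> G) (Q \<boxtimes> G) (prod_rel S (Id_on (carrier G)))"
proof -
  have "bmor_id k G = rel_mor k G G (Id_on (carrier G))"
    unfolding bmor_id_def using assms(1) by (intro bclass_presented presented_Id D_group D_finite)
  then show ?thesis
    using assms subgroup_Id
    by (simp add: shift_green_def act_def fun_eq_iff rel_mor_prod(1)[OF k] D_group D_finite)
qed

lemma subgroup_shift_contr_rel:
  assumes "G \<in> D" "L \<in> D" "K \<in> D" "H \<in> D"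
  shows "subgroup (shift_contr_rel G L K H) (((L \<boxtimes> H) \<boxtimes> G) \<times>\<times> (((L \<boxtimes> K) \<boxtimes> G) \<boxtimes> ((K \<boxtimes> H) \<boxtimes> G)))"
  unfolding contr_after_diag[OF assms, symmetric]
  using assms
  by (intro subgroup_relcomp[where H = "((L \<boxtimes> K) \<boxtimes> (K \<boxtimes> H)) \<boxtimes> G"] subgroup_prod_rel
      subgroup_contr_rel subgroup_diag_rel subgroup_Id D_prod D_group)

lemma shift_PA_comp_act:
  assumes GD: "G \<in> D" and D3: "L \<in> D" "K \<in> D" "H \<in> D"
    and \<beta>: "\<beta> \<in> carrier (fobj A ((L \<boxtimes> K) \<boxtimes> G))" and \<alpha>: "\<alpha> \<in> carrier (fobj A ((K \<boxtimes> H) \<boxtimes> G))"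
  shows "PA_comp k (shift_green k G A) L K H \<beta> \<alpha> =
    act ((L \<boxtimes> H) \<boxtimes> G) (((L \<boxtimes> K) \<boxtimes> G) \<boxtimes> ((K \<boxtimes> H) \<boxtimes> G)) (shift_contr_rel G L K H)
      (gprod A ((L \<boxtimes> K) \<boxtimes> G) ((K \<boxtimes> H) \<boxtimes> G) \<beta> \<alpha>)"
proof -
  let ?P = "(L \<boxtimes> H) \<boxtimes> G" and ?Q = "((L \<boxtimes> K) \<boxtimes> (K \<boxtimes> H)) \<boxtimes> G"
  let ?R = "((L \<boxtimes> K) \<boxtimes> G) \<boxtimes> ((K \<boxtimes> H) \<boxtimes> G)"
  note [intro] = D_prod D_group D_finite
  have "bclass k (L \<boxtimes> H) ((L \<boxtimes> K) \<boxtimes> (K \<boxtimes> H)) (contr_bs L K H) =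
      rel_mor k (L \<boxtimes> H) ((L \<boxtimes> K) \<boxtimes> (K \<boxtimes> H)) (contr_rel L K H)"
    using D3 by (intro bclass_presented presented_contr) blast+
  then have "PA_comp k (shift_green k G A) L K H \<beta> \<alpha> =
      act ?P ?Q (prod_rel (contr_rel L K H) (Id_on (carrier G)))
        (gprod (shift_green k G A) (L \<boxtimes> K) (K \<boxtimes> H) \<beta> \<alpha>)"
    unfolding PA_comp_def using D3 GD subgroup_contr_rel by (simp add: shift_fmor D_prod)
  also have "gprod (shift_green k G A) (L \<boxtimes> K) (K \<boxtimes> H) \<beta> \<alpha> =
      act ?Q ?R (diag_rel G (L \<boxtimes> K) (K \<boxtimes> H)) (gprod A ((L \<boxtimes> K) \<boxtimes> G) ((K \<boxtimes> H) \<boxtimes> G) \<beta> \<alpha>)"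
    using D3 GD
    by (simp add: shift_green_def)
      (subst fmor_presented[OF _ _ presented_U]; simp add: D_prod D_group D_finite group_prod_grp finite_prod_grp)
  also have "act ?P ?Q (prod_rel (contr_rel L K H) (Id_on (carrier G))) \<dots> =
      act ?P ?R (prod_rel (contr_rel L K H) (Id_on (carrier G)) O diag_rel G (L \<boxtimes> K) (K \<boxtimes> H))
        (gprod A ((L \<boxtimes> K) \<boxtimes> G) ((K \<boxtimes> H) \<boxtimes> G) \<beta> \<alpha>)"
    using D3 GD \<alpha> \<beta>
    by (intro act_comp_full subgroup_prod_rel subgroup_contr_rel subgroup_diag_rel subgroup_Id gprod_closed D_prod)
      (force simp: diag_rel_def carrier_prod_grp)+
  finally show ?thesis using contr_after_diag GD D3 by simp
qed

definition res :: "'a grp \<Rightarrow> 'a grp \<Rightarrow> 'm \<Rightarrow> 'm" where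
  "res G P = act P (P \<boxtimes> G) (res_rel G P)"

definition infl :: "'a grp \<Rightarrow> 'a grp \<Rightarrow> 'm \<Rightarrow> 'm" where
  "infl G P = act (P \<boxtimes> G) P (infl_rel G P)"

text \<open>
  The right action of the morphisms of the category of \<open>A\<close> on those of the category of \<open>A_G\<close>.
\<close>

definition mixed :: "'a grp \<Rightarrow> 'a grp \<Rightarrow> 'a grp \<Rightarrow> 'a grp \<Rightarrow> 'm \<Rightarrow> 'm \<Rightarrow> 'm" where
  "mixed G L K H x a = act ((L \<boxtimes> H) \<boxtimes> G) (((L \<boxtimes> K) \<boxtimes> G) \<boxtimes> (K \<boxtimes> H)) (mixed_rel G L K H)
     (gprod A ((L \<boxtimes> K) \<boxtimes> G) (K \<boxtimes> H) x a)"

lemma res_infl: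
  assumes "G \<in> D" "P \<in> D" "y \<in> carrier (fobj A P)"
  shows "res G P (infl G P y) = y"
proof -
  interpret G: group G using assms(1) by (rule D_group)
  have "res G P (infl G P y) = act P P (res_rel G P O infl_rel G P) y"
    unfolding res_def infl_def using assms
    by (intro act_comp_full subgroup_res_rel subgroup_infl_rel D_prod D_group)
      (auto simp: infl_rel_def carrier_prod_grp)
  also have "res_rel G P O infl_rel G P = Id_on (carrier P)"
    by (force simp: res_rel_def infl_rel_def)
  finally show ?thesis using act_Id assms by simp
qed

text \<open>
  Restricting a composite of \<open>A_G\<close> sets the diagonal \<open>g\<close> to \<open>1\<close>, and so does restricting both
  factors before they are composed.
\<close>

lemma res_PA_comp:
  assumes GD: "G \<in> D" and D3: "L \<in> D" "K \<in> D" "H \<in> D"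
    and \<beta>: "\<beta> \<in> carrier (fobj A ((L \<boxtimes> K) \<boxtimes> G))" and \<alpha>: "\<alpha> \<in> carrier (fobj A ((K \<boxtimes> H) \<boxtimes> G))"
  shows "res G (L \<boxtimes> H) (PA_comp k (shift_green k G A) L K H \<beta> \<alpha>) =
    PA_comp k A L K H (res G (L \<boxtimes> K) \<beta>) (res G (K \<boxtimes> H) \<alpha>)"
proof -
  interpret G: group G using GD by (rule D_group)
  let ?Q = "((L \<boxtimes> K) \<boxtimes> G) \<boxtimes> ((K \<boxtimes> H) \<boxtimes> G)"
  let ?z = "gprod A ((L \<boxtimes> K) \<boxtimes> G) ((K \<boxtimes> H) \<boxtimes> G) \<beta> \<alpha>"
  have z: "?z \<in> carrier (fobj A ?Q)" using assms by (intro gprod_closed D_prod)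
  have "res G (L \<boxtimes> H) (PA_comp k (shift_green k G A) L K H \<beta> \<alpha>) =
      act (L \<boxtimes> H) ?Q (res_rel G (L \<boxtimes> H) O shift_contr_rel G L K H) ?z"
    unfolding res_def shift_PA_comp_act[OF assms] using GD D3 z group.is_monoid[OF D_group[OF D3(2)]]
    by (intro act_comp_full subgroup_res_rel subgroup_shift_contr_rel D_prod D_group)
      (force simp: shift_contr_rel_def carrier_prod_grp dest: monoid.one_closed)+
  also have "res_rel G (L \<boxtimes> H) O shift_contr_rel G L K H =
      contr_rel L K H O prod_rel (res_rel G (L \<boxtimes> K)) (res_rel G (K \<boxtimes> H))"
  proof (rule Set.set_eqI)
    fix x
    have "x \<in> res_rel G (L \<boxtimes> H) O shift_contr_rel G L K H \<longleftrightarrow>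
        (\<exists>l\<in>carrier L. \<exists>k\<in>carrier K. \<exists>h\<in>carrier H.
          x = (Tup l h, Tup (Tup (Tup l k) \<one>\<^bsub>G\<^esub>) (Tup (Tup k h) \<one>\<^bsub>G\<^esub>)))"
      by (force simp: res_rel_def shift_contr_rel_def carrier_prod_grp)
    also have "\<dots> \<longleftrightarrow> x \<in> contr_rel L K H O prod_rel (res_rel G (L \<boxtimes> K)) (res_rel G (K \<boxtimes> H))"
      by (force simp: res_rel_def contr_rel_def prod_rel_def carrier_prod_grp)
    finally show "x \<in> res_rel G (L \<boxtimes> H) O shift_contr_rel G L K H \<longleftrightarrow>
        x \<in> contr_rel L K H O prod_rel (res_rel G (L \<boxtimes> K)) (res_rel G (K \<boxtimes> H))" .
  qed
  also have "act (L \<boxtimes> H) ?Q \<dots> ?z = act (L \<boxtimes> H) ((L \<boxtimes> K) \<boxtimes> (K \<boxtimes> H)) (contr_rel L K H)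
      (act ((L \<boxtimes> K) \<boxtimes> (K \<boxtimes> H)) ?Q (prod_rel (res_rel G (L \<boxtimes> K)) (res_rel G (K \<boxtimes> H))) ?z)"
    using GD D3 z
    by (intro act_comp_full[symmetric] subgroup_res_rel subgroup_contr_rel subgroup_prod_rel D_prod D_group)
      (force simp: res_rel_def prod_rel_def carrier_prod_grp)+
  also have "act ((L \<boxtimes> K) \<boxtimes> (K \<boxtimes> H)) ?Q (prod_rel (res_rel G (L \<boxtimes> K)) (res_rel G (K \<boxtimes> H))) ?z =
      gprod A (L \<boxtimes> K) (K \<boxtimes> H) (res G (L \<boxtimes> K) \<beta>) (res G (K \<boxtimes> H) \<alpha>)"
    unfolding res_def using GD D3 \<alpha> \<beta>
    by (intro gprod_act[symmetric] subgroup_res_rel D_prod D_group)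
  finally show ?thesis by (simp add: PA_comp_act[OF D3])
qed


text \<open>
  Both sides are obtained from the triple product \<open>x \<times> (\<beta> \<times> \<alpha>)\<close>, the right-hand one after
  reassociation, by contracting \<open>J\<close> and \<open>K\<close> and keeping the \<open>G\<close> of \<open>x\<close>: the inflation of \<open>\<alpha>\<close>
  imposes no condition on its own copy of \<open>G\<close>, which the diagonal identifies with that of \<open>x\<close>.
\<close>

lemma mixed_PA_comp:
  assumes GD: "G \<in> D" and D4: "L \<in> D" "J \<in> D" "K \<in> D" "H \<in> D"
    and x: "x \<in> carrier (fobj A ((L \<boxtimes> J) \<boxtimes> G))"
    and \<beta>: "\<beta> \<in> carrier (fobj A (J \<boxtimes> K))" and \<alpha>: "\<alpha> \<in> carrier (fobj A (K \<boxtimes> H))"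
  shows "mixed G L J H x (PA_comp k A J K H \<beta> \<alpha>) =
    PA_comp k (shift_green k G A) L K H (mixed G L J K x \<beta>) (infl G (K \<boxtimes> H) \<alpha>)"
proof -
  let ?P = "(L \<boxtimes> H) \<boxtimes> G" and ?X = "(L \<boxtimes> J) \<boxtimes> G" and ?B = "J \<boxtimes> K" and ?C = "K \<boxtimes> H"
  let ?Q = "((L \<boxtimes> K) \<boxtimes> G) \<boxtimes> (?C \<boxtimes> G)"
  let ?z = "gprod A ?X (?B \<boxtimes> ?C) x (gprod A ?B ?C \<beta> \<alpha>)"
  let ?Id = "Id_on (carrier ?X)" and ?m = "mixed_rel G L J"
  note DD = GD D4
  note sub = subgroup_prod_rel subgroup_contr_rel subgroup_Id subgroup_mixed_rel subgroup_infl_rel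
    subgroup_assoc_rel subgroup_shift_contr_rel
  have z: "?z \<in> carrier (fobj A (?X \<boxtimes> (?B \<boxtimes> ?C)))" using DD x \<beta> \<alpha> by (intro gprod_closed D_prod)
  have one: "\<one>\<^bsub>J\<^esub> \<in> carrier J" "\<one>\<^bsub>K\<^esub> \<in> carrier K"
    using DD D_group by (auto intro: monoid.one_closed group.is_monoid)
  have "mixed G L J H x (PA_comp k A J K H \<beta> \<alpha>) =
      act ?P (?X \<boxtimes> (J \<boxtimes> H)) (?m H) (gprod A ?X (J \<boxtimes> H) (act ?X ?X ?Id x)
        (act (J \<boxtimes> H) (?B \<boxtimes> ?C) (contr_rel J K H) (gprod A ?B ?C \<beta> \<alpha>)))"
    unfolding mixed_def PA_comp_act[OF D4(2-4)] using DD x by (simp add: act_Id D_prod)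
  also have "gprod A ?X (J \<boxtimes> H) (act ?X ?X ?Id x)
        (act (J \<boxtimes> H) (?B \<boxtimes> ?C) (contr_rel J K H) (gprod A ?B ?C \<beta> \<alpha>)) =
      act (?X \<boxtimes> (J \<boxtimes> H)) (?X \<boxtimes> (?B \<boxtimes> ?C)) (prod_rel ?Id (contr_rel J K H)) ?z"
    using DD x \<beta> \<alpha> by (intro gprod_act sub gprod_closed D_prod)
  also have "act ?P (?X \<boxtimes> (J \<boxtimes> H)) (?m H) \<dots> =
      act ?P (?X \<boxtimes> (?B \<boxtimes> ?C)) (?m H O prod_rel ?Id (contr_rel J K H)) ?z"
    using DD z one
    by (intro act_comp_full sub D_prod D_group) (force simp: prod_rel_def contr_rel_def carrier_prod_grp)+
  also have "?m H O prod_rel ?Id (contr_rel J K H) =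
      (shift_contr_rel G L K H O prod_rel (?m K) (infl_rel G ?C)) O assoc_rel ?X ?B ?C"
  proof (rule Set.set_eqI)
    fix y
    have "y \<in> ?m H O prod_rel ?Id (contr_rel J K H) \<longleftrightarrow>
        (\<exists>l\<in>carrier L. \<exists>h\<in>carrier H. \<exists>g\<in>carrier G. \<exists>j\<in>carrier J. \<exists>k\<in>carrier K.
          y = (Tup (Tup l h) g, Tup (Tup (Tup l j) g) (Tup (Tup j k) (Tup k h))))"
      by (force simp: prod_rel_def contr_rel_def mixed_rel_def carrier_prod_grp)
    also have "\<dots> \<longleftrightarrow> y \<in> (shift_contr_rel G L K H O prod_rel (?m K) (infl_rel G ?C)) O assoc_rel ?X ?B ?C"
      by (force simp: prod_rel_def shift_contr_rel_def mixed_rel_def infl_rel_def assoc_rel_def carrier_prod_grp)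
    finally show "y \<in> ?m H O prod_rel ?Id (contr_rel J K H) \<longleftrightarrow>
        y \<in> (shift_contr_rel G L K H O prod_rel (?m K) (infl_rel G ?C)) O assoc_rel ?X ?B ?C" .
  qed
  also have "act ?P (?X \<boxtimes> (?B \<boxtimes> ?C)) \<dots> ?z =
      act ?P ((?X \<boxtimes> ?B) \<boxtimes> ?C) (shift_contr_rel G L K H O prod_rel (?m K) (infl_rel G ?C))
        (act ((?X \<boxtimes> ?B) \<boxtimes> ?C) (?X \<boxtimes> (?B \<boxtimes> ?C)) (assoc_rel ?X ?B ?C) ?z)"
    using DD z
    by (intro act_comp_full[symmetric] sub subgroup_relcomp[where H = ?Q] D_prod D_group)
      (force simp: assoc_rel_def carrier_prod_grp)+
  also have "act ((?X \<boxtimes> ?B) \<boxtimes> ?C) (?X \<boxtimes> (?B \<boxtimes> ?C)) (assoc_rel ?X ?B ?C) ?z =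
      gprod A (?X \<boxtimes> ?B) ?C (gprod A ?X ?B x \<beta>) \<alpha>"
    using DD x \<beta> \<alpha>
    by (subst green_biset_functorD(4)[OF A]; simp add: D_prod)
      (subst fmor_presented[OF _ _ presented_assoc]; simp add: D_prod D_group D_finite group_prod_grp finite_prod_grp)
  also have "act ?P ((?X \<boxtimes> ?B) \<boxtimes> ?C) (shift_contr_rel G L K H O prod_rel (?m K) (infl_rel G ?C)) \<dots> =
      act ?P ?Q (shift_contr_rel G L K H)
        (act ?Q ((?X \<boxtimes> ?B) \<boxtimes> ?C) (prod_rel (?m K) (infl_rel G ?C)) (gprod A (?X \<boxtimes> ?B) ?C (gprod A ?X ?B x \<beta>) \<alpha>))"
    using DD x \<beta> \<alpha> one
    by (intro act_comp_full[symmetric] sub gprod_closed D_prod D_group)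
      (force simp: prod_rel_def mixed_rel_def infl_rel_def carrier_prod_grp)+
  also have "act ?Q ((?X \<boxtimes> ?B) \<boxtimes> ?C) (prod_rel (?m K) (infl_rel G ?C)) (gprod A (?X \<boxtimes> ?B) ?C (gprod A ?X ?B x \<beta>) \<alpha>) =
      gprod A ((L \<boxtimes> K) \<boxtimes> G) (?C \<boxtimes> G) (mixed G L J K x \<beta>) (infl G ?C \<alpha>)"
    unfolding mixed_def infl_def using DD x \<beta> \<alpha>
    by (intro gprod_act[symmetric] sub gprod_closed D_prod D_group)
  also have "act ?P ?Q (shift_contr_rel G L K H) \<dots> =
      PA_comp k (shift_green k G A) L K H (mixed G L J K x \<beta>) (infl G (K \<boxtimes> H) \<alpha>)"
    unfolding mixed_def infl_def using DD x \<beta> \<alpha>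
    by (intro shift_PA_comp_act[symmetric] act_closed sub gprod_closed D_prod D_group)
  finally show ?thesis .
qed

text \<open>
  Inserting the diagonal of \<open>H\<close> into the contraction returns \<open>x\<close> up to the unit isomorphism.  The second
  projection of the contraction and the first projection of the diagonal are both proper
  subgroups in general, so the single double coset has to be exhibited.
\<close>

lemma mixed_PA_id:
  assumes GD: "G \<in> D" and D2: "L \<in> D" "H \<in> D" and x: "x \<in> carrier (fobj A ((L \<boxtimes> H) \<boxtimes> G))"
  shows "mixed G L H H x (PA_id k A H) = x"
proof -
  interpret G: group G using GD by (rule D_group)
  interpret L: group L using D2(1) by (rule D_group)
  interpret H: group H using D2(2) by (rule D_group)
  let ?X = "(L \<boxtimes> H) \<boxtimes> G" and ?Y = "((L \<boxtimes> H) \<boxtimes> G) \<boxtimes> (H \<boxtimes> H)"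
  let ?z = "gprod A ?X triv_grp x (geps A)"
  let ?S = "prod_rel (Id_on (carrier ?X)) (rarrow_rel H)"
  note DD = GD D2 D_triv[OF GD]
  note e = green_biset_functorD(3)[OF A]
  have "mixed G L H H x (PA_id k A H) =
      act ?X ?Y (mixed_rel G L H H) (gprod A ?X (H \<boxtimes> H) (act ?X ?X (Id_on (carrier ?X)) x)
        (act (H \<boxtimes> H) triv_grp (rarrow_rel H) (geps A)))"
    unfolding mixed_def PA_id_def using DD x
    by (simp add: act_Id D_prod fmor_presented[OF _ _ presented_rarrow] D_group D_finite)
  also have "gprod A ?X (H \<boxtimes> H) (act ?X ?X (Id_on (carrier ?X)) x)
        (act (H \<boxtimes> H) triv_grp (rarrow_rel H) (geps A)) = act ?Y (?X \<boxtimes> triv_grp) ?S ?z"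
    using DD x e by (intro gprod_act subgroup_Id subgroup_rarrow_rel D_prod)
  also have "act ?X ?Y (mixed_rel G L H H) \<dots> = act ?X (?X \<boxtimes> triv_grp) (mixed_rel G L H H O ?S) ?z"
  proof (rule act_comp)
    show "subgroup (mixed_rel G L H H) (?X \<times>\<times> ?Y)" using DD by (intro subgroup_mixed_rel D_group)
    show "subgroup ?S (?Y \<times>\<times> (?X \<boxtimes> triv_grp))"
      using DD by (intro subgroup_prod_rel subgroup_Id subgroup_rarrow_rel D_prod)
    show "?z \<in> carrier (fobj A (?X \<boxtimes> triv_grp))" using DD x e by (intro gprod_closed D_prod)
    fix y assume "y \<in> carrier ?Y"
    then obtain l k g k' h where y: "y = Tup (Tup (Tup l k) g) (Tup k' h)"
      and c: "l \<in> carrier L" "k \<in> carrier H" "g \<in> carrier G" "k' \<in> carrier H" "h \<in> carrier H"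
      by (auto simp: carrier_prod_grp)
    \<comment> \<open>An element of the contraction has equal inner entries, here \<open>k'\<close>; the discrepancy with
      \<open>k\<close> is absorbed by the identity relation on \<open>(L \<times> H) \<times> G\<close>.\<close>
    let ?s = "Tup (Tup (Tup l k') g) (Tup k' h)"
    let ?t = "Tup (Tup (Tup \<one>\<^bsub>L\<^esub> (inv\<^bsub>H\<^esub> k' \<otimes>\<^bsub>H\<^esub> k)) \<one>\<^bsub>G\<^esub>) (Tup \<one>\<^bsub>H\<^esub> \<one>\<^bsub>H\<^esub>)"
    have "?s \<in> Range (mixed_rel G L H H)" using c by (force simp: mixed_rel_def)
    moreover have "?t \<in> Domain ?S" using c by (force simp: prod_rel_def rarrow_rel_def carrier_prod_grp)
    moreover have "y = ?s \<otimes>\<^bsub>?Y\<^esub> ?t"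
      using c by (simp add: y H.m_assoc[symmetric])
    ultimately show "\<exists>s\<in>Range (mixed_rel G L H H). \<exists>t\<in>Domain ?S. y = s \<otimes>\<^bsub>?Y\<^esub> t" by blast
  qed (use DD in \<open>auto intro: D_prod\<close>)
  also have "mixed_rel G L H H O ?S = runit_rel ?X"
  proof (rule Set.set_eqI)
    fix y
    have "y \<in> mixed_rel G L H H O ?S \<longleftrightarrow> (\<exists>l\<in>carrier L. \<exists>h\<in>carrier H. \<exists>g\<in>carrier G.
        y = (Tup (Tup l h) g, Tup (Tup (Tup l h) g) Unit))"
      by (force simp: prod_rel_def rarrow_rel_def mixed_rel_def carrier_prod_grp)
    also have "\<dots> \<longleftrightarrow> y \<in> runit_rel ?X"
      by (force simp: runit_rel_def carrier_prod_grp)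
    finally show "y \<in> mixed_rel G L H H O ?S \<longleftrightarrow> y \<in> runit_rel ?X" .
  qed
  also have "act ?X (?X \<boxtimes> triv_grp) (runit_rel ?X) ?z = x"
    using green_biset_functorD(5)[OF A _ x] DD
    by (simp add: D_prod fmor_presented[OF _ _ presented_runit] D_group D_finite)
  finally show ?thesis .
qed

lemma PA_comp_closed:
  assumes "L \<in> D" "K \<in> D" "H \<in> D" "\<beta> \<in> carrier (fobj A (L \<boxtimes> K))" "\<alpha> \<in> carrier (fobj A (K \<boxtimes> H))"
  shows "PA_comp k A L K H \<beta> \<alpha> \<in> carrier (fobj A (L \<boxtimes> H))"
  using assms by (simp add: PA_comp_act) (intro act_closed subgroup_contr_rel gprod_closed D_prod)

lemma shift_PA_comp_closed:
  assumes "G \<in> D" "L \<in> D" "K \<in> D" "H \<in> D"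
    "\<beta> \<in> carrier (fobj A ((L \<boxtimes> K) \<boxtimes> G))" "\<alpha> \<in> carrier (fobj A ((K \<boxtimes> H) \<boxtimes> G))"
  shows "PA_comp k (shift_green k G A) L K H \<beta> \<alpha> \<in> carrier (fobj A ((L \<boxtimes> H) \<boxtimes> G))"
  using assms
  by (simp add: shift_PA_comp_act) (intro act_closed subgroup_shift_contr_rel gprod_closed D_prod)

lemma PA_id_closed:
  assumes "H \<in> D"
  shows "PA_id k A H \<in> carrier (fobj A (H \<boxtimes> H))"
proof -
  have "PA_id k A H = act (H \<boxtimes> H) triv_grp (rarrow_rel H) (geps A)"
    unfolding PA_id_def using assms D_triv
    by (simp add: D_prod fmor_presented[OF _ _ presented_rarrow] D_group D_finite)
  then show ?thesis
    using assms D_triv green_biset_functorD(3)[OF A] by (simp add: act_closed subgroup_rarrow_rel D_prod)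
qed

lemma fobj_shift: "fobj (shift_green k G A) H = fobj A (H \<boxtimes> G)"
  by (simp add: shift_green_def)

lemma infl_closed: "G \<in> D \<Longrightarrow> P \<in> D \<Longrightarrow> a \<in> carrier (fobj A P) \<Longrightarrow> infl G P a \<in> carrier (fobj A (P \<boxtimes> G))"
  unfolding infl_def by (intro act_closed subgroup_infl_rel D_prod D_group)

lemma res_linear: "G \<in> D \<Longrightarrow> P \<in> D \<Longrightarrow> linear_map k (fobj A (P \<boxtimes> G)) (fobj A P) (res G P)"
  unfolding res_def by (intro act_linear subgroup_res_rel D_prod D_group)

lemma mixed_linear:
  assumes "G \<in> D" "L \<in> D" "K \<in> D" "H \<in> D" "x \<in> carrier (fobj A ((L \<boxtimes> K) \<boxtimes> G))"
  shows "linear_map k (fobj A (K \<boxtimes> H)) (fobj A ((L \<boxtimes> H) \<boxtimes> G)) (mixed G L K H x)"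
proof -
  have "linear_map k (fobj A (K \<boxtimes> H)) (fobj A (((L \<boxtimes> K) \<boxtimes> G) \<boxtimes> (K \<boxtimes> H)))
      (gprod A ((L \<boxtimes> K) \<boxtimes> G) (K \<boxtimes> H) x)"
    using green_biset_functorD(2)[OF A _ _ assms(5), of "K \<boxtimes> H"] assms(1-4) by (simp add: D_prod)
  moreover have "linear_map k (fobj A (((L \<boxtimes> K) \<boxtimes> G) \<boxtimes> (K \<boxtimes> H))) (fobj A ((L \<boxtimes> H) \<boxtimes> G))
      (act ((L \<boxtimes> H) \<boxtimes> G) (((L \<boxtimes> K) \<boxtimes> G) \<boxtimes> (K \<boxtimes> H)) (mixed_rel G L K H))"
    using assms(1-4) by (intro act_linear subgroup_mixed_rel D_prod D_group)
  ultimately show ?thesis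
    unfolding mixed_def by (rule linear_map_comp)
qed

lemma ess_supp_A:
  assumes "H \<in> D"
  shows "H \<in> ess_supp k D A \<longleftrightarrow> \<not> carrier (fobj A (H \<boxtimes> H)) \<subseteq> ess_ideal k D A H"
    "submodule (ess_ideal k D A H) k (fobj A (H \<boxtimes> H))"
  using ess_supp_iff[of k A H D] assms by (simp_all add: fobj_module D_prod PA_comp_closed)

lemma ess_supp_shift:
  assumes "G \<in> D" "H \<in> D"
  shows "H \<in> ess_supp k D (shift_green k G A) \<longleftrightarrow>
      \<not> carrier (fobj A ((H \<boxtimes> H) \<boxtimes> G)) \<subseteq> ess_ideal k D (shift_green k G A) H"
    "submodule (ess_ideal k D (shift_green k G A) H) k (fobj A ((H \<boxtimes> H) \<boxtimes> G))"
  using ess_supp_iff[of k "shift_green k G A" H D] assms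
  by (simp_all add: fobj_shift fobj_module D_prod shift_PA_comp_closed)

text \<open>
  By linearity it suffices to restrict composites through smaller groups.
\<close>

lemma res_ess_ideal:
  assumes GD: "G \<in> D" and HD: "H \<in> D" and x: "x \<in> ess_ideal k D (shift_green k G A) H"
  shows "res G (H \<boxtimes> H) x \<in> ess_ideal k D A H"
proof (rule linear_map_submod_gen[OF _ _ res_linear])
  show "x \<in> submod_gen k (fobj A ((H \<boxtimes> H) \<boxtimes> G)) (ess_gens k D (shift_green k G A) H)"
    using x by (simp add: ess_ideal_eq fobj_shift)
  show "submodule (ess_ideal k D A H) k (fobj A (H \<boxtimes> H))" using HD by (rule ess_supp_A)
  show "ess_gens k D (shift_green k G A) H \<subseteq> carrier (fobj A ((H \<boxtimes> H) \<boxtimes> G))"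
    using GD HD by (auto simp: ess_gens_def fobj_shift shift_PA_comp_closed)
  fix y assume "y \<in> ess_gens k D (shift_green k G A) H"
  then obtain K \<alpha> \<beta> where K: "K \<in> D" "order K < order H"
    and ab: "\<alpha> \<in> carrier (fobj A ((K \<boxtimes> H) \<boxtimes> G))" "\<beta> \<in> carrier (fobj A ((H \<boxtimes> K) \<boxtimes> G))"
    and y: "y = PA_comp k (shift_green k G A) H K H \<beta> \<alpha>"
    by (auto simp: ess_gens_def fobj_shift)
  have "res G (H \<boxtimes> H) y = PA_comp k A H K H (res G (H \<boxtimes> K) \<beta>) (res G (K \<boxtimes> H) \<alpha>)"
    unfolding y using GD HD K(1) HD ab(2,1) by (rule res_PA_comp)
  moreover have "res G (H \<boxtimes> K) \<beta> \<in> carrier (fobj A (H \<boxtimes> K))" "res G (K \<boxtimes> H) \<alpha> \<in> carrier (fobj A (K \<boxtimes> H))"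
    using ab GD HD K(1) linear_mapD(1)[OF res_linear] by (auto simp: D_prod)
  ultimately have "res G (H \<boxtimes> H) y \<in> ess_gens k D A H"
    using K unfolding ess_gens_def by blast
  then show "res G (H \<boxtimes> H) y \<in> ess_ideal k D A H"
    unfolding ess_ideal_eq by (rule subsetD[OF submod_gen_superset])
qed (use GD HD in \<open>auto intro: fobj_module D_prod\<close>)

lemma mixed_ess_ideal:
  assumes GD: "G \<in> D" and HD: "H \<in> D" and x: "x \<in> carrier (fobj A ((H \<boxtimes> H) \<boxtimes> G))"
    and a: "a \<in> ess_ideal k D A H"
  shows "mixed G H H H x a \<in> ess_ideal k D (shift_green k G A) H"
proof (rule linear_map_submod_gen[OF _ _ mixed_linear[OF GD HD HD HD x]])
  show "a \<in> submod_gen k (fobj A (H \<boxtimes> H)) (ess_gens k D A H)"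
    using a by (simp add: ess_ideal_eq)
  show "submodule (ess_ideal k D (shift_green k G A) H) k (fobj A ((H \<boxtimes> H) \<boxtimes> G))"
    using GD HD by (rule ess_supp_shift)
  show "ess_gens k D A H \<subseteq> carrier (fobj A (H \<boxtimes> H))"
    using HD by (auto simp: ess_gens_def PA_comp_closed)
  fix y assume "y \<in> ess_gens k D A H"
  then obtain K \<alpha> \<beta> where K: "K \<in> D" "order K < order H"
    and ab: "\<alpha> \<in> carrier (fobj A (K \<boxtimes> H))" "\<beta> \<in> carrier (fobj A (H \<boxtimes> K))"
    and y: "y = PA_comp k A H K H \<beta> \<alpha>"
    by (auto simp: ess_gens_def)
  have "mixed G H H H x y =
      PA_comp k (shift_green k G A) H K H (mixed G H H K x \<beta>) (infl G (K \<boxtimes> H) \<alpha>)"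
    unfolding y using GD HD HD K(1) HD x ab(2,1) by (rule mixed_PA_comp)
  moreover have "mixed G H H K x \<beta> \<in> carrier (fobj A ((H \<boxtimes> K) \<boxtimes> G))"
    using linear_mapD(1)[OF mixed_linear[OF GD HD HD K(1) x]] ab(2) .
  moreover have "infl G (K \<boxtimes> H) \<alpha> \<in> carrier (fobj A ((K \<boxtimes> H) \<boxtimes> G))"
    using ab GD HD K(1) by (intro infl_closed D_prod)
  ultimately have "mixed G H H H x y \<in> ess_gens k D (shift_green k G A) H"
    using K unfolding ess_gens_def fobj_shift by blast
  then show "mixed G H H H x y \<in> ess_ideal k D (shift_green k G A) H"
    unfolding ess_ideal_eq by (rule subsetD[OF submod_gen_superset])
qed (use GD HD in \<open>auto intro: fobj_module D_prod\<close>)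

lemma ess_supp_shift_eq:
  assumes GD: "G \<in> D"
  shows "ess_supp k D (shift_green k G A) = ess_supp k D A"
proof -
  have "H \<in> ess_supp k D (shift_green k G A) \<longleftrightarrow> H \<in> ess_supp k D A" if HD: "H \<in> D" for H
  proof -
    have "carrier (fobj A (H \<boxtimes> H)) \<subseteq> ess_ideal k D A H"
      if all: "carrier (fobj A ((H \<boxtimes> H) \<boxtimes> G)) \<subseteq> ess_ideal k D (shift_green k G A) H"
    proof
      fix y assume y: "y \<in> carrier (fobj A (H \<boxtimes> H))"
      have "infl G (H \<boxtimes> H) y \<in> ess_ideal k D (shift_green k G A) H"
        using all infl_closed[OF GD D_prod[OF HD HD] y] by blast
      then have "res G (H \<boxtimes> H) (infl G (H \<boxtimes> H) y) \<in> ess_ideal k D A H"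
        using GD HD by (intro res_ess_ideal)
      then show "y \<in> ess_ideal k D A H" using res_infl[OF GD D_prod[OF HD HD] y] by simp
    qed
    moreover have "carrier (fobj A ((H \<boxtimes> H) \<boxtimes> G)) \<subseteq> ess_ideal k D (shift_green k G A) H"
      if all: "carrier (fobj A (H \<boxtimes> H)) \<subseteq> ess_ideal k D A H"
    proof
      fix x assume x: "x \<in> carrier (fobj A ((H \<boxtimes> H) \<boxtimes> G))"
      have "mixed G H H H x (PA_id k A H) \<in> ess_ideal k D (shift_green k G A) H"
        using all PA_id_closed[OF HD] by (intro mixed_ess_ideal GD HD x) blast
      then show "x \<in> ess_ideal k D (shift_green k G A) H"
        using mixed_PA_id[OF GD HD HD x] by simp
    qed
    ultimately show ?thesis using ess_supp_A(1)[OF HD] ess_supp_shift(1)[OF GD HD] by blast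
  qed
  moreover have "ess_supp k D B \<subseteq> D" for B :: "('a, 'k, 'm) green_fun" by (auto simp: ess_supp_def)
  ultimately show ?thesis by blast
qed

end

theorem corollary4p4:
  fixes k :: "('k, 'r) ring_scheme"
    and D :: "'a grp set"
    and A :: "('a, 'k, 'm) green_fun"
  assumes "cring k"
    and "admissible D"
    and "green_biset_functor k D A"
  shows "\<forall>G\<in>D. ess_supp k D (shift_green k G A) = ess_supp k D A"
  using green_functor.ess_supp_shift_eq[OF green_functor.intro[OF assms]] by blast

end
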